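(* If $\theta_1:f\Rightarrow g$ and $\tau_1:g\Rightarrow h$ are 2-term $\infty$-homotopies between infinity morphisms $f,g,h:V\to W$ of 2-term Leibniz infinity algebras, then the vertical composite $\tau_1\circ_1\theta_1$ is given by $\tau_1+\theta_1$.
   Context: Work over a field $\mathbb K$ of characteristic zero, with homological grading; $s$ is the suspension. **2-term Leibniz infinity algebra**: $V=V_0\oplus V_1$ with linear, bilinear, trilinear maps $l_1,l_2,l_3$ of degrees $-1,0,1$ such that for $w,x,y,z\in V_0$, $h,k\in V_1$: (a) $l_1l_2(x,h)=l_2(x,l_1h)$, $l_1l_2(h,x)=l_2(l_1h,x)$; (b) $l_2(l_1h,k)=l_2(h,l_1k)$; (c) $l_1l_3(x,y,z)=l_2(x,l_2(y,z))-l_2(y,l_2(x,z))-l_2(l_2(x,y),z)$; (d) $l_3(x,y,l_1h)=l_2(x,l_2(y,h))-l_2(y,l_2(x,h))-l_2(l_2(x,y),h)$, $l_3(x,l_1h,y)=l_2(x,l_2(h,y))-l_2(h,l_2(x,y))-l_2(l_2(x,h),y)$, $l_3(l_1h,x,y)=l_2(h,l_2(x,y))-l_2(x,l_2(h,y))-l_2(l_2(h,x),y)$; (e) $l_2(l_3(w,x,y),z)+l_2(w,l_3(x,y,z))-l_2(x,l_3(w,y,z))+l_2(y,l_3(w,x,z))-l_3(l_2(w,x),y,z)+l_3(w,l_2(x,y),z)-l_3(x,l_2(w,y),z)-l_3(w,x,l_2(y,z))+l_3(w,y,l_2(x,z))-l_3(x,y,l_2(w,z))=0$. **Infinity morphism**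 $f=(f_1,f_2):(V,l_\bullet)\to(W,m_\bullet)$: linear $f_1$, bilinear $f_2$ of degrees $0,1$ with, for $x,y,z\in V_0$, $h\in V_1$: $m_1f_1h=f_1l_1h$; $m_2(f_1x,f_1y)+m_1f_2(x,y)=f_1l_2(x,y)$; $m_2(f_1x,f_1h)=f_1l_2(x,h)-f_2(x,l_1h)$; $m_2(f_1h,f_1x)=f_1l_2(h,x)-f_2(l_1h,x)$; $m_3(f_1x,f_1y,f_1z)-m_2(f_2(x,y),f_1z)+m_2(f_1x,f_2(y,z))-m_2(f_1y,f_2(x,z))=f_1l_3(x,y,z)+f_2(l_2(x,y),z)-f_2(x,l_2(y,z))+f_2(y,l_2(x,z))$. **2-term $\infty$-homotopy** $\theta_1:f\Rightarrow g$: a degree $1$ linear map $\theta_1:V\to W$ with, for $x,y\in V_0$, $h\in V_1$: $g_1x-f_1x=m_1\theta_1x$; $g_1h-f_1h=\theta_1l_1h$; $g_2(x,y)-f_2(x,y)=\theta_1l_2(x,y)-m_2(f_1x,\theta_1y)-m_2(\theta_1x,g_1y)$. Let $\mathcal T(f,g)$ be the set of these. **Convolution algebra.** $\mathrm{Zin}^c(sV)=\bigoplus_{n\ge1}(sV)^{\otimes n}$ has coproduct $\Delta(v_1\dots v_p)=\sum_{k=1}^{p-1}\sum_{\sigma\in\mathrm{Sh}(k,p-k-1)}\varepsilon(\sigma)(v_{\sigma(1)}\dots v_{\sigma(k)})\otimes(v_{\sigma(k+1)}\dots v_{\sigma(p-1)}v_p)$ and the coderivation $D$ with corestrictions $D_i$,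 $l_i=s^{-1}D_is^{\otimes i}$. $L=\mathrm{Hom}_{\mathbb K}(\mathrm{Zin}^c(sV),W)$ is a Lie infinity algebra: $\delta f:=\mathcal L_1f=m_1f+(-1)^ffD$, $\mathcal L_p(f_1,\dots,f_p)=m_p\circ\big(\sum_{\sigma\in S(p)}\varepsilon(\sigma)\mathrm{sign}(\sigma)f_{\sigma(1)}\otimes\dots\otimes f_{\sigma(p)}\big)\circ\Delta^{p-1}$ for $p\ge2$, where $\Delta^{p-1}=(\Delta\otimes\mathrm{id}^{\otimes(p-2)})\cdots(\Delta\otimes\mathrm{id})\Delta$. Maurer-Cartan elements of $(\mathfrak g,\ell_i)$: $\alpha\in\mathfrak g_{-1}$ with $\sum_{i\ge1}\frac1{i!}(-1)^{i(i-1)/2}\ell_i(\alpha,\dots,\alpha)=0$. Infinity morphisms $V\to W$ are identified with elements $\alpha$ of $\mathrm{MC}(L)$ via $f_p=\alpha^ps^{\otimes p}$, with $\alpha^p:(sV)^{\otimes p}\to W$. Note $L_0=\mathrm{Hom}(sV_0,W_1)$. **Simplices.** $\Omega^\star_n$ is the algebra of polynomial forms on the simplex $\Delta^n$ with vertices $e_0,\dots,e_n$, $k$-forms having degree $-k$; $\mathrm{MC}_n(\bar L)=\mathrm{MC}(L\otimes\Omega^\star_n)$ for the structure obtained by extension of scalars (with differential $\delta+d$). $\varepsilon_n^i$ is evaluation at $e_i$ (vanishing on forms of positive form degree), and $h_n^i\omega=\int_I(\phi_n^i)^*\omega$ with $\phi_n^i(u,\vec t)=u\vec t+(1-u)\vec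 e_i$, $u\in I=[0,1]$; both are extended to $L\otimes\Omega_n^\star$. For $\mu\in\mathrm{MC}(L)$ and $\nu=(\delta+d)\beta$ with $\beta\in(L\otimes\Omega_n^\star)_0$, $\varepsilon_n^i\beta=0$, let $\mathcal B_n^i(\mu,\nu)$ denote the unique $\alpha\in\mathrm{MC}_n(\bar L)$ with $\varepsilon_n^i\alpha=\mu$ and $(\delta+d)h_n^i\alpha=\nu$. For $\alpha\in\mathrm{MC}_1(\bar L)$ with $\varepsilon_1^0\alpha=f$, $\varepsilon_1^1\alpha=g$, set $S_1^0\alpha=(\beta(1)-\beta(0))s$ with $\beta=h_1^0\alpha$; this is an element of $\mathcal T(f,g)$. **Vertical composite** $\tau_1\circ_1\theta_1$, defined by the following procedure. Choose $\beta',\beta''\in L_0\otimes\Omega^0(\Delta^1)$ with $\beta'(0)=-\theta_1s^{-1}$, $\beta'(1)=0$, $\beta''(0)=0$, $\beta''(1)=\tau_1s^{-1}$, giving lifts $\alpha'=\mathcal B_1^1(g,(\delta+d)\beta')$ and $\alpha''=\mathcal B_1^0(g,(\delta+d)\beta'')$ of $\theta_1$ and $\tau_1$ in $\mathrm{MC}_1(\bar L)$. Regard $\beta'$ and $\beta''$ as defined on the faces $01$ and $12$ of $\Delta^2$, choose any extension $\beta\in L_0\otimes\Omega^0(\Delta^2)$ of $(\beta',\beta'')$, and let $\alpha=\mathcal B_2^1(g,(\delta+d)\beta)\in\mathrm{MC}_2(\bar L)$. Its restriction $\alpha|_{02}$ to the face $02\cong\Delta^1$ is a composite of $\alpha',\alpha''$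 in the Kan complex $\mathrm{MC}_\bullet(\bar L)$, and $\tau_1\circ_1\theta_1:=S_1^0(\alpha|_{02})\in\mathcal T(f,h)$. *)

theory Defs
  imports Complex_Main "HOL-Library.Poly_Mapping" "HOL-Library.Function_Algebras"
    "HOL-Library.Product_Plus" "HOL-Combinatorics.Permutations"
begin

section \<open>2-term Leibniz infinity algebras, morphisms and homotopies\<close>

text \<open>
  The graded vector space is \<open>'a \<times> 'b\<close>, with \<open>'a\<close> in degree 0 and \<open>'b\<close> in degree 1.
  The fields \<open>l2_ij\<close> are the components of the degree 0 map \<open>l\<^sub>2\<close>; its component on two elements
  of degree 1 vanishes for degree reasons, as do the omitted components of \<open>l\<^sub>1\<close> and \<open>l\<^sub>3\<close>.
\<close>

record ('k, 'a, 'b) leibniz2 =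
  scl0 :: "'k \<Rightarrow> 'a \<Rightarrow> 'a"
  scl1 :: "'k \<Rightarrow> 'b \<Rightarrow> 'b"
  l1 :: "'b \<Rightarrow> 'a"
  l2_00 :: "'a \<Rightarrow> 'a \<Rightarrow> 'a"
  l2_01 :: "'a \<Rightarrow> 'b \<Rightarrow> 'b"
  l2_10 :: "'b \<Rightarrow> 'a \<Rightarrow> 'b"
  l3 :: "'a \<Rightarrow> 'a \<Rightarrow> 'a \<Rightarrow> 'b"

definition bilinear_map ::
  "('k::field \<Rightarrow> 'a::ab_group_add \<Rightarrow> 'a) \<Rightarrow> ('k \<Rightarrow> 'b::ab_group_add \<Rightarrow> 'b) \<Rightarrow>
   ('k \<Rightarrow> 'c::ab_group_add \<Rightarrow> 'c) \<Rightarrow> ('a \<Rightarrow> 'b \<Rightarrow> 'c) \<Rightarrow> bool" where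
  "bilinear_map s1 s2 s3 f \<longleftrightarrow>
     (\<forall>x. Vector_Spaces.linear s2 s3 (\<lambda>y. f x y)) \<and> (\<forall>y. Vector_Spaces.linear s1 s3 (\<lambda>x. f x y))"

locale two_term_leibniz =
  fixes V :: "('k::field_char_0, 'a::ab_group_add, 'b::ab_group_add) leibniz2"
  assumes vs0: "vector_space (scl0 V)"
    and vs1: "vector_space (scl1 V)"
    and l1_linear: "Vector_Spaces.linear (scl1 V) (scl0 V) (l1 V)"
    and l2_00_bilinear: "bilinear_map (scl0 V) (scl0 V) (scl0 V) (l2_00 V)"
    and l2_01_bilinear: "bilinear_map (scl0 V) (scl1 V) (scl1 V) (l2_01 V)"
    and l2_10_bilinear: "bilinear_map (scl1 V) (scl0 V) (scl1 V) (l2_10 V)"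
    and l3_linear1: "\<And>y z. Vector_Spaces.linear (scl0 V) (scl1 V) (\<lambda>x. l3 V x y z)"
    and l3_linear2: "\<And>x z. Vector_Spaces.linear (scl0 V) (scl1 V) (\<lambda>y. l3 V x y z)"
    and l3_linear3: "\<And>x y. Vector_Spaces.linear (scl0 V) (scl1 V) (\<lambda>z. l3 V x y z)"
    and ax_a1: "\<And>x h. l1 V (l2_01 V x h) = l2_00 V x (l1 V h)"
    and ax_a2: "\<And>x h. l1 V (l2_10 V h x) = l2_00 V (l1 V h) x"
    and ax_b: "\<And>h k. l2_01 V (l1 V h) k = l2_10 V h (l1 V k)"
    and ax_c: "\<And>x y z. l1 V (l3 V x y z) =
      l2_00 V x (l2_00 V y z) - l2_00 V y (l2_00 V x z) - l2_00 V (l2_00 V x y) z"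
    and ax_d1: "\<And>x y h. l3 V x y (l1 V h) =
      l2_01 V x (l2_01 V y h) - l2_01 V y (l2_01 V x h) - l2_01 V (l2_00 V x y) h"
    and ax_d2: "\<And>x h y. l3 V x (l1 V h) y =
      l2_01 V x (l2_10 V h y) - l2_10 V h (l2_00 V x y) - l2_10 V (l2_01 V x h) y"
    and ax_d3: "\<And>h x y. l3 V (l1 V h) x y =
      l2_10 V h (l2_00 V x y) - l2_01 V x (l2_10 V h y) - l2_10 V (l2_10 V h x) y"
    and ax_e: "\<And>w x y z.
      l2_10 V (l3 V w x y) z + l2_01 V w (l3 V x y z) - l2_01 V x (l3 V w y z)
      + l2_01 V y (l3 V w x z) - l3 V (l2_00 V w x) y z + l3 V w (l2_00 V x y) z
      - l3 V x (l2_00 V w y) z - l3 V w x (l2_00 V y z) + l3 V w y (l2_00 V x z)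
      - l3 V x y (l2_00 V w z) = 0"

text \<open>\<open>f\<^sub>1\<close> has the components \<open>mor0\<close> and \<open>mor1\<close>; \<open>f\<^sub>2\<close> is \<open>mor2\<close>.\<close>

record ('a, 'b, 'c, 'd) leibniz2_mor =
  mor0 :: "'a \<Rightarrow> 'c"
  mor1 :: "'b \<Rightarrow> 'd"
  mor2 :: "'a \<Rightarrow> 'a \<Rightarrow> 'd"

locale infinity_morphism =
  fixes V :: "('k::field_char_0, 'a::ab_group_add, 'b::ab_group_add) leibniz2"
    and W :: "('k, 'c::ab_group_add, 'd::ab_group_add) leibniz2"
    and f :: "('a, 'b, 'c, 'd) leibniz2_mor"
  assumes mor0_linear: "Vector_Spaces.linear (scl0 V) (scl0 W) (mor0 f)"
    and mor1_linear: "Vector_Spaces.linear (scl1 V) (scl1 W) (mor1 f)"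
    and mor2_bilinear: "bilinear_map (scl0 V) (scl0 V) (scl1 W) (mor2 f)"
    and mor_l1: "\<And>h. l1 W (mor1 f h) = mor0 f (l1 V h)"
    and mor_l2_00: "\<And>x y. l2_00 W (mor0 f x) (mor0 f y) + l1 W (mor2 f x y) = mor0 f (l2_00 V x y)"
    and mor_l2_01: "\<And>x h. l2_01 W (mor0 f x) (mor1 f h) = mor1 f (l2_01 V x h) - mor2 f x (l1 V h)"
    and mor_l2_10: "\<And>h x. l2_10 W (mor1 f h) (mor0 f x) = mor1 f (l2_10 V h x) - mor2 f (l1 V h) x"
    and mor_l3: "\<And>x y z.
      l3 W (mor0 f x) (mor0 f y) (mor0 f z) - l2_10 W (mor2 f x y) (mor0 f z)
      + l2_01 W (mor0 f x) (mor2 f y z) - l2_01 W (mor0 f y) (mor2 f x z)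
      = mor1 f (l3 V x y z) + mor2 f (l2_00 V x y) z - mor2 f x (l2_00 V y z) + mor2 f y (l2_00 V x z)"

text \<open>A degree 1 linear map \<open>V \<rightarrow> W\<close> is a linear map from degree 0 of \<open>V\<close> to degree 1 of \<open>W\<close>.\<close>

definition homotopies ::
  "('k::field_char_0, 'a::ab_group_add, 'b::ab_group_add) leibniz2 \<Rightarrow>
   ('k, 'c::ab_group_add, 'd::ab_group_add) leibniz2 \<Rightarrow>
   ('a, 'b, 'c, 'd) leibniz2_mor \<Rightarrow> ('a, 'b, 'c, 'd) leibniz2_mor \<Rightarrow> ('a \<Rightarrow> 'd) set" where
  "homotopies V W f g = {\<theta>.
     Vector_Spaces.linear (scl0 V) (scl1 W) \<theta> \<and>
     (\<forall>x. mor0 g x - mor0 f x = l1 W (\<theta> x)) \<and>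
     (\<forall>h. mor1 g h - mor1 f h = \<theta> (l1 V h)) \<and>
     (\<forall>x y. mor2 g x y - mor2 f x y =
        \<theta> (l2_00 V x y) - l2_01 W (mor0 f x) (\<theta> y) - l2_10 W (\<theta> x) (mor0 g y))}"

text \<open>Scalar multiplication and the multilinear operations on all of \<open>V = V\<^sub>0 \<oplus> V\<^sub>1\<close>; the \<open>i\<close>-ary
  operation is applied to the list of its \<open>i\<close> arguments and is zero for \<open>i > 3\<close>.\<close>

definition scl :: "('k, 'a, 'b) leibniz2 \<Rightarrow> 'k \<Rightarrow> 'a \<times> 'b \<Rightarrow> 'a \<times> 'b" where
  "scl V c v = (scl0 V c (fst v), scl1 V c (snd v))"

fun ops :: "('k, 'a::ab_group_add, 'b::ab_group_add) leibniz2 \<Rightarrow> ('a \<times> 'b) list \<Rightarrow> 'a \<times> 'b" where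
  "ops V [u] = (l1 V (snd u), 0)"
| "ops V [u, v] = (l2_00 V (fst u) (fst v), l2_01 V (fst u) (snd v) + l2_10 V (snd u) (fst v))"
| "ops V [u, v, w] = (0, l3 V (fst u) (fst v) (fst w))"
| "ops V _ = 0"


section \<open>Formal linear combinations and signs\<close>

definition pscale :: "'k::field \<Rightarrow> ('x \<Rightarrow>\<^sub>0 'k) \<Rightarrow> ('x \<Rightarrow>\<^sub>0 'k)" where
  "pscale c p = Poly_Mapping.map ((*) c) p"

text \<open>Linear extension of \<open>f\<close> to formal combinations; \<open>s\<close> is the scalar multiplication of the target.\<close>

definition lin_ext :: "('k::field \<Rightarrow> 'y \<Rightarrow> 'y::comm_monoid_add) \<Rightarrow> ('x \<Rightarrow> 'y) \<Rightarrow> ('x \<Rightarrow>\<^sub>0 'k) \<Rightarrow> 'y" where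
  "lin_ext s f p = (\<Sum>x\<in>Poly_Mapping.keys p. s (Poly_Mapping.lookup p x) (f x))"

text \<open>Positions are counted from 0. \<open>koszul ds \<sigma>\<close> is the sign \<open>\<epsilon>(\<sigma>)\<close> in
  \<open>v\<^sub>0 \<dots> v\<^sub>n = \<epsilon>(\<sigma>) v\<^bsub>\<sigma>(0)\<^esub> \<dots> v\<^bsub>\<sigma>(n)\<^esub>\<close> for graded commuting symbols of degrees \<open>ds\<close>.\<close>

definition koszul :: "int list \<Rightarrow> (nat \<Rightarrow> nat) \<Rightarrow> 'k::field" where
  "koszul ds \<sigma> = (\<Prod>j<length ds. \<Prod>i<j. if \<sigma> j < \<sigma> i then (- 1) powi (ds ! \<sigma> i * ds ! \<sigma> j) else 1)"

definition Sh :: "nat \<Rightarrow> nat \<Rightarrow> (nat \<Rightarrow> nat) set" where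
  "Sh p q = {\<sigma>. \<sigma> permutes {..<p + q} \<and> strict_mono_on {..<p} \<sigma> \<and> strict_mono_on {p..<p + q} \<sigma>}"

text \<open>The sign of \<open>(f\<^sub>0 \<otimes> \<dots> \<otimes> f\<^sub>n) (a\<^sub>0 \<otimes> \<dots> \<otimes> a\<^sub>n) = \<plusminus> f\<^sub>0 a\<^sub>0 \<otimes> \<dots> \<otimes> f\<^sub>n a\<^sub>n\<close>, where the \<open>f\<^sub>j\<close> have
  degrees \<open>ds\<close> and the \<open>a\<^sub>i\<close> have degrees \<open>es\<close>: each \<open>f\<^sub>j\<close> passes the \<open>a\<^sub>i\<close> with \<open>i < j\<close>.\<close>

definition interchange_sign :: "int list \<Rightarrow> int list \<Rightarrow> 'k::field" where
  "interchange_sign ds es = (- 1) powi (\<Sum>j<length ds. \<Sum>i<j. ds ! j * es ! i)"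


section \<open>The Zinbiel coalgebra of \<open>sV\<close>\<close>

text \<open>
  A word lists homogeneous elements \<open>v\<^sub>1, \<dots>, v\<^sub>p\<close> of \<open>V\<close> and stands for \<open>sv\<^sub>1 \<dots> sv\<^sub>p\<close>.
  Elements of \<open>Zin\<^sup>c(sV)\<close> and of its tensor powers are represented by formal linear combinations
  of words, or of lists of words; these representatives are only ever evaluated on multilinear maps.
\<close>

type_synonym ('a, 'b) word = "('a + 'b) list"

definition vdeg :: "'a + 'b \<Rightarrow> int" where
  "vdeg v = (case v of Inl _ \<Rightarrow> 0 | Inr _ \<Rightarrow> 1)"

definition sdeg :: "'a + 'b \<Rightarrow> int" where
  "sdeg v = vdeg v + 1"

definition wdeg :: "('a, 'b) word \<Rightarrow> int" where
  "wdeg w = sum_list (map sdeg w)"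

definition emb :: "'a::zero + 'b::zero \<Rightarrow> 'a \<times> 'b" where
  "emb v = (case v of Inl x \<Rightarrow> (x, 0) | Inr h \<Rightarrow> (0, h))"

text \<open>The coproduct: the first \<open>p - 1\<close> letters are unshuffled, the last letter stays last in the
  second factor.\<close>

definition coprod :: "('a, 'b) word \<Rightarrow> ('a, 'b) word list \<Rightarrow>\<^sub>0 'k::field" where
  "coprod w = (\<Sum>k\<in>{1..<length w}. \<Sum>\<sigma>\<in>Sh k (length w - k - 1).
     let u = permute_list \<sigma> (butlast w)
     in Poly_Mapping.single [take k u, drop k u @ [last w]] (koszul (map sdeg (butlast w)) \<sigma>))"

text \<open>\<open>coprod_iter p\<close> is \<open>\<Delta>\<^sup>p\<close>, with values in the \<open>(p + 1)\<close>-fold tensor power.\<close>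

primrec coprod_iter :: "nat \<Rightarrow> ('a, 'b) word \<Rightarrow> ('a, 'b) word list \<Rightarrow>\<^sub>0 'k::field" where
  "coprod_iter 0 w = Poly_Mapping.single [w] 1"
| "coprod_iter (Suc p) w =
     lin_ext pscale (\<lambda>ws. lin_ext pscale (\<lambda>ab. Poly_Mapping.single (ab @ tl ws) 1) (coprod (hd ws)))
       (coprod_iter p w)"

text \<open>
  The corestriction \<open>D\<^sub>i\<close>, from \<open>l\<^sub>i = s\<^sup>-\<^sup>1 D\<^sub>i s\<^sup>\<otimes>\<^sup>i\<close> and
  \<open>s\<^sup>\<otimes>\<^sup>i (v\<^sub>1 \<otimes> \<dots> \<otimes> v\<^sub>i) = (-1)^(\<Sum>\<^sub>j (i - j) |v\<^sub>j|) sv\<^sub>1 \<otimes> \<dots> \<otimes> sv\<^sub>i\<close>; here \<open>k\<close> is the degree of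
  \<open>l\<^sub>i(v\<^sub>1, \<dots>, v\<^sub>i)\<close>.
\<close>

definition corestr ::
  "('k::field, 'a::ab_group_add, 'b::ab_group_add) leibniz2 \<Rightarrow> ('a, 'b) word \<Rightarrow> ('a + 'b) \<Rightarrow>\<^sub>0 'k" where
  "corestr V w =
    (let v = ops V (map emb w);
         k = sum_list (map vdeg w) + int (length w) - 2;
         e = (\<Sum>j<length w. int (length w - Suc j) * vdeg (w ! j))
     in if k = 0 then Poly_Mapping.single (Inl (fst v)) ((- 1) powi e)
        else if k = 1 then Poly_Mapping.single (Inr (snd v)) ((- 1) powi e)
        else 0)"

text \<open>
  The coderivation of \<open>Zin\<^sup>c(sV)\<close> with corestrictions \<open>D\<^sub>i\<close>:
  \<open>D(v\<^sub>1 \<dots> v\<^sub>p) = \<Sum>\<^bsub>1\<le>i\<le>j\<le>p\<^esub> \<Sum>\<^bsub>\<sigma>\<in>Sh(j-i,i-1)\<^esub> \<epsilon>(\<sigma>) (-1)^(|v\<^bsub>\<sigma>(1)\<^esub>| + \<dots> + |v\<^bsub>\<sigma>(j-i)\<^esub>|)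
     v\<^bsub>\<sigma>(1)\<^esub> \<dots> v\<^bsub>\<sigma>(j-i)\<^esub> D\<^sub>i(v\<^bsub>\<sigma>(j-i+1)\<^esub>, \<dots>, v\<^bsub>\<sigma>(j-1)\<^esub>, v\<^sub>j) v\<^bsub>j+1\<^esub> \<dots> v\<^sub>p\<close>.
\<close>

definition coder ::
  "('k::field, 'a::ab_group_add, 'b::ab_group_add) leibniz2 \<Rightarrow> ('a, 'b) word \<Rightarrow> ('a, 'b) word \<Rightarrow>\<^sub>0 'k" where
  "coder V w = (\<Sum>i\<in>{1..length w}. \<Sum>j\<in>{i..length w}. \<Sum>\<sigma>\<in>Sh (j - i) (i - 1).
     let u = permute_list \<sigma> (take (j - 1) w)
     in lin_ext pscale
          (\<lambda>v. Poly_Mapping.single (take (j - i) u @ v # drop j w)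
             (koszul (map sdeg (take (j - 1) w)) \<sigma> * (- 1) powi wdeg (take (j - i) u)))
          (corestr V (drop (j - i) u @ [w ! (j - 1)])))"


section \<open>The convolution Lie infinity algebra\<close>

text \<open>Linear maps \<open>Zin\<^sup>c(sV) \<rightarrow> W\<close> are functions on words that are linear in each letter; the
  empty word does not belong to \<open>Zin\<^sup>c(sV)\<close> and is given the value 0.\<close>

type_synonym ('a, 'b, 'c, 'd) conv = "('a, 'b) word \<Rightarrow> 'c \<times> 'd"

definition conv_deg ::
  "('k::field, 'a::ab_group_add, 'b::ab_group_add) leibniz2 \<Rightarrow>
   ('k, 'c::ab_group_add, 'd::ab_group_add) leibniz2 \<Rightarrow> int \<Rightarrow> ('a, 'b, 'c, 'd) conv set" where
  "conv_deg V W k = {F. F [] = 0 \<and>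
     (\<forall>u w. Vector_Spaces.linear (scl0 V) (scl W) (\<lambda>x. F (u @ Inl x # w))) \<and>
     (\<forall>u w. Vector_Spaces.linear (scl1 V) (scl W) (\<lambda>h. F (u @ Inr h # w))) \<and>
     (\<forall>w. wdeg w + k \<noteq> 0 \<longrightarrow> fst (F w) = 0) \<and>
     (\<forall>w. wdeg w + k \<noteq> 1 \<longrightarrow> snd (F w) = 0)}"

definition conv_scale ::
  "('k, 'c, 'd) leibniz2 \<Rightarrow> 'k \<Rightarrow> ('a, 'b, 'c, 'd) conv \<Rightarrow> ('a, 'b, 'c, 'd) conv" where
  "conv_scale W c F = (\<lambda>w. scl W c (F w))"

text \<open>Homogeneous elements are passed together with their degree.\<close>

definition conv_diff ::
  "('k::field, 'a::ab_group_add, 'b::ab_group_add) leibniz2 \<Rightarrow>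
   ('k, 'c::ab_group_add, 'd::ab_group_add) leibniz2 \<Rightarrow>
   int \<Rightarrow> ('a, 'b, 'c, 'd) conv \<Rightarrow> ('a, 'b, 'c, 'd) conv" where
  "conv_diff V W k F = (\<lambda>w. ops W [F w] + scl W ((- 1) powi k) (lin_ext (scl W) F (coder V w)))"

definition conv_bracket ::
  "('k::field, 'c::ab_group_add, 'd::ab_group_add) leibniz2 \<Rightarrow>
   (int \<times> ('a, 'b, 'c, 'd) conv) list \<Rightarrow> ('a, 'b, 'c, 'd) conv" where
  "conv_bracket W Fs = (\<lambda>w. \<Sum>\<sigma> | \<sigma> permutes {..<length Fs}.
     scl W (koszul (map fst Fs) \<sigma> * of_int (sign \<sigma>))
       (lin_ext (scl W)
          (\<lambda>ws. let Gs = permute_list \<sigma> Fs in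
             scl W (interchange_sign (map fst Gs) (map wdeg ws)) (ops W (map2 (\<lambda>G a. snd G a) Gs ws)))
          (coprod_iter (length Fs - 1) w)))"

text \<open>The identification \<open>f\<^sub>p = \<alpha>\<^sup>p s\<^sup>\<otimes>\<^sup>p\<close>; no signs occur since \<open>f\<^sub>2\<close> lives on degree 0.\<close>

fun mc_of :: "('a, 'b, 'c::zero, 'd::zero) leibniz2_mor \<Rightarrow> ('a, 'b, 'c, 'd) conv" where
  "mc_of f [Inl x] = (mor0 f x, 0)"
| "mc_of f [Inr h] = (0, mor1 f h)"
| "mc_of f [Inl x, Inl y] = (0, mor2 f x y)"
| "mc_of f _ = (0, 0)"

text \<open>The element \<open>\<theta> s\<^sup>-\<^sup>1\<close> of degree 0.\<close>

fun desusp :: "('a \<Rightarrow> 'd::zero) \<Rightarrow> ('a, 'b, 'c::zero, 'd) conv" where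
  "desusp \<theta> [Inl x] = (0, \<theta> x)"
| "desusp \<theta> _ = (0, 0)"


section \<open>Polynomial forms on simplices\<close>

text \<open>
  \<open>\<Delta>\<^sup>n\<close> has the affine coordinates \<open>t\<^sub>1, \<dots>, t\<^sub>n\<close> with \<open>t\<^sub>0 = 1 - t\<^sub>1 - \<dots> - t\<^sub>n\<close>, so the monomials
  \<open>t\<^sup>a dt\<^sub>I\<close> (differentials in increasing order) with indices in \<open>{1..n}\<close> are a basis of its
  polynomial forms; \<open>(a, I)\<close> stands for \<open>t\<^sup>a dt\<^sub>I\<close>. In these coordinates, \<open>e\<^sub>i\<close> is the point
  with \<open>t\<^sub>j = \<delta>\<^sub>i\<^sub>j\<close>. On \<open>I \<times> \<Delta>\<^sup>n\<close>, the free index 0 is used for the coordinate \<open>u\<close> of \<open>I\<close>.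
\<close>

type_synonym mono_form = "(nat \<Rightarrow>\<^sub>0 nat) \<times> nat set"
type_synonym 'k form = "mono_form \<Rightarrow>\<^sub>0 'k"

definition simplex_basis :: "nat \<Rightarrow> mono_form set" where
  "simplex_basis n = {(a, I). Poly_Mapping.keys a \<subseteq> {1..n} \<and> I \<subseteq> {1..n}}"

definition fdeg :: "mono_form \<Rightarrow> nat" where
  "fdeg b = card (snd b)"

definition form_one :: "'k::field form" where
  "form_one = Poly_Mapping.single (0, {}) 1"

definition coord :: "nat \<Rightarrow> 'k::field form" where
  "coord j = Poly_Mapping.single (Poly_Mapping.single j 1, {}) 1"

fun wedge_mono :: "mono_form \<Rightarrow> mono_form \<Rightarrow> 'k::field form" where
  "wedge_mono (a, I) (b, J) =
     (if I \<inter> J = {} then Poly_Mapping.single (a + b, I \<union> J) ((- 1) ^ card {(i, j). i \<in> I \<and> j \<in> J \<and> j < i})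
      else 0)"

definition wedge :: "'k::field form \<Rightarrow> 'k form \<Rightarrow> 'k form" where
  "wedge p q = lin_ext pscale (\<lambda>b. lin_ext pscale (\<lambda>c. wedge_mono b c) q) p"

definition wedge_list :: "'k::field form list \<Rightarrow> 'k form" where
  "wedge_list ps = foldr wedge ps form_one"

text \<open>\<open>d (t\<^sup>a dt\<^sub>I) = \<Sum>\<^sub>j (\<partial>t\<^sup>a / \<partial>t\<^sub>j) dt\<^sub>j \<and> dt\<^sub>I\<close>.\<close>

definition d_mono :: "mono_form \<Rightarrow> 'k::field form" where
  "d_mono b = (\<Sum>j\<in>Poly_Mapping.keys (fst b).
     pscale (of_nat (Poly_Mapping.lookup (fst b) j))
       (wedge_mono (fst b - Poly_Mapping.single j 1, {j}) (0, snd b)))"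

text \<open>Pullback along a polynomial map whose \<open>j\<close>-th coordinate is \<open>\<phi> j\<close>.\<close>

definition pull_mono :: "(nat \<Rightarrow> 'k::field form) \<Rightarrow> mono_form \<Rightarrow> 'k form" where
  "pull_mono \<phi> b = wedge
     (wedge_list (map (\<lambda>j. wedge_list (replicate (Poly_Mapping.lookup (fst b) j) (\<phi> j)))
        (sorted_list_of_set (Poly_Mapping.keys (fst b)))))
     (wedge_list (map (\<lambda>j. lin_ext pscale d_mono (\<phi> j)) (sorted_list_of_set (snd b))))"

text \<open>The affine map \<open>\<Delta>\<^sup>m \<rightarrow> \<Delta>\<^sup>n\<close> with \<open>e\<^sub>k \<mapsto> e\<^bsub>v k\<^esub>\<close>.\<close>

definition bary :: "nat \<Rightarrow> nat \<Rightarrow> 'k::field form" where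
  "bary m k = (if k = 0 then form_one - (\<Sum>i\<in>{1..m}. coord i) else coord k)"

definition simplicial_map :: "nat \<Rightarrow> (nat \<Rightarrow> nat) \<Rightarrow> nat \<Rightarrow> 'k::field form" where
  "simplicial_map m v j = (\<Sum>k | k \<le> m \<and> v k = j. bary m k)"

text \<open>\<open>\<epsilon>\<^sup>i\<close>: evaluation at \<open>e\<^sub>i\<close>.\<close>

definition eval_mono :: "nat \<Rightarrow> mono_form \<Rightarrow> 'k::field" where
  "eval_mono i b = (if snd b = {}
     then \<Prod>j\<in>Poly_Mapping.keys (fst b). of_bool (j = i) ^ Poly_Mapping.lookup (fst b) j else 0)"

text \<open>\<open>h\<^sup>i\<close>: pullback along \<open>\<phi>(u, t) = u t + (1 - u) e\<^sub>i\<close>, then integration over \<open>u \<in> [0, 1]\<close> of the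
  coefficient of \<open>du\<close> (which stands leftmost, having index 0).\<close>

definition homotopy_map :: "nat \<Rightarrow> nat \<Rightarrow> 'k::field form" where
  "homotopy_map i j = wedge (coord 0) (coord j) + (if j = i then form_one - coord 0 else 0)"

definition integrate_mono :: "mono_form \<Rightarrow> 'k::field form" where
  "integrate_mono b = (if 0 \<in> snd b
     then Poly_Mapping.single
       (fst b - Poly_Mapping.single 0 (Poly_Mapping.lookup (fst b) 0), snd b - {0})
       (inverse (of_nat (Poly_Mapping.lookup (fst b) 0 + 1)))
     else 0)"

definition h_mono :: "nat \<Rightarrow> mono_form \<Rightarrow> 'k::field form" where
  "h_mono i b = lin_ext pscale integrate_mono (pull_mono (homotopy_map i) b)"


section \<open>Extension of scalars to polynomial forms\<close>

text \<open>
  An element of \<open>L \<otimes> \<Omega>\<^sub>n\<close> is a finitely supported family of elements of \<open>L\<close> indexed by the monomial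
  basis of \<open>\<Omega>\<^sub>n\<close>. As a \<open>k\<close>-form has degree \<open>-k\<close>, the coefficient of \<open>b\<close> in an element of degree
  \<open>k\<close> has degree \<open>k + fdeg b\<close>.
\<close>

type_synonym ('a, 'b, 'c, 'd) convf = "mono_form \<Rightarrow>\<^sub>0 ('a, 'b, 'c, 'd) conv"

definition convf_deg ::
  "('k::field, 'a::ab_group_add, 'b::ab_group_add) leibniz2 \<Rightarrow>
   ('k, 'c::ab_group_add, 'd::ab_group_add) leibniz2 \<Rightarrow> nat \<Rightarrow> int \<Rightarrow> ('a, 'b, 'c, 'd) convf set" where
  "convf_deg V W n k = {\<alpha>. Poly_Mapping.keys \<alpha> \<subseteq> simplex_basis n \<and>
     (\<forall>b. Poly_Mapping.lookup \<alpha> b \<in> conv_deg V W (k + int (fdeg b)))}"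

definition tensor ::
  "('k::field, 'c::ab_group_add, 'd::ab_group_add) leibniz2 \<Rightarrow>
   ('a, 'b, 'c, 'd) conv \<Rightarrow> 'k form \<Rightarrow> ('a, 'b, 'c, 'd) convf" where
  "tensor W F \<omega> = Poly_Mapping.map (\<lambda>c. conv_scale W c F) \<omega>"

text \<open>\<open>id \<otimes> T\<close> on elements of degree \<open>k\<close>, for a linear map \<open>T\<close> of degree \<open>e\<close> between forms:
  \<open>(id \<otimes> T) (F \<otimes> \<omega>) = (-1)^(e |F|) F \<otimes> T \<omega>\<close>.\<close>

definition form_ext ::
  "('k::field, 'c::ab_group_add, 'd::ab_group_add) leibniz2 \<Rightarrow> int \<Rightarrow> int \<Rightarrow>
   (mono_form \<Rightarrow> 'k form) \<Rightarrow> ('a, 'b, 'c, 'd) convf \<Rightarrow> ('a, 'b, 'c, 'd) convf" where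
  "form_ext W e k T \<alpha> = (\<Sum>b\<in>Poly_Mapping.keys \<alpha>.
     tensor W (conv_scale W ((- 1) powi (e * (k + int (fdeg b)))) (Poly_Mapping.lookup \<alpha> b)) (T b))"

text \<open>The differential \<open>\<delta> + d\<close> on elements of degree \<open>k\<close>.\<close>

definition total_diff ::
  "('k::field, 'a::ab_group_add, 'b::ab_group_add) leibniz2 \<Rightarrow>
   ('k, 'c::ab_group_add, 'd::ab_group_add) leibniz2 \<Rightarrow>
   int \<Rightarrow> ('a, 'b, 'c, 'd) convf \<Rightarrow> ('a, 'b, 'c, 'd) convf" where
  "total_diff V W k \<alpha> =
     (\<Sum>b\<in>Poly_Mapping.keys \<alpha>.
        tensor W (conv_diff V W (k + int (fdeg b)) (Poly_Mapping.lookup \<alpha> b)) (Poly_Mapping.single b 1))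
     + form_ext W (- 1) k d_mono \<alpha>"

text \<open>Brackets of elements given with their degrees:
  \<open>\<L>\<^sub>p(F\<^sub>1 \<otimes> \<omega>\<^sub>1, \<dots>, F\<^sub>p \<otimes> \<omega>\<^sub>p) = \<plusminus> \<L>\<^sub>p(F\<^sub>1, \<dots>, F\<^sub>p) \<otimes> \<omega>\<^sub>1 \<and> \<dots> \<and> \<omega>\<^sub>p\<close>, with the sign of moving each \<open>F\<^sub>j\<close>
  past the \<open>\<omega>\<^sub>i\<close> with \<open>i < j\<close>.\<close>

definition convf_bracket ::
  "('k::field, 'c::ab_group_add, 'd::ab_group_add) leibniz2 \<Rightarrow>
   (int \<times> ('a, 'b, 'c, 'd) convf) list \<Rightarrow> ('a, 'b, 'c, 'd) convf" where
  "convf_bracket W \<alpha>s = (\<Sum>bs\<in>listset (map (\<lambda>\<alpha>. Poly_Mapping.keys (snd \<alpha>)) \<alpha>s).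
     let Fs = map2 (\<lambda>\<alpha> b. (fst \<alpha> + int (fdeg b), Poly_Mapping.lookup (snd \<alpha>) b)) \<alpha>s bs
     in tensor W
          (conv_scale W (interchange_sign (map fst Fs) (map (\<lambda>b. - int (fdeg b)) bs)) (conv_bracket W Fs))
          (wedge_list (map (\<lambda>b. Poly_Mapping.single b 1) bs)))"

text \<open>The Maurer-Cartan series; its terms with \<open>i > 3\<close> vanish since \<open>m\<^sub>i = 0\<close> there.\<close>

definition mc_curvature ::
  "('k::field_char_0, 'a::ab_group_add, 'b::ab_group_add) leibniz2 \<Rightarrow>
   ('k, 'c::ab_group_add, 'd::ab_group_add) leibniz2 \<Rightarrow>
   ('a, 'b, 'c, 'd) convf \<Rightarrow> ('a, 'b, 'c, 'd) convf" where
  "mc_curvature V W \<alpha> = (\<Sum>i\<in>{1..3}.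
     Poly_Mapping.map (conv_scale W ((- 1) ^ (i * (i - 1) div 2) / fact i))
       (if i = 1 then total_diff V W (- 1) \<alpha> else convf_bracket W (replicate i (- 1, \<alpha>))))"

definition MC_simplex ::
  "('k::field_char_0, 'a::ab_group_add, 'b::ab_group_add) leibniz2 \<Rightarrow>
   ('k, 'c::ab_group_add, 'd::ab_group_add) leibniz2 \<Rightarrow> nat \<Rightarrow> ('a, 'b, 'c, 'd) convf set" where
  "MC_simplex V W n = {\<alpha> \<in> convf_deg V W n (- 1). mc_curvature V W \<alpha> = 0}"

definition eval_vertex ::
  "('k::field, 'c::ab_group_add, 'd::ab_group_add) leibniz2 \<Rightarrow> nat \<Rightarrow>
   ('a, 'b, 'c, 'd) convf \<Rightarrow> ('a, 'b, 'c, 'd) conv" where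
  "eval_vertex W i \<alpha> = (\<Sum>b\<in>Poly_Mapping.keys \<alpha>. conv_scale W (eval_mono i b) (Poly_Mapping.lookup \<alpha> b))"

text \<open>\<open>h\<^sup>i\<close> on elements of degree \<open>k\<close>; on forms it raises the homological degree by 1.\<close>

definition h_op ::
  "('k::field, 'c::ab_group_add, 'd::ab_group_add) leibniz2 \<Rightarrow> nat \<Rightarrow> int \<Rightarrow>
   ('a, 'b, 'c, 'd) convf \<Rightarrow> ('a, 'b, 'c, 'd) convf" where
  "h_op W i k \<alpha> = form_ext W 1 k (h_mono i) \<alpha>"

text \<open>Restriction to the edge of \<open>\<Delta>\<^sup>2\<close> from \<open>e\<^sub>p\<close> to \<open>e\<^sub>q\<close>, identified with \<open>\<Delta>\<^sup>1\<close> by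
  \<open>e\<^sub>0 \<mapsto> e\<^sub>p\<close>, \<open>e\<^sub>1 \<mapsto> e\<^sub>q\<close>. The degree argument of \<open>form_ext\<close> is irrelevant for pullbacks.\<close>

definition restrict_edge ::
  "('k::field, 'c::ab_group_add, 'd::ab_group_add) leibniz2 \<Rightarrow> nat \<Rightarrow> nat \<Rightarrow>
   ('a, 'b, 'c, 'd) convf \<Rightarrow> ('a, 'b, 'c, 'd) convf" where
  "restrict_edge W p q \<alpha> =
     form_ext W 0 0 (pull_mono (simplicial_map 1 (\<lambda>k. if k = 0 then p else q))) \<alpha>"


section \<open>The vertical composite\<close>

definition mc_lift ::
  "('k::field_char_0, 'a::ab_group_add, 'b::ab_group_add) leibniz2 \<Rightarrow>
   ('k, 'c::ab_group_add, 'd::ab_group_add) leibniz2 \<Rightarrow> nat \<Rightarrow> nat \<Rightarrow>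
   ('a, 'b, 'c, 'd) conv \<Rightarrow> ('a, 'b, 'c, 'd) convf \<Rightarrow> ('a, 'b, 'c, 'd) convf" where
  "mc_lift V W n i \<mu> \<nu> = (THE \<alpha>. \<alpha> \<in> MC_simplex V W n \<and>
     eval_vertex W i \<alpha> = \<mu> \<and> total_diff V W 0 (h_op W i (- 1) \<alpha>) = \<nu>)"

text \<open>The homotopy \<open>S \<alpha> = (\<beta>(1) - \<beta>(0)) s\<close> of a 1-simplex \<open>\<alpha>\<close>, where \<open>\<beta> = h\<^sup>0 \<alpha>\<close>.\<close>

definition S_op ::
  "('k::field, 'c::ab_group_add, 'd::ab_group_add) leibniz2 \<Rightarrow> ('a, 'b, 'c, 'd) convf \<Rightarrow> 'a \<Rightarrow> 'd" where
  "S_op W \<alpha> = (\<lambda>x. let \<beta> = h_op W 0 (- 1) \<alpha>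
     in snd ((eval_vertex W 1 \<beta> - eval_vertex W 0 \<beta>) [Inl x]))"

text \<open>\<open>L\<^sub>0 \<otimes> \<Omega>\<^sup>0(\<Delta>\<^sup>n)\<close>.\<close>

definition conv0_functions ::
  "('k::field, 'a::ab_group_add, 'b::ab_group_add) leibniz2 \<Rightarrow>
   ('k, 'c::ab_group_add, 'd::ab_group_add) leibniz2 \<Rightarrow> nat \<Rightarrow> ('a, 'b, 'c, 'd) convf set" where
  "conv0_functions V W n = {\<beta> \<in> convf_deg V W n 0. \<forall>b\<in>Poly_Mapping.keys \<beta>. fdeg b = 0}"

text \<open>\<open>\<rho>\<close> is a value of \<open>\<tau> \<circ>\<^sub>1 \<theta>\<close> for some choice of \<open>\<beta>'\<close>, \<open>\<beta>''\<close> and of their extension \<open>\<beta>\<close>, for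
  \<open>\<theta> : f \<Rightarrow> g\<close> and \<open>\<tau> : g \<Rightarrow> h\<close>.\<close>

definition is_vertical_composite ::
  "('k::field_char_0, 'a::ab_group_add, 'b::ab_group_add) leibniz2 \<Rightarrow>
   ('k, 'c::ab_group_add, 'd::ab_group_add) leibniz2 \<Rightarrow> ('a, 'b, 'c, 'd) leibniz2_mor \<Rightarrow>
   ('a \<Rightarrow> 'd) \<Rightarrow> ('a \<Rightarrow> 'd) \<Rightarrow> ('a \<Rightarrow> 'd) \<Rightarrow> bool" where
  "is_vertical_composite V W g \<tau> \<theta> \<rho> \<longleftrightarrow> (\<exists>\<beta>' \<beta>'' \<beta>.
     \<beta>' \<in> conv0_functions V W 1 \<and>
     eval_vertex W 0 \<beta>' = - desusp \<theta> \<and> eval_vertex W 1 \<beta>' = 0 \<and>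
     \<beta>'' \<in> conv0_functions V W 1 \<and>
     eval_vertex W 0 \<beta>'' = 0 \<and> eval_vertex W 1 \<beta>'' = desusp \<tau> \<and>
     \<beta> \<in> conv0_functions V W 2 \<and>
     restrict_edge W 0 1 \<beta> = \<beta>' \<and> restrict_edge W 1 2 \<beta> = \<beta>'' \<and>
     \<rho> = S_op W (restrict_edge W 0 2 (mc_lift V W 2 1 (mc_of g) (total_diff V W 0 \<beta>))))"

end

theory Submission
  imports Defs "HOL-Computational_Algebra.Primes" "HOL-Library.Infinite_Set"
begin

text \<open>
  For degree reasons an element of degree \<open>-1\<close> of \<open>L \<otimes> \<Omega>\<^sub>n\<close> is a sum \<open>A + B\<close> of a function \<open>A\<close> with
  values in \<open>L\<^bsub>-1\<^esub>\<close> and a 1-form \<open>B\<close> with values in \<open>L\<^sub>0 = Hom(sV\<^sub>0, W\<^sub>1)\<close>, and the Maurer-Cartan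
  equation splits by form degree (\<open>curvature_at_0\<close>, \<open>curvature_at_1\<close>, \<open>curvature_high\<close>): every value
  of \<open>A\<close> is an infinity morphism, \<open>dA\<close> is an affine expression in \<open>A\<close> with coefficients from \<open>B\<close>,
  and \<open>dB = 0\<close>.

  The last equation makes \<open>B\<close> exact (\<open>closed_imp_exact\<close>), and since \<open>h df = f - f(e\<^sub>i)\<close>
  (\<open>h_mono_d_mono\<close>), the condition \<open>(\<delta> + d) h\<alpha> = (\<delta> + d) \<beta>\<close> on a lift forces \<open>B = d\<beta>\<close>
  (\<open>MC_one_forms\<close>). The equation for \<open>dA\<close> then determines \<open>A\<close> from its value at \<open>e\<^sub>i\<close>
  (\<open>MC_unique\<close>). It can be solved explicitly: starting from \<open>g\<close>, the value of \<open>A\<close> at a point \<open>t\<close> is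
  the target of the homotopy \<open>\<beta>(t)\<close> with source \<open>g\<close>. The only term of degree above 1 in \<open>\<beta>\<close> is
  \<open>- m\<^sub>2(\<beta> x, m\<^sub>1 \<beta> y)\<close>; axiom (b) makes its differential \<open>- m\<^sub>2(d\<beta> x, m\<^sub>1 \<beta> y) - m\<^sub>2(m\<^sub>1 \<beta> x, d\<beta> y)\<close>,
  as the equation demands. That these values are again infinity morphisms is
  \<open>infinity_morphism_shift\<close>. So the lift exists, is unique, and has the 1-form part \<open>d\<beta>\<close>
  (\<open>mc_lift_eq_lift\<close>).

  The restriction of the lift to the edge \<open>02\<close> has the 1-form part \<open>d(\<beta>|\<^bsub>02\<^esub>)\<close>, from which \<open>h\<^sup>0\<close> recovers
  \<open>\<beta>|\<^bsub>02\<^esub>\<close> up to a constant. The composite is therefore \<open>\<beta>(e\<^sub>2) - \<beta>(e\<^sub>0)\<close> (\<open>S_op_restrict_lift\<close>),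
  which is \<open>\<tau> + \<theta>\<close> for every choice of \<open>\<beta>\<close>.

  All identities between forms are tested on values: elements of \<open>L \<otimes> \<Omega>\<^sub>n\<close> are paired with linear
  functionals on the monomials, above all with the evaluation of the coefficient of \<open>dt\<^sub>I\<close> at a
  point. Over an infinite field such evaluations separate forms (\<open>separation\<close>), so that products
  and pullbacks of forms reduce to arithmetic in \<open>L\<close>.
\<close>

abbreviation "keys \<equiv> Poly_Mapping.keys"
abbreviation "lookup \<equiv> Poly_Mapping.lookup"
abbreviation "single \<equiv> Poly_Mapping.single"

section \<open>Linear functionals on formal combinations\<close>

lemma lin_ext_superset:
  assumes "vector_space s" "finite S" "keys p \<subseteq> S"
  shows "lin_ext s f p = (\<Sum>x\<in>S. s (lookup p x) (f x))"
proof -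
  interpret vector_space s by fact
  show ?thesis unfolding lin_ext_def
    by (rule sum.mono_neutral_left) (use assms in \<open>auto simp: in_keys_iff\<close>)
qed

lemma lin_ext_zero [simp]: "lin_ext s f 0 = 0"
  by (simp add: lin_ext_def)

lemma lin_ext_single:
  assumes "vector_space s"
  shows "lin_ext s f (single x c) = s c (f x)"
  by (subst lin_ext_superset[OF assms, of "{x}"]) auto

lemma lin_ext_add:
  assumes "vector_space s"
  shows "lin_ext s f (p + q) = lin_ext s f p + lin_ext s f q"
proof -
  interpret vector_space s by fact
  let ?S = "keys p \<union> keys q"
  have "keys (p + q) \<subseteq> ?S" by (rule Poly_Mapping.keys_add)
  then show ?thesis
    by (subst (1 2 3) lin_ext_superset[OF assms, of ?S])
      (auto simp: lookup_add scale_left_distrib sum.distrib)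
qed

lemma lin_ext_sum:
  assumes "vector_space s"
  shows "lin_ext s f (sum p A) = (\<Sum>a\<in>A. lin_ext s f (p a))"
  by (induction A rule: infinite_finite_induct) (auto simp: lin_ext_add[OF assms])

lemma lookup_pscale [simp]: "lookup (pscale c p) x = c * lookup p x"
  by (simp add: pscale_def Poly_Mapping.map.rep_eq when_def)

lemma vector_space_pscale: "vector_space pscale"
  by standard (auto intro!: poly_mapping_eqI simp: lookup_add algebra_simps)

lemma vector_space_mult: "vector_space ((*) :: 'k::field \<Rightarrow> 'k \<Rightarrow> 'k)"
  by standard (auto simp: algebra_simps)

lemma lin_ext_pscale:
  assumes "vector_space s"
  shows "lin_ext s f (pscale c p) = s c (lin_ext s f p)"
proof -
  interpret vector_space s by fact
  have "keys (pscale c p) \<subseteq> keys p" by (auto simp: in_keys_iff)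
  then show ?thesis
    by (subst (1 2) lin_ext_superset[OF assms, of "keys p"])
      (auto simp: scale_sum_right)
qed

lemma lin_ext_diff:
  assumes "vector_space s"
  shows "lin_ext s f (p - q) = lin_ext s f p - lin_ext s f q"
  using lin_ext_add[OF assms, of f "p - q" q] by simp

lemma lin_ext_uminus:
  assumes "vector_space s"
  shows "lin_ext s f (- p) = - lin_ext s f p"
  using lin_ext_diff[OF assms, of f 0 p] by simp

lemma lin_ext_lin_ext:
  assumes "vector_space s"
  shows "lin_ext s f (lin_ext pscale g p) = lin_ext s (\<lambda>x. lin_ext s f (g x)) p"
  by (subst lin_ext_def[of pscale])
    (simp add: lin_ext_sum[OF assms] lin_ext_pscale[OF assms], simp add: lin_ext_def[of s _ p])

lemma lin_ext_cong:
  assumes "\<And>x. x \<in> keys p \<Longrightarrow> f x = g x"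
  shows "lin_ext s f p = lin_ext s g p"
  using assms by (simp add: lin_ext_def)

lemma keys_lin_ext_pscale:
  "keys (lin_ext pscale f p) \<subseteq> (\<Union>x\<in>keys p. keys (f x))"
  unfolding lin_ext_def
  by (rule order_trans[OF Poly_Mapping.keys_sum]) (auto simp: in_keys_iff)

text \<open>The pairing of a combination of \<open>x\<close>'s with coefficients in a vector space and a linear
  functional on the span of the \<open>x\<close>'s. Vertex evaluations, single coefficients and values at a
  point of a form with values in \<open>L\<close> are pairings, and an operator \<open>id \<otimes> T\<close> is transposed to the
  functional, which removes \<open>T\<close> from the \<open>L\<close>-valued side.\<close>

definition pairing ::
  "('k \<Rightarrow> 'y \<Rightarrow> 'y::comm_monoid_add) \<Rightarrow> ('x \<Rightarrow> 'k) \<Rightarrow> ('x \<Rightarrow>\<^sub>0 'y) \<Rightarrow> 'y" where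
  "pairing s \<xi> \<alpha> = (\<Sum>b\<in>keys \<alpha>. s (\<xi> b) (lookup \<alpha> b))"

context vector_space
begin

lemma pairing_superset:
  assumes "finite S" "keys \<alpha> \<subseteq> S"
  shows "pairing scale \<xi> \<alpha> = (\<Sum>b\<in>S. \<xi> b *s lookup \<alpha> b)"
  unfolding pairing_def
  by (rule sum.mono_neutral_left) (use assms in \<open>auto simp: in_keys_iff\<close>)

lemma pairing_zero [simp]: "pairing scale \<xi> 0 = 0"
  by (simp add: pairing_def)

lemma pairing_add: "pairing scale \<xi> (\<alpha> + \<beta>) = pairing scale \<xi> \<alpha> + pairing scale \<xi> \<beta>"
proof -
  let ?S = "keys \<alpha> \<union> keys \<beta>"
  have "keys (\<alpha> + \<beta>) \<subseteq> ?S" by (rule Poly_Mapping.keys_add)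
  then show ?thesis
    by (subst (1 2 3) pairing_superset[of ?S])
      (auto simp: lookup_add scale_right_distrib sum.distrib)
qed

lemma pairing_diff: "pairing scale \<xi> (\<alpha> - \<beta>) = pairing scale \<xi> \<alpha> - pairing scale \<xi> \<beta>"
  using pairing_add[of \<xi> "\<alpha> - \<beta>" \<beta>] by simp

lemma pairing_sum: "pairing scale \<xi> (sum \<alpha> A) = (\<Sum>a\<in>A. pairing scale \<xi> (\<alpha> a))"
  by (induction A rule: infinite_finite_induct) (auto simp: pairing_add)

lemma pairing_cong:
  assumes "\<And>b. b \<in> keys \<alpha> \<Longrightarrow> \<xi> b = \<mu> b"
  shows "pairing scale \<xi> \<alpha> = pairing scale \<mu> \<alpha>"
  using assms by (simp add: pairing_def)

lemma pairing_functional_diff: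
  "pairing scale (\<lambda>b. \<xi> b - \<mu> b) \<alpha> = pairing scale \<xi> \<alpha> - pairing scale \<mu> \<alpha>"
  by (simp add: pairing_def scale_left_diff_distrib sum_subtractf)

lemma pairing_functional_scale:
  "pairing scale (\<lambda>b. c * \<xi> b) \<alpha> = c *s pairing scale \<xi> \<alpha>"
  by (simp add: pairing_def scale_sum_right)

lemma pairing_functional_zero [simp]: "pairing scale (\<lambda>b. 0) \<alpha> = 0"
  by (simp add: pairing_def)

lemma pairing_indicator: "pairing scale (\<lambda>c. of_bool (c = b)) \<alpha> = lookup \<alpha> b"
proof -
  have "(\<Sum>c\<in>insert b (keys \<alpha>). of_bool (c = b) *s lookup \<alpha> c)
    = (\<Sum>c\<in>insert b (keys \<alpha>). if c = b then lookup \<alpha> c else 0)"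
    by (rule sum.cong) auto
  then show ?thesis
    by (subst pairing_superset[of "insert b (keys \<alpha>)"]) auto
qed

lemma pairing_lookup_cong:
  assumes "\<And>b. \<xi> b \<noteq> 0 \<Longrightarrow> lookup \<alpha> b = lookup \<beta> b"
  shows "pairing scale \<xi> \<alpha> = pairing scale \<xi> \<beta>"
proof -
  let ?S = "keys \<alpha> \<union> keys \<beta>"
  have "(\<Sum>b\<in>?S. \<xi> b *s lookup \<alpha> b) = (\<Sum>b\<in>?S. \<xi> b *s lookup \<beta> b)"
    by (rule sum.cong[OF refl]) (use assms in force)
  then show ?thesis
    by (simp add: pairing_superset[of ?S])
qed

text \<open>Subtracting \<open>x\<^bsub>a0\<^esub>\<close> times the equation for \<open>n\<close> from the equation for \<open>n + 1\<close> removes the term of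
  \<open>a0\<close> and multiplies the others by nonzero scalars.\<close>

lemma vandermonde:
  assumes "finite S" "inj_on x S" and "\<And>n::nat. (\<Sum>a\<in>S. (x a ^ n) *s c a) = 0" and "a \<in> S"
  shows "c a = 0"
  using assms
proof (induction S arbitrary: c a rule: finite_induct)
  case empty
  then show ?case by simp
next
  case (insert a0 S)
  have *: "c a' = 0" if "a' \<in> S" for a'
  proof -
    have "(x a' - x a0) *s c a' = 0"
    proof (rule insert.IH)
      show "inj_on x S" using insert.prems(1) by (auto simp: inj_on_def)
      fix n
      have "(\<Sum>a\<in>S. (x a ^ n) *s ((x a - x a0) *s c a)) =
        (\<Sum>a\<in>insert a0 S. (x a ^ n) *s ((x a - x a0) *s c a))"
        using insert.hyps by simp
      also have "\<dots> = (\<Sum>a\<in>insert a0 S. (x a ^ Suc n) *s c a) - x a0 *s (\<Sum>a\<in>insert a0 S. (x a ^ n) *s c a)"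
        by (simp only: scale_sum_right sum_subtractf[symmetric])
          (rule sum.cong, auto simp: algebra_simps scale_left_diff_distrib)
      also have "\<dots> = 0" by (simp only: insert.prems(2)) simp
      finally show "(\<Sum>a\<in>S. (x a ^ n) *s ((x a - x a0) *s c a)) = 0" .
    qed (fact that)
    moreover have "x a' \<noteq> x a0"
      using insert.prems(1) that insert.hyps by (auto simp: inj_on_def)
    ultimately show ?thesis by simp
  qed
  moreover have "c a0 = 0"
    using insert.prems(2)[of 0] insert.hyps * by simp
  ultimately show ?case using insert.prems(3) by auto
qed

end

section \<open>Points separate coefficients\<close>

definition mval :: "(nat \<Rightarrow> 'k::field) \<Rightarrow> (nat \<Rightarrow>\<^sub>0 nat) \<Rightarrow> 'k" where
  "mval T a = (\<Prod>j\<in>keys a. T j ^ lookup a j)"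

lemma mval_superset:
  assumes "finite S" "keys a \<subseteq> S"
  shows "mval T a = (\<Prod>j\<in>S. T j ^ lookup a j)"
  unfolding mval_def
  by (rule prod.mono_neutral_left) (use assms in \<open>auto simp: in_keys_iff\<close>)

lemma mval_zero [simp]: "mval T 0 = 1"
  by (simp add: mval_def)

lemma mval_single [simp]: "mval T (single j n) = T j ^ n"
  by (subst mval_superset[of "{j}"]) auto

lemma mval_add: "mval T (a + b) = mval T a * mval T b"
proof -
  let ?S = "keys a \<union> keys b"
  have "keys (a + b) \<subseteq> ?S" by (rule Poly_Mapping.keys_add)
  then show ?thesis
    by (subst (1 2 3) mval_superset[of ?S]) (auto simp: lookup_add power_add prod.distrib)
qed

lemma mval_power: "mval (\<lambda>j. T j ^ n) a = mval T a ^ n"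
  by (simp add: mval_def prod_power_distrib power_mult[symmetric] mult.commute)

lemma mval_cong: "(\<And>j. j \<in> keys a \<Longrightarrow> T j = U j) \<Longrightarrow> mval T a = mval U a"
  by (simp add: mval_def)

text \<open>With distinct primes as coordinates, unique factorization recovers a monomial from its value.\<close>

lemma exists_separating_point: "\<exists>T :: nat \<Rightarrow> 'k::field_char_0. inj (mval T)"
proof -
  \<comment> \<open>The coordinates are the prime numbers in increasing order.\<close>
  define p :: "nat \<Rightarrow> nat" where "p = enumerate {q. prime q}"
  have inf: "infinite {q::nat. prime q}" by (rule primes_infinite)
  have prime: "prime (p j)" for j
    using enumerate_in_set[OF inf] by (simp add: p_def)
  have inj: "inj p"
    using strict_mono_enumerate[OF inf] by (simp add: p_def strict_mono_imp_inj_on)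
  have mult: "multiplicity (p j) (\<Prod>i\<in>keys a. p i ^ lookup a i) = lookup a j" for a j
  proof -
    have "(\<Prod>i\<in>keys a. p i ^ lookup a i) =
      (\<Prod>q\<in>p ` keys a. q ^ lookup a (inv p q))"
      by (subst prod.reindex) (use inj in \<open>auto simp: inj_on_def\<close>)
    also have "multiplicity (p j) \<dots> = (if p j \<in> p ` keys a then lookup a (inv p (p j)) else 0)"
      by (rule multiplicity_prod_prime_powers) (auto simp: prime)
    also have "\<dots> = lookup a j"
      using inj by (auto simp: inj_image_mem_iff in_keys_iff)
    finally show ?thesis .
  qed
  have val: "mval (\<lambda>j. of_nat (p j)) a = (of_nat (\<Prod>i\<in>keys a. p i ^ lookup a i) :: 'k)" for a
    by (simp add: mval_def)
  have "inj (mval (\<lambda>j. of_nat (p j)) :: _ \<Rightarrow> 'k)"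
  proof (rule injI)
    fix a b assume "mval (\<lambda>j. of_nat (p j)) a = (mval (\<lambda>j. of_nat (p j)) b :: 'k)"
    then have "(\<Prod>i\<in>keys a. p i ^ lookup a i) =
        (\<Prod>i\<in>keys b. p i ^ lookup b i)"
      unfolding val by (simp only: of_nat_eq_iff)
    then show "a = b" by (intro poly_mapping_eqI) (metis mult)
  qed
  then show ?thesis by blast
qed

text \<open>On a form, this functional evaluates the coefficient function of \<open>dt\<^sub>I\<close> at the point \<open>T\<close>.\<close>

definition coeff_at :: "(nat \<Rightarrow> 'k::field) \<Rightarrow> nat set \<Rightarrow> mono_form \<Rightarrow> 'k" where
  "coeff_at T I b = (if snd b = I then mval T (fst b) else 0)"

text \<open>Raising the coordinates of a separating point to the \<open>n\<close>-th power raises the value of each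
  monomial to the \<open>n\<close>-th power, so a polynomial that vanishes at all points gives a Vandermonde
  system with distinct nodes.\<close>

lemma separation:
  fixes scale :: "'k::field_char_0 \<Rightarrow> 'v::ab_group_add \<Rightarrow> 'v"
  assumes "vector_space scale" and "finite S"
    and zero: "\<And>T. (\<Sum>b\<in>S. scale (coeff_at T I b) (c b)) = 0" and "b \<in> S" "snd b = I"
  shows "c b = 0"
proof -
  interpret vector_space scale by fact
  obtain T :: "nat \<Rightarrow> 'k" where T: "inj (mval T)" using exists_separating_point by blast
  let ?S = "{b \<in> S. snd b = I}"
  show ?thesis
  proof (rule vandermonde[of ?S "\<lambda>b. mval T (fst b)" c])
    show "inj_on (\<lambda>b. mval T (fst b)) ?S"
      using T by (auto simp: inj_on_def dest: injD)
    fix n :: nat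
    have "(\<Sum>a\<in>S. scale (coeff_at (\<lambda>j. T j ^ n) I a) (c a)) = (\<Sum>a\<in>?S. scale (mval T (fst a) ^ n) (c a))"
      by (rule sum.mono_neutral_cong_right) (use assms in \<open>auto simp: coeff_at_def mval_power\<close>)
    then show "(\<Sum>a\<in>?S. scale (mval T (fst a) ^ n) (c a)) = 0" using zero by simp
  qed (use assms in auto)
qed

lemma separation_pairing:
  fixes scale :: "'k::field_char_0 \<Rightarrow> 'v::ab_group_add \<Rightarrow> 'v"
  assumes "vector_space scale"
    and eq: "\<And>T. pairing scale (coeff_at T I) \<alpha> = pairing scale (coeff_at T I) \<beta>" and "snd b = I"
  shows "lookup \<alpha> b = lookup \<beta> b"
proof -
  interpret vector_space scale by fact
  have "lookup (\<alpha> - \<beta>) b = 0"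
  proof (rule separation[OF assms(1), of "insert b (keys (\<alpha> - \<beta>))"])
    fix T
    show "(\<Sum>b\<in>insert b (keys (\<alpha> - \<beta>)). scale (coeff_at T I b) (lookup (\<alpha> - \<beta>) b)) = 0"
      using eq[of T] by (subst pairing_superset[symmetric]) (auto simp: pairing_diff)
  qed (use assms in auto)
  then show ?thesis by (simp add: lookup_minus)
qed

section \<open>Forms at a point\<close>

definition ev :: "(nat \<Rightarrow> 'k::field) \<Rightarrow> nat set \<Rightarrow> 'k form \<Rightarrow> 'k" where
  "ev T I = lin_ext (*) (coeff_at T I)"

text \<open>The partial derivative \<open>\<partial>t\<^sup>a / \<partial>t\<^sub>k\<close> at \<open>T\<close>.\<close>

definition deriv_mono :: "(nat \<Rightarrow> 'k::field) \<Rightarrow> nat \<Rightarrow> (nat \<Rightarrow>\<^sub>0 nat) \<Rightarrow> 'k" where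
  "deriv_mono T k a = of_nat (lookup a k) * mval T (a - single k 1)"

text \<open>The partial derivative of the 0-form part of \<open>p\<close>: it is the \<open>dt\<^sub>k\<close>-component of \<open>dp\<close>, to which
  the parts of positive degree do not contribute.\<close>

definition deriv_at :: "(nat \<Rightarrow> 'k::field) \<Rightarrow> nat \<Rightarrow> 'k form \<Rightarrow> 'k" where
  "deriv_at T k p = ev T {k} (lin_ext pscale d_mono p)"

lemmas ev_simps = lin_ext_add[OF vector_space_mult] lin_ext_diff[OF vector_space_mult]
  lin_ext_uminus[OF vector_space_mult] lin_ext_sum[OF vector_space_mult]
  lin_ext_pscale[OF vector_space_mult] lin_ext_single[OF vector_space_mult]

lemma lin_ext_wedge:
  fixes \<xi> :: "mono_form \<Rightarrow> 'k::field"
  assumes "\<And>b c. lin_ext (*) \<xi> (wedge_mono b c) = \<xi>1 b * \<zeta>1 c + \<xi>2 b * \<zeta>2 c"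
  shows "lin_ext (*) \<xi> (wedge p q) =
    lin_ext (*) \<xi>1 p * lin_ext (*) \<zeta>1 q + lin_ext (*) \<xi>2 p * lin_ext (*) \<zeta>2 q"
  unfolding wedge_def lin_ext_lin_ext[OF vector_space_mult] assms
  by (simp add: lin_ext_def sum.distrib sum_distrib_left sum_distrib_right distrib_left mult_ac)
    (rule arg_cong2[of _ _ _ _ "(+)"]; rule sum.swap)

lemma lin_ext_wedge_mono:
  fixes \<xi> :: "mono_form \<Rightarrow> 'k::field"
  shows "lin_ext (*) \<xi> (wedge_mono b c) = (if snd b \<inter> snd c = {} then
    (- 1) ^ card {(i, j). i \<in> snd b \<and> j \<in> snd c \<and> j < i} * \<xi> (fst b + fst c, snd b \<union> snd c) else 0)"
  by (cases b; cases c) (simp add: ev_simps)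

lemma ev_wedge_mono_0: "ev T {} (wedge_mono b c) = coeff_at T {} b * coeff_at T {} c"
  by (auto simp: ev_def lin_ext_wedge_mono coeff_at_def mval_add)

lemma ev_wedge_mono_1:
  "ev T {k} (wedge_mono b c) = coeff_at T {} b * coeff_at T {k} c + coeff_at T {k} b * coeff_at T {} c"
proof (cases "snd b = {}")
  case True
  then show ?thesis by (simp add: ev_def lin_ext_wedge_mono coeff_at_def mval_add)
next
  case b: False
  show ?thesis
  proof (cases "snd c = {}")
    case True
    then show ?thesis using b by (simp add: ev_def lin_ext_wedge_mono coeff_at_def mval_add)
  next
    case False
    then have "snd b \<union> snd c \<noteq> {k}" if "snd b \<inter> snd c = {}"
      using b that by (auto simp: Un_singleton_iff)
    then have "ev T {k} (wedge_mono b c) = 0"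
      by (cases "snd b \<inter> snd c = {}") (simp_all add: ev_def lin_ext_wedge_mono coeff_at_def)
    then show ?thesis using b False by (simp add: coeff_at_def)
  qed
qed

lemma ev_wedge_0: "ev T {} (wedge p q) = ev T {} p * ev T {} q"
  using lin_ext_wedge[of "coeff_at T {}" "coeff_at T {}" "coeff_at T {}" "\<lambda>_. 0" "\<lambda>_. 0" p q]
    ev_wedge_mono_0[of T] by (simp add: ev_def lin_ext_def)

text \<open>A \<open>dt\<^sub>k\<close>-component arises only from one factor of degree 0 and one of degree 1; these commute,
  so no sign appears.\<close>

lemma ev_wedge_1: "ev T {k} (wedge p q) = ev T {} p * ev T {k} q + ev T {k} p * ev T {} q"
  using lin_ext_wedge[of "coeff_at T {k}" "coeff_at T {}" "coeff_at T {k}" "coeff_at T {k}" "coeff_at T {}" p q]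
    ev_wedge_mono_1[of T k] by (simp add: ev_def)

lemma ev_form_one [simp]: "ev T I form_one = (if I = {} then 1 else 0)"
  by (simp add: ev_def form_one_def ev_simps coeff_at_def)

lemma ev_coord [simp]: "ev T I (coord j) = (if I = {} then T j else 0)"
  by (simp add: ev_def coord_def ev_simps coeff_at_def)

lemma lin_ext_d_mono:
  fixes \<xi> :: "mono_form \<Rightarrow> 'k::field"
  shows "lin_ext (*) \<xi> (d_mono b) = (\<Sum>i\<in>keys (fst b).
    if i \<in> snd b then 0 else of_nat (lookup (fst b) i) * (- 1) ^ card {j \<in> snd b. j < i}
      * \<xi> (fst b - single i 1, insert i (snd b)))"
proof -
  have "card {(i', j). i' = i \<and> j \<in> snd b \<and> j < i'} = card {j \<in> snd b. j < i}" for i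
  proof -
    have "{(i', j). i' = i \<and> j \<in> snd b \<and> j < i'} = Pair i ` {j \<in> snd b. j < i}" by auto
    then show ?thesis by (simp add: card_image inj_on_def)
  qed
  then show ?thesis
    unfolding d_mono_def
    by (simp add: ev_simps lin_ext_wedge_mono mult.assoc cong: if_cong)
      (rule sum.cong, auto simp: ev_simps)
qed

lemma ev_d_mono_0 [simp]: "ev T {} (d_mono b) = 0"
  by (simp add: ev_def lin_ext_d_mono coeff_at_def cong: if_cong)

lemma ev_d_mono_1: "ev T {k} (d_mono b) = (if snd b = {} then deriv_mono T k (fst b) else 0)"
proof (cases "snd b = {}")
  case True
  have "ev T {k} (d_mono b) = (\<Sum>i\<in>keys (fst b). if i = k then deriv_mono T i (fst b) else 0)"
    unfolding ev_def lin_ext_d_mono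
    by (rule sum.cong) (auto simp: True coeff_at_def deriv_mono_def)
  then show ?thesis using True by (auto simp: deriv_mono_def in_keys_iff)
next
  case False
  then have "coeff_at T {k} (a, insert i (snd b)) = 0" if "i \<notin> snd b" for a i
    using that by (auto simp: coeff_at_def)
  then have "(\<Sum>i\<in>keys (fst b). if i \<in> snd b then 0 else of_nat (lookup (fst b) i)
      * (- 1) ^ card {j \<in> snd b. j < i} * coeff_at T {k} (fst b - single i 1, insert i (snd b))) = 0"
    by (intro sum.neutral) simp
  then show ?thesis using False
    by (simp only: ev_def lin_ext_d_mono if_False)
qed

text \<open>The Euler operator \<open>t\<^sub>k \<partial>\<^sub>k\<close> is diagonal on monomials, which makes the coefficients of a
  function visible in its derivatives.\<close>

lemma deriv_mono_mult: "T k * deriv_mono T k a = of_nat (lookup a k) * mval T a"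
proof (cases "lookup a k = 0")
  case False
  then have "a = (a - single k 1) + single k 1"
    by (intro poly_mapping_eqI) (auto simp: lookup_add lookup_minus lookup_single when_def)
  then have "mval T a = mval T (a - single k 1) * T k"
    by (metis mval_add mval_single power_one_right)
  then show ?thesis by (simp add: deriv_mono_def)
qed (simp add: deriv_mono_def)

lemma deriv_mono_add: "deriv_mono T k (a + b) = deriv_mono T k a * mval T b + mval T a * deriv_mono T k b"
proof -
  have *: "of_nat (lookup a k) * mval T (a + b - single k 1) = deriv_mono T k a * mval T b" for a b
  proof (cases "lookup a k = 0")
    case False
    then have "a + b - single k 1 = (a - single k 1) + b"
      by (intro poly_mapping_eqI) (auto simp: lookup_add lookup_minus lookup_single when_def)
    then show ?thesis by (simp add: deriv_mono_def mval_add)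
  qed (simp add: deriv_mono_def)
  show ?thesis
    using *[of a b] *[of b a] by (simp add: deriv_mono_def[of T k "a + b"] lookup_add algebra_simps)
qed

lemma deriv_mono_single: "deriv_mono T k (single j 1) = (if j = k then 1 else 0)"
  by (simp add: deriv_mono_def lookup_single)

lemma ev_lin_ext_d_0 [simp]: "ev T {} (lin_ext pscale d_mono p) = 0"
  using ev_d_mono_0[of T] by (simp add: ev_def lin_ext_lin_ext[OF vector_space_mult]) (simp add: lin_ext_def)

lemma deriv_at_eq:
  "deriv_at T k p = lin_ext (*) (\<lambda>b. if snd b = {} then deriv_mono T k (fst b) else 0) p"
  using ev_d_mono_1[of T k] by (simp add: deriv_at_def ev_def lin_ext_lin_ext[OF vector_space_mult])

lemma deriv_at_wedge: "deriv_at T k (wedge p q) = deriv_at T k p * ev T {} q + ev T {} p * deriv_at T k q"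
  unfolding deriv_at_eq ev_def
  by (rule lin_ext_wedge) (auto simp: lin_ext_wedge_mono coeff_at_def deriv_mono_add)

lemma deriv_at_form_one [simp]: "deriv_at T k form_one = 0"
  by (simp add: deriv_at_eq form_one_def ev_simps deriv_mono_def)

lemma ev_wedge_list_0: "ev T {} (wedge_list ps) = prod_list (map (ev T {}) ps)"
  by (induction ps) (auto simp: wedge_list_def ev_wedge_0)

lemma deriv_at_replicate:
  "deriv_at T k (wedge_list (replicate m p)) = of_nat m * ev T {} p ^ (m - 1) * deriv_at T k p"
proof (induction m)
  case (Suc m)
  have "ev T {} (wedge_list (replicate m p)) = ev T {} p ^ m"
    by (simp add: ev_wedge_list_0 prod_list_replicate)
  with Suc show ?case
    by (cases m) (auto simp: wedge_list_def deriv_at_wedge algebra_simps)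
qed (simp add: wedge_list_def)

lemma deriv_at_wedge_list:
  assumes "distinct js"
  shows "deriv_at T k (wedge_list (map q js)) =
    (\<Sum>j\<in>set js. deriv_at T k (q j) * (\<Prod>i\<in>set js - {j}. ev T {} (q i)))"
  using assms
proof (induction js)
  case (Cons j js)
  have "ev T {} (wedge_list (map q js)) = (\<Prod>i\<in>set js. ev T {} (q i))"
    using Cons.prems by (simp add: ev_wedge_list_0 prod.distinct_set_conv_list o_def)
  moreover have "(\<Prod>i\<in>insert j (set js) - {j'}. ev T {} (q i)) = ev T {} (q j) * (\<Prod>i\<in>set js - {j'}. ev T {} (q i))"
    if "j' \<in> set js" for j'
  proof -
    have "insert j (set js) - {j'} = insert j (set js - {j'})" using that Cons.prems by auto
    then show ?thesis using Cons.prems by simp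
  qed
  moreover have "insert j (set js) - {j} = set js" using Cons.prems by auto
  ultimately show ?case using Cons
    by (simp add: wedge_list_def deriv_at_wedge sum_distrib_left algebra_simps)
qed (simp add: wedge_list_def)

section \<open>Homogeneous forms and pullbacks\<close>

text \<open>Homogeneous \<open>m\<close>-forms in the variables \<open>X\<close>. Finiteness is part of the condition because
  \<open>card\<close> is 0 on infinite index sets.\<close>

definition forms_on :: "nat set \<Rightarrow> nat \<Rightarrow> 'k::field form set" where
  "forms_on X m = {p. \<forall>b\<in>keys p.
     keys (fst b) \<subseteq> X \<and> snd b \<subseteq> X \<and> finite (snd b) \<and> card (snd b) = m}"

lemma forms_on_lin_ext:
  assumes "\<And>b. b \<in> keys p \<Longrightarrow> f b \<in> forms_on X m"
  shows "lin_ext pscale f p \<in> forms_on X m"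
  using assms keys_lin_ext_pscale[of f p] by (fastforce simp: forms_on_def)

lemma forms_on_wedge_mono:
  assumes "keys a \<subseteq> X" "I \<subseteq> X" "finite I" "keys b \<subseteq> X" "J \<subseteq> X" "finite J"
  shows "wedge_mono (a, I) (b, J) \<in> forms_on X (card I + card J)"
  using assms Poly_Mapping.keys_add[of a b]
  by (auto simp: forms_on_def card_Un_disjoint split: if_splits)

lemma forms_on_wedge:
  assumes "p \<in> forms_on X m" "q \<in> forms_on X n"
  shows "wedge p q \<in> forms_on X (m + n)"
  unfolding wedge_def
proof (intro forms_on_lin_ext)
  fix b c assume "b \<in> keys p" "c \<in> keys q"
  then show "wedge_mono b c \<in> forms_on X (m + n)"
    using assms forms_on_wedge_mono[of "fst b" X "snd b" "fst c" "snd c"]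
    by (auto simp: forms_on_def)
qed

lemma forms_on_form_one: "form_one \<in> forms_on X 0"
  by (auto simp: forms_on_def form_one_def)

lemma forms_on_coord: "j \<in> X \<Longrightarrow> coord j \<in> forms_on X 0"
  by (auto simp: forms_on_def coord_def)

lemma forms_on_zero: "0 \<in> forms_on X m"
  by (auto simp: forms_on_def)

lemma forms_on_add: "p \<in> forms_on X m \<Longrightarrow> q \<in> forms_on X m \<Longrightarrow> p + q \<in> forms_on X m"
  using Poly_Mapping.keys_add[of p q] by (fastforce simp: forms_on_def)

lemma forms_on_diff: "p \<in> forms_on X m \<Longrightarrow> q \<in> forms_on X m \<Longrightarrow> p - q \<in> forms_on X m"
  using Poly_Mapping.keys_diff[of p q] by (fastforce simp: forms_on_def)

lemma forms_on_sum: "(\<And>a. a \<in> A \<Longrightarrow> p a \<in> forms_on X m) \<Longrightarrow> sum p A \<in> forms_on X m"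
  by (induction A rule: infinite_finite_induct) (auto intro: forms_on_zero forms_on_add)

lemma forms_on_pscale: "p \<in> forms_on X m \<Longrightarrow> pscale c p \<in> forms_on X m"
  by (auto simp: forms_on_def in_keys_iff)

lemma pscale_zero_right [simp]: "pscale c 0 = 0"
  by (intro poly_mapping_eqI) simp

lemma forms_on_wedge_list:
  assumes "\<And>p. p \<in> set ps \<Longrightarrow> p \<in> forms_on X m"
  shows "wedge_list ps \<in> forms_on X (m * length ps)"
  using assms
proof (induction ps)
  case (Cons p ps)
  then have "wedge p (wedge_list ps) \<in> forms_on X (m + m * length ps)"
    by (intro forms_on_wedge) auto
  then show ?case by (simp add: wedge_list_def algebra_simps)
qed (simp add: wedge_list_def forms_on_form_one)

lemma forms_on_d_mono:
  assumes "keys a \<subseteq> X" "I \<subseteq> X" "finite I"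
  shows "d_mono (a, I) \<in> forms_on X (Suc (card I))"
  unfolding d_mono_def
proof (intro forms_on_sum forms_on_pscale)
  fix j assume j: "j \<in> keys (fst (a, I))"
  have "keys (a - single j 1) \<subseteq> X"
    using assms(1) by (auto simp: in_keys_iff lookup_minus)
  then show "wedge_mono (fst (a, I) - single j 1, {j}) (0, snd (a, I)) \<in> forms_on X (Suc (card I))"
    using forms_on_wedge_mono[of "a - single j 1" X "{j}" 0 I] assms j by auto
qed

lemma forms_on_pull_mono:
  assumes "\<And>j. j \<in> keys a \<union> I \<Longrightarrow> \<phi> j \<in> forms_on X 0" "finite I"
  shows "pull_mono \<phi> (a, I) \<in> forms_on X (card I)"
proof -
  let ?ps = "map (\<lambda>j. wedge_list (replicate (lookup a j) (\<phi> j))) (sorted_list_of_set (keys a))"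
  let ?qs = "map (\<lambda>j. lin_ext pscale d_mono (\<phi> j)) (sorted_list_of_set I)"
  have "p \<in> forms_on X 0" if p: "p \<in> set ?ps" for p
  proof -
    from p obtain j where j: "j \<in> keys a" "p = wedge_list (replicate (lookup a j) (\<phi> j))" by auto
    show ?thesis
      using forms_on_wedge_list[of "replicate (lookup a j) (\<phi> j)" X 0] assms(1) j by auto
  qed
  then have "wedge_list ?ps \<in> forms_on X (0 * length ?ps)" by (rule forms_on_wedge_list)
  moreover have "q \<in> forms_on X 1" if q: "q \<in> set ?qs" for q
  proof -
    from q obtain j where j: "j \<in> I" "q = lin_ext pscale d_mono (\<phi> j)" using assms(2) by auto
    have "d_mono b \<in> forms_on X 1" if "b \<in> keys (\<phi> j)" for b
      using assms(1)[of j] that j forms_on_d_mono[of "fst b" X "snd b"] by (auto simp: forms_on_def)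
    then show ?thesis unfolding j(2) by (rule forms_on_lin_ext)
  qed
  then have "wedge_list ?qs \<in> forms_on X (1 * length ?qs)" by (rule forms_on_wedge_list)
  ultimately show ?thesis
    using forms_on_wedge by (fastforce simp: pull_mono_def)
qed

lemma forms_on_lookup:
  assumes "p \<in> forms_on X m" "finite (snd b) \<Longrightarrow> card (snd b) \<noteq> m"
  shows "lookup p b = 0"
  using assms by (force simp: forms_on_def in_keys_iff)

lemma forms_on_ev_0:
  assumes "p \<in> forms_on X m" "finite I \<Longrightarrow> card I \<noteq> m"
  shows "ev T I p = 0"
  unfolding ev_def lin_ext_def
proof (rule sum.neutral, rule ballI)
  fix b assume "b \<in> keys p"
  then have "snd b \<noteq> I" using assms by (auto simp: forms_on_def)
  then show "lookup p b * coeff_at T I b = 0" by (simp add: coeff_at_def)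
qed

lemma ev_pull_coeffs:
  "ev T {} (wedge_list (map (\<lambda>j. wedge_list (replicate (lookup a j) (\<phi> j)))
        (sorted_list_of_set (keys a)))) = mval (\<lambda>j. ev T {} (\<phi> j)) a"
  by (simp add: ev_wedge_list_0 o_def prod_list_replicate mval_def)
    (subst prod.distinct_set_conv_list[symmetric], auto)

lemma ev_pull_mono_0:
  assumes "finite (snd b)"
  shows "ev T {} (pull_mono \<phi> b) = coeff_at (\<lambda>j. ev T {} (\<phi> j)) {} b"
proof (cases "snd b = {}")
  case False
  then obtain j js where "sorted_list_of_set (snd b) = j # js"
    using assms by (metis list.exhaust sorted_list_of_set_eq_Nil_iff)
  then show ?thesis using False
    by (simp add: pull_mono_def ev_wedge_0 ev_wedge_list_0 coeff_at_def)
qed (simp add: pull_mono_def ev_wedge_0 ev_pull_coeffs coeff_at_def, simp add: wedge_list_def)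

lemma ev_pull_mono_1:
  "ev T {k} (pull_mono \<phi> (a, {j})) = mval (\<lambda>j. ev T {} (\<phi> j)) a * deriv_at T k (\<phi> j)"
  by (simp add: pull_mono_def ev_wedge_1 ev_pull_coeffs)
    (simp add: wedge_list_def ev_wedge_1 ev_wedge_0 deriv_at_def)

lemma d_mono_0: "d_mono (a, {}) = (\<Sum>j\<in>keys a.
    pscale (of_nat (lookup a j)) (single (a - single j 1, {j}) 1))"
  by (simp add: d_mono_def)

text \<open>Both sides are \<open>\<Sum>\<^sub>j (\<partial>\<^sub>j t\<^sup>a)(\<phi>) \<partial>\<^sub>k \<phi>\<^sub>j\<close>: the left one by the definition of the pullback of
  \<open>dt\<^sub>j\<close>, the right one by the Leibniz rule for the product of the powers \<open>\<phi>\<^sub>j\<close> to the \<open>a\<^sub>j\<close>.\<close>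

lemma chain_rule:
  "ev T {k} (lin_ext pscale (pull_mono \<phi>) (d_mono (a, {}))) = deriv_at T k (pull_mono \<phi> (a, {}))"
proof -
  let ?U = "\<lambda>j. ev T {} (\<phi> j)"
  have "ev T {k} (lin_ext pscale (pull_mono \<phi>) (d_mono (a, {}))) =
    (\<Sum>j\<in>keys a. deriv_mono ?U j a * deriv_at T k (\<phi> j))"
    by (simp add: d_mono_0 ev_def lin_ext_lin_ext[OF vector_space_mult] ev_simps)
      (simp add: ev_def[symmetric] ev_pull_mono_1 deriv_mono_def mult.assoc)
  also have "\<dots> = (\<Sum>j\<in>keys a. of_nat (lookup a j) * ?U j ^ (lookup a j - 1) * deriv_at T k (\<phi> j)
      * (\<Prod>i\<in>keys a - {j}. ?U i ^ lookup a i))"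
  proof (rule sum.cong[OF refl])
    fix j assume j: "j \<in> keys a"
    have "mval ?U (a - single j 1) =
      (\<Prod>i\<in>keys a. ?U i ^ lookup (a - single j 1) i)"
      by (rule mval_superset) (auto simp: in_keys_iff lookup_minus)
    also have "\<dots> = ?U j ^ (lookup a j - 1) * (\<Prod>i\<in>keys a - {j}. ?U i ^ lookup a i)"
      using j by (subst prod.remove[OF _ j]) (auto simp: lookup_minus lookup_single when_def intro!: prod.cong)
    finally show "deriv_mono ?U j a * deriv_at T k (\<phi> j) = of_nat (lookup a j) * ?U j ^ (lookup a j - 1) * deriv_at T k (\<phi> j)
      * (\<Prod>i\<in>keys a - {j}. ?U i ^ lookup a i)"
      by (simp add: deriv_mono_def)
  qed
  also have "\<dots> = deriv_at T k (pull_mono \<phi> (a, {}))"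
    by (simp add: pull_mono_def deriv_at_wedge deriv_at_wedge_list)
      (simp add: wedge_list_def[of "[]"] deriv_at_replicate ev_wedge_list_0 prod_list_replicate)
  finally show ?thesis .
qed

section \<open>The homotopy operator and closed 1-forms\<close>

lemma lin_ext_mult_eq_pairing: "lin_ext (*) \<xi> (p :: 'x \<Rightarrow>\<^sub>0 'k::field) = pairing (*) \<xi> p"
  by (simp add: lin_ext_def pairing_def mult.commute)

text \<open>By separation, a functional that sees only the coefficient of \<open>dt\<^sub>I\<close> is determined by the
  values of that coefficient.\<close>

lemma ev_eqD:
  fixes p q :: "'k::field_char_0 form"
  assumes "\<And>T. ev T I p = ev T I q" "\<And>b. snd b \<noteq> I \<Longrightarrow> \<xi> b = 0"
  shows "lin_ext (*) \<xi> p = lin_ext (*) \<xi> q"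
proof -
  have "lookup p b = lookup q b" if "snd b = I" for b
    using separation_pairing[OF vector_space_mult, of I p q b] assms(1) that
    by (simp add: ev_def lin_ext_mult_eq_pairing)
  then show ?thesis
    unfolding lin_ext_mult_eq_pairing
    by (intro vector_space.pairing_lookup_cong[OF vector_space_mult]) (metis assms(2))
qed

lemma ev_integrate_mono:
  "ev T I (integrate_mono b) = (if 0 \<in> snd b \<and> snd b - {0} = I then
     mval T (fst b - single 0 (lookup (fst b) 0)) /
       of_nat (lookup (fst b) 0 + 1) else 0)"
  by (simp add: integrate_mono_def ev_def ev_simps coeff_at_def field_simps)

text \<open>The index 0 stands for the coordinate \<open>u\<close> of the interval; its power splits off.\<close>

lemma mval_upd_0:
  "mval (T(0 := c)) a = c ^ lookup a 0 * mval T (a - single 0 (lookup a 0))"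
proof -
  let ?r = "a - single 0 (lookup a 0)"
  have a: "a = single 0 (lookup a 0) + ?r"
    by (intro poly_mapping_eqI) (auto simp: lookup_add lookup_minus lookup_single when_def)
  have "mval (T(0 := c)) ?r = mval T ?r"
    by (rule mval_cong) (auto simp: in_keys_iff lookup_minus lookup_single)
  then show ?thesis by (subst a) (simp only: mval_add mval_single, simp)
qed

text \<open>The fundamental theorem of calculus in the variable \<open>u\<close>: only the \<open>du\<close>-component of \<open>df\<close> is
  integrated.\<close>

lemma integrate_d_mono:
  fixes T :: "nat \<Rightarrow> 'k::field_char_0"
  shows "lin_ext (*) (\<lambda>b. ev T {} (integrate_mono b)) (d_mono c) =
    coeff_at (T(0 := 1)) {} c - coeff_at (T(0 := 0)) {} c"
proof (cases "snd c = {}")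
  case True
  let ?a = "fst c"
  have *: "?a - single 0 1 - single 0 (lookup ?a 0 - 1) =
    ?a - single 0 (lookup ?a 0)"
    by (intro poly_mapping_eqI) (auto simp: lookup_minus lookup_single when_def)
  have "lin_ext (*) (\<lambda>b. ev T {} (integrate_mono b)) (d_mono c) =
    (\<Sum>i\<in>keys ?a. if i = 0 then mval T (?a - single 0 (lookup ?a 0)) else 0)"
    unfolding lin_ext_d_mono
  proof (rule sum.cong[OF refl])
    fix i assume i: "i \<in> keys ?a"
    show "(if i \<in> snd c then 0 else of_nat (lookup ?a i) * (- 1) ^ card {j \<in> snd c. j < i}
        * ev T {} (integrate_mono (?a - single i 1, insert i (snd c)))) =
      (if i = 0 then mval T (?a - single 0 (lookup ?a 0)) else 0)"
    proof (cases "i = 0")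
      case True
      then obtain m where m: "lookup ?a 0 = Suc m" using i by (auto simp: in_keys_iff gr0_conv_Suc)
      have "(of_nat (Suc m) :: 'k) \<noteq> 0" by (simp del: of_nat_Suc)
      then show ?thesis using True \<open>snd c = {}\<close> * m
        by (simp add: ev_integrate_mono lookup_minus lookup_single add.commute)
    qed (use \<open>snd c = {}\<close> in \<open>auto simp: ev_integrate_mono\<close>)
  qed
  also have "\<dots> = coeff_at (T(0 := 1)) {} c - coeff_at (T(0 := 0)) {} c"
    using True by (auto simp: coeff_at_def mval_upd_0 in_keys_iff zero_power)
  finally show ?thesis .
next
  case False
  then have "ev T {} (integrate_mono (a, insert i (snd c))) = 0" if "i \<notin> snd c" for a i
    using that by (auto simp: ev_integrate_mono)
  then have "lin_ext (*) (\<lambda>b. ev T {} (integrate_mono b)) (d_mono c) = 0"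
    unfolding lin_ext_d_mono by (intro sum.neutral) simp
  then show ?thesis using False by (simp add: coeff_at_def)
qed

lemma forms_on_homotopy_map:
  assumes "j \<in> X" "0 \<in> X"
  shows "homotopy_map i j \<in> forms_on X 0"
  using forms_on_wedge[OF forms_on_coord[OF assms(2)] forms_on_coord[OF assms(1)]] assms
  by (auto simp: homotopy_map_def intro!: forms_on_add forms_on_diff forms_on_coord forms_on_form_one forms_on_zero)

lemma ev_homotopy_map:
  "ev T {} (homotopy_map i j) = T 0 * T j + (if j = i then 1 - T 0 else 0)"
  using ev_wedge_0[of T "coord 0" "coord j"] ev_form_one[of T "{}"] ev_coord[of T "{}" 0] ev_coord[of T "{}" j]
  by (simp add: homotopy_map_def ev_def ev_simps)

text \<open>The formula \<open>h(df) = f - f(e\<^sub>i)\<close>. By the chain rule, \<open>\<phi>\<^sup>*(df) = d(\<phi>\<^sup>* f)\<close>, and \<open>\<phi>\<close> is the identity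
  for \<open>u = 1\<close> and constant with value \<open>e\<^sub>i\<close> for \<open>u = 0\<close>. The index 0 must not occur in \<open>f\<close> since
  it is taken by \<open>u\<close>.\<close>

lemma h_mono_d_mono:
  fixes T :: "nat \<Rightarrow> 'k::field_char_0"
  assumes "0 \<notin> keys a"
  shows "lin_ext (*) (\<lambda>b. ev T {} (h_mono i b)) (d_mono (a, {})) = mval T a - eval_mono i (a, {})"
proof -
  let ?\<phi> = "homotopy_map i :: nat \<Rightarrow> 'k form"
  let ?J = "\<lambda>b. ev T {} (integrate_mono b)"
  have "lin_ext (*) (\<lambda>b. ev T {} (h_mono i b)) (d_mono (a, {})) =
    lin_ext (*) ?J (lin_ext pscale (pull_mono ?\<phi>) (d_mono (a, {})))"
    by (simp add: h_mono_def ev_def lin_ext_lin_ext[OF vector_space_mult])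
  also have "\<dots> = lin_ext (*) ?J (lin_ext pscale d_mono (pull_mono ?\<phi> (a, {})))"
    by (rule ev_eqD[of "{0}"]) (auto simp: chain_rule deriv_at_def ev_integrate_mono)
  also have "\<dots> = lin_ext (*) (\<lambda>c. coeff_at (T(0 := 1)) {} c - coeff_at (T(0 := 0)) {} c) (pull_mono ?\<phi> (a, {}))"
    by (simp add: lin_ext_lin_ext[OF vector_space_mult] integrate_d_mono)
  also have "\<dots> = ev (T(0 := 1)) {} (pull_mono ?\<phi> (a, {})) - ev (T(0 := 0)) {} (pull_mono ?\<phi> (a, {}))"
    by (simp add: ev_def lin_ext_def algebra_simps sum_subtractf)
  also have "\<dots> = mval T a - eval_mono i (a, {})"
  proof -
    have "mval (\<lambda>j. ev (T(0 := 1)) {} (?\<phi> j)) a = mval T a"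
      by (rule mval_cong) (use assms in \<open>auto simp: ev_homotopy_map\<close>)
    moreover have "mval (\<lambda>j. ev (T(0 := 0)) {} (?\<phi> j)) a = mval (\<lambda>j. of_bool (j = i)) a"
      by (rule mval_cong) (auto simp: ev_homotopy_map)
    ultimately show ?thesis
      by (simp add: ev_pull_mono_0 coeff_at_def eval_mono_def) (simp add: mval_def)
  qed
  finally show ?thesis .
qed

lemma eval_mono_eq: "eval_mono i b = coeff_at (\<lambda>j. of_bool (j = i)) {} b"
  by (simp add: eval_mono_def coeff_at_def mval_def)

lemma h_mono_forms_on:
  assumes "b \<in> simplex_basis n"
  shows "(h_mono i b :: 'k::field form) \<in> forms_on {1..n} (fdeg b - 1)"
    and "fdeg b = 0 \<Longrightarrow> (h_mono i b :: 'k form) = 0"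
proof -
  obtain a I where b: "b = (a, I)" by (cases b)
  then have aI: "keys a \<subseteq> {1..n}" "I \<subseteq> {1..n}" "finite I"
    using assms by (auto simp: simplex_basis_def dest: finite_subset)
  have pull: "(pull_mono (homotopy_map i) b :: 'k form) \<in> forms_on {0..n} (fdeg b)"
    unfolding b fdeg_def snd_conv
    by (rule forms_on_pull_mono) (use aI in \<open>auto intro!: forms_on_homotopy_map\<close>)
  show "(h_mono i b :: 'k form) \<in> forms_on {1..n} (fdeg b - 1)"
    unfolding h_mono_def
  proof (rule forms_on_lin_ext)
    fix c :: mono_form
    assume "c \<in> keys (pull_mono (homotopy_map i) b :: 'k form)"
    then have c: "keys (fst c) \<subseteq> {0..n}" "snd c \<subseteq> {0..n}" "finite (snd c)" "card (snd c) = fdeg b"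
      using pull by (auto simp: forms_on_def)
    show "integrate_mono c \<in> forms_on {1..n} (fdeg b - 1)"
    proof (cases "0 \<in> snd c")
      case True
      have "x \<in> {1..n}" if "x \<in> keys (fst c - single 0 (lookup (fst c) 0))" for x
      proof -
        have "x \<noteq> 0" "x \<in> keys (fst c)" using that
          by (auto simp: in_keys_iff lookup_minus lookup_single when_def split: if_splits)
        then show ?thesis using c by auto
      qed
      moreover have "snd c - {0} \<subseteq> {1..n}" using c by (auto simp: Suc_le_eq)
      ultimately show ?thesis using True c
        by (auto simp: integrate_mono_def forms_on_def)
    qed (auto simp: integrate_mono_def forms_on_zero)
  qed
  assume "fdeg b = 0"
  then have "(integrate_mono c :: 'k form) = 0" if "c \<in> keys (pull_mono (homotopy_map i) b :: 'k form)" for c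
    using pull that by (auto simp: forms_on_def integrate_mono_def)
  then show "(h_mono i b :: 'k form) = 0"
    by (auto simp: h_mono_def lin_ext_def pscale_zero_right intro!: sum.neutral)
qed

lemma forms_on_simplicial_map: "simplicial_map 1 v j \<in> forms_on {1..1} 0"
  unfolding simplicial_map_def
  by (rule forms_on_sum) (auto simp: bary_def intro!: forms_on_diff forms_on_form_one forms_on_coord)

lemma ev_simplicial_map_vertex:
  assumes "i \<le> 1"
  shows "ev (\<lambda>j. of_bool (j = i)) {} (simplicial_map 1 v j :: 'k::field form) = of_bool (v i = j)"
proof -
  let ?T = "\<lambda>j. of_bool (j = i) :: 'k"
  have bary: "ev ?T {} (bary 1 k) = of_bool (k = i)" if "k \<le> 1" for k
    using that assms ev_form_one[of ?T "{}"] ev_coord[of ?T "{}" 1]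
    ev_coord[of ?T "{}" k] by (cases "k = 0") (auto simp: bary_def ev_def ev_simps)
  have "ev ?T {} (simplicial_map 1 v j) = (\<Sum>k | k \<le> 1 \<and> v k = j. ev ?T {} (bary 1 k))"
    by (simp add: simplicial_map_def ev_def ev_simps)
  also have "\<dots> = (\<Sum>k | k \<le> 1 \<and> v k = j. of_bool (k = i))"
    by (rule sum.cong) (auto simp: bary[simplified])
  also have "\<dots> = of_bool (v i = j)"
  proof -
    have "finite {k. k \<le> 1 \<and> v k = j}" by (rule finite_subset[of _ "{..1}"]) auto
    then show ?thesis using assms by (auto simp: of_bool_def)
  qed
  finally show ?thesis .
qed

text \<open>The total degree of the monomial \<open>t\<^sup>a\<close>.\<close>

definition tot :: "(nat \<Rightarrow>\<^sub>0 nat) \<Rightarrow> nat" where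
  "tot a = (\<Sum>i\<in>keys a. lookup a i)"

lemma tot_remove:
  assumes "i \<in> keys a"
  shows "Suc (tot (a - single i 1)) = tot a"
proof -
  have "tot (a - single i 1) = (\<Sum>j\<in>keys a. lookup (a - single i 1) j)"
    unfolding tot_def by (rule sum.mono_neutral_left) (auto simp: in_keys_iff lookup_minus)
  also have "\<dots> = (lookup a i - 1) + (\<Sum>j\<in>keys a - {i}. lookup a j)"
    by (subst sum.remove[OF _ assms]) (auto simp: lookup_minus lookup_single when_def intro!: sum.cong)
  finally show ?thesis
    using assms sum.remove[OF _ assms, of "lookup a"] by (simp add: tot_def in_keys_iff)
qed

text \<open>The cone operator with apex \<open>0\<close> sends \<open>t\<^sup>a dt\<^sub>j\<close> to \<open>t\<^sup>a t\<^sub>j / (|a| + 1)\<close> and, for \<open>i < l\<close>,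
  \<open>t\<^sup>c dt\<^sub>i dt\<^sub>l\<close> to \<open>t\<^sup>c (t\<^sub>i dt\<^sub>l - t\<^sub>l dt\<^sub>i) / (|c| + 2)\<close>; it satisfies \<open>d K + K d = id\<close> on 1-forms.
  This is the \<open>dt\<^sub>k\<close>-component of that identity at \<open>T\<close>, with \<open>\<xi>\<close> the \<open>dt\<^sub>k\<close>-component of \<open>- K\<close>. In
  this dual form it applies to forms with coefficients in any vector space.\<close>

lemma poincare:
  fixes T :: "nat \<Rightarrow> 'k::field_char_0"
  shows "\<exists>\<xi>. (\<forall>b. card (snd b) \<noteq> 2 \<longrightarrow> \<xi> b = 0) \<and> (\<forall>a j. lin_ext (*) \<xi> (d_mono (a, {j})) =
    deriv_mono T k (a + single j 1) / of_nat (Suc (tot a)) - coeff_at T {k} (a, {j}))"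
proof -
  let ?e = "\<lambda>j. single j (1::nat)"
  define \<xi> :: "mono_form \<Rightarrow> 'k" where "\<xi> = (\<lambda>b. if card (snd b) = 2 then
    (coeff_at T {k} (fst b + ?e (Max (snd b)), {Min (snd b)}) -
     coeff_at T {k} (fst b + ?e (Min (snd b)), {Max (snd b)})) / of_nat (tot (fst b) + 2) else 0)"
  have "lin_ext (*) \<xi> (d_mono (a, {j})) =
    deriv_mono T k (a + ?e j) / of_nat (Suc (tot a)) - coeff_at T {k} (a, {j})" for a j
  proof -
    have "lin_ext (*) \<xi> (d_mono (a, {j})) = (\<Sum>i\<in>keys a. of_nat (lookup a i) *
        (coeff_at T {k} (a - ?e i + ?e j, {i}) - coeff_at T {k} (a, {j})) / of_nat (Suc (tot a)))"
      unfolding lin_ext_d_mono fst_conv snd_conv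
    proof (rule sum.cong[OF refl])
      fix i assume i: "i \<in> keys a"
      have a: "a - ?e i + ?e i = a" using i
        by (intro poly_mapping_eqI) (auto simp: lookup_add lookup_minus lookup_single when_def in_keys_iff)
      have t: "of_nat (tot (a - ?e i) + 2) = (of_nat (Suc (tot a)) :: 'k)"
        using tot_remove[OF i] by (simp only: of_nat_eq_iff)
      consider "i = j" | "i < j" | "j < i" by linarith
      then show "(if i \<in> {j} then 0 else of_nat (lookup a i) * (- 1) ^ card {j' \<in> {j}. j' < i} *
          \<xi> (a - ?e i, insert i {j})) = of_nat (lookup a i) *
        (coeff_at T {k} (a - ?e i + ?e j, {i}) - coeff_at T {k} (a, {j})) / of_nat (Suc (tot a))"
      proof cases
        case 1
        then show ?thesis using a[simplified] 1 by simp
      next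
        case 2
        then have [simp]: "Max {i, j} = j" "Min {i, j} = i" "{j'. j' = j \<and> j' < i} = {}" "i \<noteq> j" by auto
        show ?thesis by (simp add: \<xi>_def a[simplified] t[simplified])
      next
        case 3
        then have [simp]: "Max {i, j} = i" "Min {i, j} = j" "{j'. j' = j \<and> j' < i} = {j}" "i \<noteq> j" by auto
        show ?thesis by (simp add: \<xi>_def a[simplified] t[simplified] right_diff_distrib diff_divide_distrib)
      qed
    qed
    also have "\<dots> = ((\<Sum>i\<in>keys a. of_nat (lookup a i) * coeff_at T {k} (a - ?e i + ?e j, {i}))
        - of_nat (tot a) * coeff_at T {k} (a, {j})) / of_nat (Suc (tot a))"
      by (simp add: sum_divide_distrib[symmetric] right_diff_distrib sum_subtractf sum_distrib_right tot_def of_nat_sum)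
    also have "(\<Sum>i\<in>keys a. of_nat (lookup a i) * coeff_at T {k} (a - ?e i + ?e j, {i})) =
      (\<Sum>i\<in>keys a. if i = k then deriv_mono T k a * T j else 0)"
      by (rule sum.cong) (auto simp: coeff_at_def deriv_mono_def mval_add)
    also have "\<dots> = deriv_mono T k a * T j"
      by (auto simp: deriv_mono_def in_keys_iff)
    also have "deriv_mono T k a * T j = deriv_mono T k (a + ?e j) - coeff_at T {k} (a, {j})"
      by (simp add: deriv_mono_add deriv_mono_single[simplified] coeff_at_def)
    also have "(deriv_mono T k (a + ?e j) - coeff_at T {k} (a, {j}) - of_nat (tot a) * coeff_at T {k} (a, {j})) / of_nat (Suc (tot a))
      = deriv_mono T k (a + ?e j) / of_nat (Suc (tot a)) - coeff_at T {k} (a, {j})"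
    proof -
      have "of_nat (Suc (tot a)) \<noteq> (0 :: 'k)" by (simp del: of_nat_Suc)
      then show ?thesis by (simp add: field_simps del: of_nat_Suc, simp add: algebra_simps)
    qed
    finally show ?thesis .
  qed
  moreover have "\<forall>b. card (snd b) \<noteq> 2 \<longrightarrow> \<xi> b = 0" by (simp add: \<xi>_def)
  ultimately show ?thesis by blast
qed

section \<open>Linear maps and the operations of a Leibniz algebra\<close>

abbreviation "linear_map \<equiv> Vector_Spaces.linear"

lemma linear_simps:
  assumes "linear_map s1 s2 f"
  shows "f (x + y) = f x + f y" "f (s1 c x) = s2 c (f x)" "f 0 = 0" "f (- x) = - f x"
    "f (x - y) = f x - f y" "f (sum g A) = (\<Sum>a\<in>A. f (g a))"
proof -
  interpret Vector_Spaces.linear s1 s2 f by fact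
  show "f (x + y) = f x + f y" "f (s1 c x) = s2 c (f x)" "f 0 = 0" "f (- x) = - f x"
    "f (x - y) = f x - f y" "f (sum g A) = (\<Sum>a\<in>A. f (g a))"
    by (simp_all add: add scale zero neg diff sum)
qed

lemma linear_vs:
  assumes "linear_map s1 s2 f"
  shows "vector_space s1" "vector_space s2"
  using assms by (simp_all add: Vector_Spaces.linear_def)

lemma linear_pairing:
  assumes "linear_map s1 s2 f"
  shows "f (pairing s1 \<xi> \<alpha>) = (\<Sum>b\<in>keys \<alpha>. s2 (\<xi> b) (f (lookup \<alpha> b)))"
  by (simp add: pairing_def linear_simps[OF assms])

lemma linear_plus:
  assumes "linear_map s1 s2 f" "linear_map s1 s2 g"
  shows "linear_map s1 s2 (\<lambda>x. f x + g x)"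
proof -
  interpret vector_space s2 using assms linear_vs by blast
  show ?thesis using assms linear_vs[OF assms(1)]
    by (auto simp: Vector_Spaces.linear_iff algebra_simps scale_right_distrib)
qed

lemma linear_minus:
  assumes "linear_map s1 s2 f" "linear_map s1 s2 g"
  shows "linear_map s1 s2 (\<lambda>x. f x - g x)"
proof -
  interpret vector_space s2 using assms linear_vs by blast
  show ?thesis using assms linear_vs[OF assms(1)]
    by (auto simp: Vector_Spaces.linear_iff algebra_simps scale_right_diff_distrib)
qed

lemma linear_scaled:
  assumes "linear_map s1 s2 f"
  shows "linear_map s1 s2 (\<lambda>x. s2 c (f x))"
proof -
  interpret vector_space s2 using assms linear_vs by blast
  show ?thesis using assms linear_vs[OF assms(1)]
    by (auto simp: Vector_Spaces.linear_iff scale_right_distrib scale_left_commute)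
qed

lemma linear_null:
  assumes "vector_space s1" "vector_space s2"
  shows "linear_map s1 s2 (\<lambda>x. 0)"
proof -
  interpret vector_space s2 by fact
  show ?thesis using assms by (auto simp: Vector_Spaces.linear_iff)
qed

lemma linear_neg:
  assumes "linear_map s1 s2 f"
  shows "linear_map s1 s2 (\<lambda>x. - f x)"
  using linear_minus[OF linear_null assms] linear_vs[OF assms] by simp

lemma linear_summed:
  assumes "vector_space s1" "vector_space s2" "\<And>a. a \<in> A \<Longrightarrow> linear_map s1 s2 (f a)"
  shows "linear_map s1 s2 (\<lambda>x. \<Sum>a\<in>A. f a x)"
  using assms(3)
  by (induction A rule: infinite_finite_induct) (auto intro: linear_null[OF assms(1,2)] linear_plus)

lemma linear_lin_ext:
  assumes "vector_space s1" "vector_space s2" "\<And>a. a \<in> keys p \<Longrightarrow> linear_map s1 s2 (f a)"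
  shows "linear_map s1 s2 (\<lambda>x. lin_ext s2 (\<lambda>a. f a x) p)"
  unfolding lin_ext_def by (intro linear_summed linear_scaled assms)

lemma linear_comp:
  assumes "linear_map s1 s2 f" "linear_map s2 s3 g"
  shows "linear_map s1 s3 (\<lambda>x. g (f x))"
  using assms by (simp add: Vector_Spaces.linear_iff)

lemma sum_fun_apply: "(sum f A) x = (\<Sum>a\<in>A. f a x)"
  by (induction A rule: infinite_finite_induct) auto

context two_term_leibniz
begin

lemmas l1_simps [simp] = linear_simps[OF l1_linear]

lemma bilinear_simps:
  assumes "bilinear_map s1 s2 s3 f"
  shows "f (x + x') y = f x y + f x' y" "f x (y + y') = f x y + f x y'"
    "f (s1 c x) y = s3 c (f x y)" "f x (s2 c y) = s3 c (f x y)" "f 0 y = 0" "f x 0 = 0"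
    "f (- x) y = - f x y" "f x (- y) = - f x y"
    "f (x - x') y = f x y - f x' y" "f x (y - y') = f x y - f x y'"
  using linear_simps[of s2 s3 "f x"] linear_simps[of s1 s3 "\<lambda>x. f x y"] assms
  by (auto simp: bilinear_map_def)

lemmas l2_00_simps [simp] = bilinear_simps[OF l2_00_bilinear]
lemmas l2_01_simps [simp] = bilinear_simps[OF l2_01_bilinear]
lemmas l2_10_simps [simp] = bilinear_simps[OF l2_10_bilinear]
lemmas l3_simps [simp] = linear_simps(1-5)[OF l3_linear1] linear_simps(1-5)[OF l3_linear2] linear_simps(1-5)[OF l3_linear3]

lemma vector_space_scl: "vector_space (scl V)"
proof -
  interpret v0: vector_space "scl0 V" by (rule vs0)
  interpret v1: vector_space "scl1 V" by (rule vs1)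
  show ?thesis
    by standard (auto simp: scl_def v0.scale_right_distrib v1.scale_right_distrib
      v0.scale_left_distrib v1.scale_left_distrib)
qed

lemma vector_space_conv: "vector_space (conv_scale V)"
proof -
  interpret v: vector_space "scl V" by (rule vector_space_scl)
  show ?thesis
    by standard (auto simp: conv_scale_def fun_eq_iff v.scale_right_distrib v.scale_left_distrib)
qed

lemma scl_simps [simp]: "fst (scl V c v) = scl0 V c (fst v)" "snd (scl V c v) = scl1 V c (snd v)"
  by (simp_all add: scl_def)

lemma scl0_zero [simp]: "scl0 V c 0 = 0" "scl0 V 0 x = 0" "scl0 V 1 x = x"
proof -
  interpret v0: vector_space "scl0 V" by (rule vs0)
  show "scl0 V c 0 = 0" "scl0 V 0 x = 0" "scl0 V 1 x = x" by simp_all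
qed

lemma scl1_zero [simp]: "scl1 V c 0 = 0" "scl1 V 0 x = 0" "scl1 V 1 x = x"
proof -
  interpret v1: vector_space "scl1 V" by (rule vs1)
  show "scl1 V c 0 = 0" "scl1 V 0 x = 0" "scl1 V 1 x = x" by simp_all
qed

lemma scl1_add: "scl1 V c (x + y) = scl1 V c x + scl1 V c y"
  using vs1 by (rule vector_space.vector_space_assms(1))

lemma scl1_one_neg [simp]: "scl1 V (- 1) x = - x"
proof -
  interpret v1: vector_space "scl1 V" by (rule vs1)
  show ?thesis by simp
qed

lemma scl0_one_neg [simp]: "scl0 V (- 1) x = - x"
proof -
  interpret v0: vector_space "scl0 V" by (rule vs0)
  show ?thesis by simp
qed

lemma ops_linear_1: "linear_map (scl V) (scl V) (\<lambda>u. ops V [u])"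
  using vector_space_scl by (simp add: Vector_Spaces.linear_iff prod_eq_iff)

lemma ops_linear_2:
  "linear_map (scl V) (scl V) (\<lambda>u. ops V [u, v])"
  "linear_map (scl V) (scl V) (\<lambda>u. ops V [v, u])"
  using vector_space_scl by (simp_all add: Vector_Spaces.linear_iff prod_eq_iff scl1_add)

lemma ops_linear_3:
  "linear_map (scl V) (scl V) (\<lambda>u. ops V [u, v, w])"
  "linear_map (scl V) (scl V) (\<lambda>u. ops V [v, u, w])"
  "linear_map (scl V) (scl V) (\<lambda>u. ops V [v, w, u])"
  using vector_space_scl by (simp_all add: Vector_Spaces.linear_iff prod_eq_iff)

end

section \<open>Coproduct and coderivation on short words\<close>

lemma permutes_lessThan_0: "{\<sigma>. \<sigma> permutes {..<0::nat}} = {id}"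
  by auto
lemma permutes_lessThan_1: "{\<sigma>. \<sigma> permutes {..<Suc 0}} = {id}"
  by (auto simp: lessThan_Suc)
lemma permutes_lessThan_2: "{\<sigma>. \<sigma> permutes {..<Suc (Suc 0)}} = {id, transpose 0 1}"
  by (auto simp: lessThan_Suc permutes_doubleton_iff insert_commute)

lemma Sh_Collect: "Sh p q = {\<sigma> \<in> {\<sigma>. \<sigma> permutes {..<p + q}}. strict_mono_on {..<p} \<sigma> \<and> strict_mono_on {p..<p + q} \<sigma>}"
  by (auto simp: Sh_def)

lemma Sh_0_0: "Sh 0 0 = {id}"
  by (auto simp: Sh_Collect permutes_lessThan_0 strict_mono_on_def)
lemma Sh_1_0: "Sh (Suc 0) 0 = {id}"
  unfolding Sh_Collect add_Suc_right add_Suc add_0 add_0_right permutes_lessThan_1 by (auto simp: strict_mono_on_def)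
lemma Sh_0_1: "Sh 0 (Suc 0) = {id}"
  unfolding Sh_Collect add_Suc_right add_Suc add_0 add_0_right permutes_lessThan_1 by (auto simp: strict_mono_on_def)
lemma not_strict_mono_swap: "\<not> strict_mono_on {..<Suc (Suc 0)} (transpose 0 (Suc 0))"
  "\<not> strict_mono_on {0..<Suc (Suc 0)} (transpose 0 (Suc 0))"
  by (force simp: strict_mono_on_def)+
lemma Sh_2_0: "Sh (Suc (Suc 0)) 0 = {id}"
  unfolding Sh_Collect add_Suc_right add_Suc add_0 add_0_right permutes_lessThan_2
  by (auto simp: not_strict_mono_swap) (auto simp: strict_mono_on_def)
lemma Sh_0_2: "Sh 0 (Suc (Suc 0)) = {id}"
  unfolding Sh_Collect add_Suc_right add_Suc add_0 add_0_right permutes_lessThan_2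
  by (auto simp: not_strict_mono_swap) (auto simp: strict_mono_on_def)
lemma Sh_1_1: "Sh (Suc 0) (Suc 0) = {id, transpose 0 1}"
  unfolding Sh_Collect add_Suc_right add_Suc add_0 add_0_right permutes_lessThan_2
  by (auto simp: strict_mono_on_def transpose_def)

lemmas Sh_small = Sh_0_0 Sh_1_0 Sh_0_1 Sh_2_0 Sh_0_2 Sh_1_1

lemma id_noteq_transpose: "id \<noteq> transpose 0 (Suc 0)"
  by (metis id_apply transpose_apply_first nat.distinct(1))

lemma small_interval_sets:
  "{Suc 0..<Suc 0} = {}" "{Suc 0..<Suc (Suc 0)} = {Suc 0}" "{Suc 0..<Suc (Suc (Suc 0))} = {Suc 0, Suc (Suc 0)}"
  "{Suc 0..Suc 0} = {Suc 0}" "{Suc 0..Suc (Suc 0)} = {Suc 0, Suc (Suc 0)}"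
  "{Suc 0..Suc (Suc (Suc 0))} = {Suc 0, Suc (Suc 0), Suc (Suc (Suc 0))}"
  "{Suc (Suc 0)..Suc (Suc (Suc 0))} = {Suc (Suc 0), Suc (Suc (Suc 0))}"
  by auto

lemma koszul_id: "koszul ds id = 1"
  by (auto simp: koszul_def intro!: prod.neutral)

lemma koszul_swap: "koszul [d, e] (transpose 0 (Suc 0)) = (- 1) powi (d * e)"
  by (simp add: koszul_def lessThan_Suc mult.commute)

lemma coprod_1: "coprod [u] = 0"
  by (simp add: coprod_def)

lemma coprod_2: "coprod [u, v] = single [[u], [v]] 1"
  by (simp add: coprod_def small_interval_sets Sh_small koszul_id)

lemma coprod_3: "coprod [u, v, t] = single [[u], [v, t]] 1
   + single [[v], [u, t]] ((- 1) powi (sdeg u * sdeg v)) + single [[u, v], [t]] 1"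
  by (simp add: coprod_def small_interval_sets Sh_small koszul_id koszul_swap id_noteq_transpose
     permute_list_def numeral_2_eq_2)

lemma pscale_one [simp]: "pscale 1 p = p"
  by (intro poly_mapping_eqI) simp

lemmas pscale_simps = lin_ext_single[OF vector_space_pscale] lin_ext_add[OF vector_space_pscale]
  lin_ext_sum[OF vector_space_pscale]

lemma pscale_single [simp]: "pscale c (single x d) = single x (c * d)"
  by (intro poly_mapping_eqI) (simp add: lookup_single when_def)

lemma lin_ext_single_one: "lin_ext pscale (\<lambda>x. single x 1) p = p"
proof (rule poly_mapping_eqI)
  fix k
  have "lookup (lin_ext pscale (\<lambda>x. single x 1) p) k
    = (\<Sum>x\<in>keys p. if x = k then lookup p x else 0)"
    by (auto simp: lin_ext_def lookup_sum lookup_single when_def intro!: sum.cong)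
  also have "\<dots> = lookup p k" by (simp add: in_keys_iff)
  finally show "lookup (lin_ext pscale (\<lambda>x. single x 1) p) k = lookup p k" .
qed

lemma coprod_iter_1: "coprod_iter (Suc 0) w = coprod w"
  by (simp add: pscale_simps lin_ext_single_one)

lemma coprod_iter_2: "coprod_iter (Suc (Suc 0)) w =
     lin_ext pscale (\<lambda>ws. lin_ext pscale (\<lambda>ab. single (ab @ tl ws) 1) (coprod (hd ws))) (coprod w)"
  by (simp only: coprod_iter.simps(2)[of "Suc 0"] coprod_iter_1)

lemma coprod_iter_2_2: "coprod_iter (Suc (Suc 0)) [u, v] = 0"
  unfolding coprod_iter_2 coprod_2 by (simp add: pscale_simps coprod_1)

lemma coprod_iter_2_3: "coprod_iter (Suc (Suc 0)) [u, v, t] = single [[u], [v], [t]] 1"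
  unfolding coprod_iter_2 coprod_3 by (simp add: pscale_simps coprod_1 coprod_2)

lemma wdeg_simps [simp]: "wdeg [] = 0" "wdeg (v # w) = sdeg v + wdeg w" "wdeg (w @ w') = wdeg w + wdeg w'"
  by (simp_all add: wdeg_def)

lemma sdeg_simps [simp]: "sdeg (Inl x) = 1" "sdeg (Inr y) = 2"
  by (simp_all add: sdeg_def vdeg_def)

lemma vdeg_simps [simp]: "vdeg (Inl x) = 0" "vdeg (Inr y) = 1"
  by (simp_all add: vdeg_def)

context two_term_leibniz
begin

text \<open>The signs come from \<open>l\<^sub>i = s\<^sup>-\<^sup>1 D\<^sub>i s\<^sup>\<otimes>\<^sup>i\<close>; only an element of \<open>V\<^sub>1\<close> that is not in the last place
  contributes one.\<close>

lemma corestr_small: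
  "corestr V [Inl x] = 0"
  "corestr V [Inr y] = single (Inl (l1 V y)) 1"
  "corestr V [Inl x, Inl x'] = single (Inl (l2_00 V x x')) 1"
  "corestr V [Inl x, Inr y] = single (Inr (l2_01 V x y)) 1"
  "corestr V [Inr y, Inl x] = single (Inr (l2_10 V y x)) (- 1)"
  "corestr V [Inl x, Inl x', Inl x''] = single (Inr (l3 V x x' x'')) 1"
  by (simp_all add: corestr_def emb_def Let_def lessThan_Suc)

lemmas coder_simps = coder_def small_interval_sets Sh_small koszul_id koszul_swap id_noteq_transpose
     permute_list_def numeral_2_eq_2 numeral_3_eq_3 corestr_small pscale_simps

lemma coder_small:
  "coder V [Inl x] = 0"
  "coder V [Inr y] = single [Inl (l1 V y)] 1"
  "coder V [Inl x, Inl x'] = single [Inl (l2_00 V x x')] 1"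
  "coder V [Inl x, Inr y] = single [Inr (l2_01 V x y)] 1 + single [Inl x, Inl (l1 V y)] (- 1)"
  "coder V [Inr y, Inl x] = single [Inr (l2_10 V y x)] (- 1) + single [Inl (l1 V y), Inl x] 1"
  "coder V [Inl x, Inl x', Inl x''] = single [Inl (l2_00 V x x'), Inl x''] 1
    + single [Inl x, Inl (l2_00 V x' x'')] (- 1) + single [Inl x', Inl (l2_00 V x x'')] 1
    + single [Inr (l3 V x x' x'')] 1"
  by (simp add: coder_simps, simp add: coder_simps, simp add: coder_simps, simp add: coder_simps,
    simp add: coder_simps add.commute, simp add: coder_simps)

end

lemma wdeg_permute_list:
  assumes "\<sigma> permutes {..<length w}"
  shows "wdeg (permute_list \<sigma> w) = wdeg w"
proof -
  have "mset (map sdeg (permute_list \<sigma> w)) = mset (map sdeg w)"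
    using mset_permute_list[OF assms] by simp
  then show ?thesis by (simp only: wdeg_def sum_mset_sum_list[symmetric])
qed

lemma keys_sum_subset:
  assumes "\<And>a. a \<in> A \<Longrightarrow> keys (f a) \<subseteq> B"
  shows "keys (sum f A) \<subseteq> B"
  using assms Poly_Mapping.keys_sum[of f A] by blast

text \<open>Coproduct and coderivation are homogeneous, of degrees \<open>0\<close> and \<open>-1\<close>. Since \<open>W\<close> lives in two degrees,
  this restricts every equation in \<open>L\<close> to very short words.\<close>

lemma coprod_keys:
  assumes "ws \<in> keys (coprod w :: _ \<Rightarrow>\<^sub>0 'k::field)"
  shows "\<exists>u v. ws = [u, v] \<and> wdeg u + wdeg v = wdeg w"
proof -
  have "keys (coprod w :: _ \<Rightarrow>\<^sub>0 'k) \<subseteq> {ws. \<exists>u v. ws = [u, v] \<and> wdeg u + wdeg v = wdeg w}"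
    unfolding coprod_def Let_def
  proof (intro keys_sum_subset)
    fix k \<sigma> assume k: "k \<in> {1..<length w}" and \<sigma>: "\<sigma> \<in> Sh k (length w - k - 1)"
    let ?u = "permute_list \<sigma> (butlast w)"
    have w: "w \<noteq> []" using k by auto
    have "k + (length w - k - 1) = length (butlast w)" using k by simp
    then have "wdeg ?u = wdeg (butlast w)"
      using \<sigma> by (intro wdeg_permute_list) (auto simp: Sh_def)
    moreover have "wdeg (take k ?u) + wdeg (drop k ?u) = wdeg ?u"
      by (metis append_take_drop_id wdeg_simps(3))
    moreover have "wdeg (butlast w) + wdeg [last w] = wdeg w"
      using w by (metis append_butlast_last_id wdeg_simps(3))
    ultimately show "keys (single [take k ?u, drop k ?u @ [last w]]
        (koszul (map sdeg (butlast w)) \<sigma> :: 'k)) \<subseteq> {ws. \<exists>u v. ws = [u, v] \<and> wdeg u + wdeg v = wdeg w}"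
      by auto
  qed
  then show ?thesis using assms by blast
qed

lemma coprod_iter_2_keys:
  assumes "ws \<in> keys (coprod_iter (Suc (Suc 0)) w :: _ \<Rightarrow>\<^sub>0 'k::field)"
  shows "\<exists>u v t. ws = [u, v, t] \<and> wdeg u + wdeg v + wdeg t = wdeg w"
proof -
  have "ws \<in> (\<Union>us\<in>keys (coprod w :: _ \<Rightarrow>\<^sub>0 'k). keys
      (lin_ext pscale (\<lambda>ab. single (ab @ tl us) (1 :: 'k)) (coprod (hd us))))"
    using assms unfolding coprod_iter_2 by (rule subsetD[OF keys_lin_ext_pscale])
  then obtain us where us: "us \<in> keys (coprod w :: _ \<Rightarrow>\<^sub>0 'k)"
    and ws: "ws \<in> keys (lin_ext pscale (\<lambda>ab. single (ab @ tl us) (1 :: 'k)) (coprod (hd us)))"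
    by (rule UN_E)
  from ws have "ws \<in> (\<Union>ab\<in>keys (coprod (hd us) :: _ \<Rightarrow>\<^sub>0 'k).
      keys (single (ab @ tl us) (1 :: 'k)))"
    by (rule subsetD[OF keys_lin_ext_pscale])
  then obtain vs where vs: "vs \<in> keys (coprod (hd us) :: _ \<Rightarrow>\<^sub>0 'k)" "ws = vs @ tl us"
    by auto
  obtain u v where "us = [u, v]" "wdeg u + wdeg v = wdeg w" using coprod_keys[OF us] by auto
  moreover obtain p q where "vs = [p, q]" "wdeg p + wdeg q = wdeg (hd us)" using coprod_keys[OF vs(1)] by auto
  ultimately show ?thesis using vs(2) by auto
qed

context two_term_leibniz
begin

lemma corestr_keys:
  assumes "v \<in> keys (corestr V w)"
  shows "sdeg v = wdeg w - 1"
proof -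
  have "wdeg w = sum_list (map vdeg w) + int (length w)"
    by (induction w) (auto simp: sdeg_def)
  then show ?thesis using assms
    by (auto simp: corestr_def Let_def split: if_splits)
qed

lemma coder_keys:
  assumes "v \<in> keys (coder V w)"
  shows "wdeg v = wdeg w - 1"
proof -
  have "keys (coder V w) \<subseteq> {v. wdeg v = wdeg w - 1}"
    unfolding coder_def Let_def
  proof (intro keys_sum_subset order_trans[OF keys_lin_ext_pscale] UN_least)
    fix i j \<sigma> v
    assume i: "i \<in> {1..length w}" and j: "j \<in> {i..length w}" and \<sigma>: "\<sigma> \<in> Sh (j - i) (i - 1)"
    let ?u = "permute_list \<sigma> (take (j - 1) w)"
    assume v: "v \<in> keys (corestr V (drop (j - i) ?u @ [w ! (j - 1)]))"
    have "(j - i) + (i - 1) = length (take (j - 1) w)" using i j by auto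
    then have "wdeg ?u = wdeg (take (j - 1) w)"
      using \<sigma> by (intro wdeg_permute_list) (auto simp: Sh_def)
    moreover have "wdeg (take (j - i) ?u) + wdeg (drop (j - i) ?u) = wdeg ?u"
      by (metis append_take_drop_id wdeg_simps(3))
    moreover have "wdeg (take (j - 1) w) + sdeg (w ! (j - 1)) + wdeg (drop j w) = wdeg w"
    proof -
      have "w = take (j - 1) w @ w ! (j - 1) # drop j w"
        using i j id_take_nth_drop[of "j - 1" w] by auto
      then show ?thesis by (metis wdeg_simps(2,3) add.assoc)
    qed
    ultimately show "keys (single (take (j - i) ?u @ v # drop j w)
      (koszul (map sdeg (take (j - 1) w)) \<sigma> * (- 1) powi wdeg (take (j - i) ?u) :: 'k)) \<subseteq> {v. wdeg v = wdeg w - 1}"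
      using corestr_keys[OF v] by auto
  qed
  then show ?thesis using assms by blast
qed

end

lemma wdeg_nonneg: "wdeg w \<ge> 0"
  by (induction w) (auto simp: sdeg_def vdeg_def split: sum.splits)

lemma wdeg_Cons_pos: "wdeg (v # w) \<ge> 1"
  using wdeg_nonneg[of w] by (cases v) auto

lemma wdeg_0: "wdeg w = 0 \<Longrightarrow> w = []"
proof (cases w)
  case (Cons v u)
  then show "wdeg w = 0 \<Longrightarrow> w = []" using wdeg_Cons_pos[of v u] by simp
qed simp

lemma wdeg_1: "wdeg w = 1 \<Longrightarrow> \<exists>x. w = [Inl x]"
proof (cases w)
  case (Cons v u)
  then show "wdeg w = 1 \<Longrightarrow> \<exists>x. w = [Inl x]"
    using wdeg_nonneg[of u] wdeg_0[of u] by (cases v) auto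
qed simp

lemma wdeg_2: "wdeg w = 2 \<Longrightarrow> (\<exists>h. w = [Inr h]) \<or> (\<exists>x y. w = [Inl x, Inl y])"
proof (cases w)
  case (Cons v u)
  then show "wdeg w = 2 \<Longrightarrow> (\<exists>h. w = [Inr h]) \<or> (\<exists>x y. w = [Inl x, Inl y])"
    using wdeg_nonneg[of u] wdeg_0[of u] wdeg_1[of u] by (cases v) auto
qed simp

lemma wdeg_3: "wdeg w = 3 \<Longrightarrow> (\<exists>x h. w = [Inl x, Inr h]) \<or> (\<exists>x h. w = [Inr h, Inl x]) \<or> (\<exists>x y z. w = [Inl x, Inl y, Inl z])"
proof (cases w)
  case (Cons v u)
  then show "wdeg w = 3 \<Longrightarrow> (\<exists>x h. w = [Inl x, Inr h]) \<or> (\<exists>x h. w = [Inr h, Inl x]) \<or> (\<exists>x y z. w = [Inl x, Inl y, Inl z])"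
    using wdeg_nonneg[of u] wdeg_1[of u] wdeg_2[of u] by (cases v) auto
qed simp

section \<open>The convolution algebra\<close>

locale convolution = V: two_term_leibniz V + W: two_term_leibniz W
  for V :: "('k::field_char_0, 'a::ab_group_add, 'b::ab_group_add) leibniz2"
    and W :: "('k, 'c::ab_group_add, 'd::ab_group_add) leibniz2"
begin

sublocale L: vector_space "conv_scale W :: 'k \<Rightarrow> ('a, 'b, 'c, 'd) conv \<Rightarrow> ('a, 'b, 'c, 'd) conv"
  by (rule W.vector_space_conv)

sublocale W': vector_space "scl W"
  by (rule W.vector_space_scl)

abbreviation pair :: "('x \<Rightarrow> 'k) \<Rightarrow> ('x \<Rightarrow>\<^sub>0 ('a, 'b, 'c, 'd) conv) \<Rightarrow> ('a, 'b, 'c, 'd) conv" where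
  "pair \<equiv> pairing (conv_scale W)"

lemma conv_scale_apply [simp]: "conv_scale W c F w = scl W c (F w)"
  by (simp add: conv_scale_def)

lemma pair_apply: "pair \<xi> \<alpha> w = (\<Sum>b\<in>keys \<alpha>. scl W (\<xi> b) (lookup \<alpha> b w))"
  by (simp add: pairing_def sum_fun_apply)

lemma conv_degD:
  assumes "F \<in> conv_deg V W k"
  shows "F [] = 0" "wdeg w + k \<noteq> 0 \<Longrightarrow> fst (F w) = 0" "wdeg w + k \<noteq> 1 \<Longrightarrow> snd (F w) = 0"
    "linear_map (scl0 V) (scl W) (\<lambda>x. F (u @ Inl x # w))"
    "linear_map (scl1 V) (scl W) (\<lambda>h. F (u @ Inr h # w))"
  using assms by (auto simp: conv_deg_def)

lemma conv_deg_zero: "0 \<in> conv_deg V W k"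
  using linear_null[OF V.vs0 W.vector_space_scl] linear_null[OF V.vs1 W.vector_space_scl]
  by (auto simp: conv_deg_def)

lemma conv_deg_add: "F \<in> conv_deg V W k \<Longrightarrow> G \<in> conv_deg V W k \<Longrightarrow> F + G \<in> conv_deg V W k"
  by (auto simp: conv_deg_def intro!: linear_plus)

lemma conv_deg_scale: "F \<in> conv_deg V W k \<Longrightarrow> conv_scale W c F \<in> conv_deg V W k"
  by (auto simp: conv_deg_def intro!: linear_scaled)

lemma conv_deg_sum: "(\<And>a. a \<in> A \<Longrightarrow> F a \<in> conv_deg V W k) \<Longrightarrow> sum F A \<in> conv_deg V W k"
  by (induction A rule: infinite_finite_induct) (auto intro: conv_deg_zero conv_deg_add)

lemma conv_deg_pair:
  assumes "\<And>b. \<xi> b \<noteq> 0 \<Longrightarrow> lookup \<alpha> b \<in> conv_deg V W k"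
  shows "pair \<xi> \<alpha> \<in> conv_deg V W k"
  unfolding pairing_def
proof (rule conv_deg_sum)
  fix b
  show "conv_scale W (\<xi> b) (lookup \<alpha> b) \<in> conv_deg V W k"
    by (cases "\<xi> b = 0") (auto intro: assms conv_deg_scale conv_deg_zero)
qed

text \<open>Words have degree at least 1, so a map of degree \<open>\<ge> 0\<close> cannot hit \<open>W\<^sub>0\<close>, and one of degree
  \<open>\<ge> 1\<close> vanishes. This is what leaves only functions and 1-forms in degree \<open>-1\<close>.\<close>

lemma conv_deg_fst_0:
  assumes "F \<in> conv_deg V W k" "k \<ge> 0"
  shows "fst (F w) = 0"
proof (cases "w = []")
  case False
  then have "wdeg w \<ge> 1" using wdeg_Cons_pos by (metis list.exhaust)
  then show ?thesis using conv_degD(2)[OF assms(1)] assms(2) by auto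
qed (use conv_degD(1)[OF assms(1)] in simp)

lemma conv_deg_pos:
  assumes "F \<in> conv_deg V W k" "k \<ge> 1"
  shows "F = 0"
proof
  fix w
  show "F w = 0 w"
  proof (cases "w = []")
    case False
    then have "wdeg w \<ge> 1" using wdeg_Cons_pos by (metis list.exhaust)
    then show ?thesis using conv_degD(2,3)[OF assms(1), of w] assms(2) by (auto simp: prod_eq_iff)
  qed (use conv_degD(1)[OF assms(1)] in simp)
qed

lemma pair_tensor: "pair \<xi> (tensor W F \<omega>) = conv_scale W (lin_ext (*) \<xi> \<omega>) F"
proof -
  have look: "lookup (tensor W F \<omega>) b = conv_scale W (lookup \<omega> b) F" for b
    by (simp add: tensor_def Poly_Mapping.map.rep_eq when_def)
  then have "keys (tensor W F \<omega>) \<subseteq> keys \<omega>"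
    by (auto simp: in_keys_iff)
  then have "pair \<xi> (tensor W F \<omega>) = (\<Sum>b\<in>keys \<omega>. conv_scale W (\<xi> b) (conv_scale W (lookup \<omega> b) F))"
    by (simp only: L.pairing_superset[OF Poly_Mapping.finite_keys] look)
  then show ?thesis
    by (simp add: lin_ext_def L.scale_sum_left mult.commute)
qed

lemma pair_form_ext:
  "pair \<xi> (form_ext W e k T \<alpha>) =
    pair (\<lambda>b. (- 1) powi (e * (k + int (fdeg b))) * lin_ext (*) \<xi> (T b)) \<alpha>"
  by (simp add: form_ext_def L.pairing_sum pair_tensor) (simp add: pairing_def mult.commute)

lemma pair_map: "pair \<xi> (Poly_Mapping.map (conv_scale W c) \<alpha>) = conv_scale W c (pair \<xi> \<alpha>)"
proof -
  have look: "lookup (Poly_Mapping.map (conv_scale W c) \<alpha>) b = conv_scale W c (lookup \<alpha> b)" for b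
    by (simp add: Poly_Mapping.map.rep_eq when_def)
  then have "keys (Poly_Mapping.map (conv_scale W c) \<alpha>) \<subseteq> keys \<alpha>"
    by (auto simp: in_keys_iff)
  then show ?thesis
    by (simp only: L.pairing_superset[OF Poly_Mapping.finite_keys] look)
      (simp add: pairing_def L.scale_sum_right mult.commute)
qed

lemma linear_apply_lin_ext:
  "linear_map (conv_scale W) (scl W) (\<lambda>F :: ('a, 'b, 'c, 'd) conv. lin_ext (scl W) F p)"
  unfolding lin_ext_def
  by (intro linear_summed L.vector_space_axioms W'.vector_space_axioms linear_scaled)
    (auto simp: Vector_Spaces.linear_iff L.vector_space_axioms W'.vector_space_axioms)

lemma linear_apply: "linear_map (conv_scale W) (scl W) (\<lambda>F :: ('a, 'b, 'c, 'd) conv. F w)"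
  by (auto simp: Vector_Spaces.linear_iff L.vector_space_axioms W'.vector_space_axioms)

lemma linear_pointwise:
  assumes "\<And>w. linear_map (conv_scale W) (scl W) (\<lambda>F :: ('a, 'b, 'c, 'd) conv. \<Phi> F w)"
  shows "linear_map (conv_scale W) (conv_scale W) (\<Phi> :: ('a, 'b, 'c, 'd) conv \<Rightarrow> ('a, 'b, 'c, 'd) conv)"
  using assms by (auto simp: Vector_Spaces.linear_iff L.vector_space_axioms fun_eq_iff)

lemma linear_conv_diff:
  "linear_map (conv_scale W) (conv_scale W) (conv_diff V W k :: ('a, 'b, 'c, 'd) conv \<Rightarrow> _)"
  by (rule linear_pointwise)
    (unfold conv_diff_def, intro linear_plus linear_scaled linear_apply_lin_ext linear_comp[OF linear_apply W.ops_linear_1])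

text \<open>The summand \<open>m\<^sub>2 (F \<otimes> G) \<Delta>\<close> of the binary bracket, where \<open>k\<close> is the degree of \<open>G\<close>; the sign is
  that of moving \<open>G\<close> past the first factor of the coproduct.\<close>

definition cup :: "int \<Rightarrow> ('a, 'b, 'c, 'd) conv \<Rightarrow> ('a, 'b, 'c, 'd) conv \<Rightarrow> ('a, 'b, 'c, 'd) conv" where
  "cup k F G = (\<lambda>w. lin_ext (scl W)
     (\<lambda>ws. scl W ((- 1) powi (k * wdeg (ws ! 0))) (ops W [F (ws ! 0), G (ws ! Suc 0)])) (coprod w))"

text \<open>The summand \<open>m\<^sub>3 (F \<otimes> G \<otimes> H) \<Delta>\<^sup>2\<close> of the ternary bracket for three elements of degree \<open>-1\<close>.\<close>

definition cup3 :: "('a, 'b, 'c, 'd) conv \<Rightarrow> ('a, 'b, 'c, 'd) conv \<Rightarrow> ('a, 'b, 'c, 'd) conv \<Rightarrow> ('a, 'b, 'c, 'd) conv" where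
  "cup3 F G H = (\<lambda>w. lin_ext (scl W)
     (\<lambda>ws. scl W (interchange_sign [- 1, - 1, - 1] (map wdeg ws))
       (ops W [F (ws ! 0), G (ws ! Suc 0), H (ws ! Suc (Suc 0))])) (coprod_iter (Suc (Suc 0)) w))"

lemma linear_cup:
  "linear_map (conv_scale W) (conv_scale W) (\<lambda>F. cup k F G)"
  "linear_map (conv_scale W) (conv_scale W) (\<lambda>F. cup k G F)"
  unfolding cup_def
  by (rule linear_pointwise, intro linear_lin_ext L.vector_space_axioms W'.vector_space_axioms
      linear_scaled linear_comp[OF linear_apply W.ops_linear_2(1)] linear_comp[OF linear_apply W.ops_linear_2(2)])+

lemma linear_cup3:
  "linear_map (conv_scale W) (conv_scale W) (\<lambda>F. cup3 F G H)"
  "linear_map (conv_scale W) (conv_scale W) (\<lambda>F. cup3 G F H)"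
  "linear_map (conv_scale W) (conv_scale W) (\<lambda>F. cup3 G H F)"
  unfolding cup3_def
  by (rule linear_pointwise, intro linear_lin_ext L.vector_space_axioms W'.vector_space_axioms
      linear_scaled linear_comp[OF linear_apply W.ops_linear_3(1)] linear_comp[OF linear_apply W.ops_linear_3(2)]
      linear_comp[OF linear_apply W.ops_linear_3(3)])+

lemma cup_pair:
  "cup k (pair \<xi> \<alpha>) (pair \<zeta> \<beta>) = (\<Sum>b\<in>keys \<alpha>. \<Sum>c\<in>keys \<beta>.
     conv_scale W (\<xi> b * \<zeta> c) (cup k (lookup \<alpha> b) (lookup \<beta> c)))"
proof -
  have 1: "cup k (pair \<xi> \<alpha>) Q = (\<Sum>b\<in>keys \<alpha>. conv_scale W (\<xi> b) (cup k (lookup \<alpha> b) Q))" for Q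
    by (rule linear_pairing[OF linear_cup(1)])
  have 2: "cup k P (pair \<zeta> \<beta>) = (\<Sum>c\<in>keys \<beta>. conv_scale W (\<zeta> c) (cup k P (lookup \<beta> c)))" for P
    by (rule linear_pairing[OF linear_cup(2)])
  show ?thesis unfolding 1 unfolding 2 by (simp add: L.scale_sum_right)
qed

lemma cup3_pair:
  "cup3 (pair \<xi> \<alpha>) (pair \<zeta> \<beta>) (pair \<eta> \<gamma>) = (\<Sum>b\<in>keys \<alpha>. \<Sum>c\<in>keys \<beta>. \<Sum>e\<in>keys \<gamma>.
     conv_scale W (\<xi> b * \<zeta> c * \<eta> e) (cup3 (lookup \<alpha> b) (lookup \<beta> c) (lookup \<gamma> e)))"
proof -
  have 1: "cup3 (pair \<xi> \<alpha>) Q R = (\<Sum>b\<in>keys \<alpha>. conv_scale W (\<xi> b) (cup3 (lookup \<alpha> b) Q R))" for Q R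
    by (rule linear_pairing[OF linear_cup3(1)])
  have 2: "cup3 P (pair \<zeta> \<beta>) R = (\<Sum>c\<in>keys \<beta>. conv_scale W (\<zeta> c) (cup3 P (lookup \<beta> c) R))" for P R
    by (rule linear_pairing[OF linear_cup3(2)])
  have 3: "cup3 P Q (pair \<eta> \<gamma>) = (\<Sum>e\<in>keys \<gamma>. conv_scale W (\<eta> e) (cup3 P Q (lookup \<gamma> e)))" for P Q
    by (rule linear_pairing[OF linear_cup3(3)])
  show ?thesis unfolding 1 unfolding 2 unfolding 3 by (simp add: L.scale_sum_right mult.assoc)
qed

lemma conv_bracket_2:
  fixes F G :: "('a, 'b, 'c, 'd) conv"
  shows "conv_bracket W [(d, F), (e, G)] = cup e F G - conv_scale W ((- 1) powi (d * e)) (cup d G F)"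
proof
  fix w
  have ops: "lin_ext (scl W) (\<lambda>ws. scl W (interchange_sign [k, l] (map wdeg ws)) (ops W (map2 (\<lambda>G a. snd G a) [(k, P), (l, Q)] ws)))
      (coprod w) = cup l P Q w" for k l and P Q :: "('a, 'b, 'c, 'd) conv"
    unfolding cup_def
  proof (rule lin_ext_cong)
    fix ws assume "ws \<in> keys (coprod w :: _ \<Rightarrow>\<^sub>0 'k)"
    then obtain u v where "ws = [u, v]" using coprod_keys by blast
    then show "scl W (interchange_sign [k, l] (map wdeg ws)) (ops W (map2 (\<lambda>G a. snd G a) [(k, P), (l, Q)] ws)) =
      scl W ((- 1) powi (l * wdeg (ws ! 0))) (ops W [P (ws ! 0), Q (ws ! Suc 0)])"
      by (simp add: interchange_sign_def lessThan_Suc)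
  qed
  show "conv_bracket W [(d, F), (e, G)] w = (cup e F G - conv_scale W ((- 1) powi (d * e)) (cup d G F)) w"
    by (simp add: conv_bracket_def permutes_lessThan_2 id_noteq_transpose koszul_id koszul_swap sign_swap_id
        permute_list_def coprod_iter_1 ops del: coprod_iter.simps)
qed

end

section \<open>The curvature by form degree\<close>

lemma sum_permutations_3:
  "(\<Sum>\<sigma> | \<sigma> permutes {..<Suc (Suc (Suc 0))}. f \<sigma>) =
    f id + f (transpose 0 1) + f (transpose 1 2) + f (transpose 1 2 \<circ> transpose 0 1)
    + f (transpose 0 2) + f (transpose 0 2 \<circ> transpose 0 1)"
proof -
  let ?S = "{..<Suc (Suc 0)}"
  have "(\<Sum>\<sigma> | \<sigma> permutes {..<Suc (Suc (Suc 0))}. f \<sigma>) =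
    (\<Sum>b\<in>insert (Suc (Suc 0)) ?S. \<Sum>q | q permutes ?S. f (transpose (Suc (Suc 0)) b \<circ> q))"
    unfolding lessThan_Suc[of "Suc (Suc 0)"] by (rule sum_over_permutations_insert) auto
  also have "\<dots> = (\<Sum>b\<in>{Suc (Suc 0), Suc 0, 0}. f (transpose (Suc (Suc 0)) b) + f (transpose (Suc (Suc 0)) b \<circ> transpose 0 1))"
    unfolding permutes_lessThan_2 by (rule sum.cong) (auto simp: id_noteq_transpose)
  finally show ?thesis
    by (simp add: numeral_2_eq_2 transpose_commute[of _ "Suc (Suc 0)"] add_ac)
qed

text \<open>For symbols of degree \<open>-1\<close> the Koszul sign is the signature, so the two signs in the ternary
  bracket cancel.\<close>

lemma koszul_sign_3:
  assumes "\<sigma> \<in> {id, transpose 0 1, transpose 1 2, transpose 1 2 \<circ> transpose 0 1, transpose 0 2, transpose 0 2 \<circ> transpose 0 1}"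
  shows "koszul [- 1, - 1, - 1] \<sigma> * of_int (sign \<sigma>) = (1 :: 'k::field)"
proof -
  have k: "koszul [- 1, - 1, - 1] \<sigma> = (if \<sigma> 1 < \<sigma> 0 then - 1 else 1) *
     (if \<sigma> 2 < \<sigma> 0 then - 1 else 1) * (if \<sigma> 2 < \<sigma> 1 then - 1 else (1 :: 'k))"
    if "\<sigma> 0 < 3" "\<sigma> 1 < 3" "\<sigma> 2 < 3"
  proof -
    define ds :: "int list" where "ds = [- 1, - 1, - 1]"
    have "ds ! i = - 1" if "i < 3" for i
      using that by (auto simp: ds_def less_Suc_eq numeral_3_eq_3)
    then have "ds ! \<sigma> 0 = - 1" "ds ! \<sigma> (Suc 0) = - 1" "ds ! \<sigma> (Suc (Suc 0)) = - 1"
      using that by (simp_all add: numeral_2_eq_2)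
    moreover have "length ds = Suc (Suc (Suc 0))" by (simp add: ds_def)
    ultimately show ?thesis unfolding ds_def[symmetric]
      by (simp add: koszul_def lessThan_Suc numeral_2_eq_2)
  qed
  have s: "sign (transpose a b \<circ> transpose c d) = (1 :: int)" if "a \<noteq> b" "c \<noteq> d" for a b c d :: nat
    using that by (simp add: sign_compose permutation_swap_id sign_swap_id)
  have b: "\<sigma> 0 < 3" "\<sigma> 1 < 3" "\<sigma> 2 < 3"
    using assms by (auto simp: transpose_def)
  show ?thesis
    unfolding k[OF b] using assms by (auto simp: s[simplified] sign_swap_id transpose_def)
qed

lemma sum_listset_2: "(\<Sum>bs\<in>listset [A, B]. f bs) = (\<Sum>b\<in>A. \<Sum>c\<in>B. f [b, c])"
proof -
  have "listset [A, B] = (\<lambda>(b, c). [b, c]) ` (A \<times> B)" by (auto simp: set_Cons_def)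
  moreover have "inj_on (\<lambda>(b, c). [b, c]) (A \<times> B)" by (auto simp: inj_on_def)
  ultimately show ?thesis by (simp add: sum.reindex sum.cartesian_product case_prod_unfold)
qed

lemma sum_listset_3: "(\<Sum>bs\<in>listset [A, B, C]. f bs) = (\<Sum>b\<in>A. \<Sum>c\<in>B. \<Sum>e\<in>C. f [b, c, e])"
proof -
  have "listset [A, B, C] = (\<lambda>(b, c, e). [b, c, e]) ` (A \<times> B \<times> C)" by (force simp: set_Cons_def)
  moreover have "inj_on (\<lambda>(b, c, e). [b, c, e]) (A \<times> B \<times> C)" by (auto simp: inj_on_def)
  ultimately show ?thesis by (simp add: sum.reindex sum.cartesian_product case_prod_unfold)
qed

lemma length_3_cases: "length xs = 3 \<Longrightarrow> \<exists>a b c. xs = [a, b, c]"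
  by (auto simp: numeral_3_eq_3 length_Suc_conv)

lemma forms_on_single: "finite (snd b) \<Longrightarrow> single b c \<in> forms_on UNIV (card (snd b))"
  by (auto simp: forms_on_def)

lemma ev_single: "ev T I (single b 1) = coeff_at T I b"
  by (simp add: ev_def ev_simps)

lemma lin_ext_eq_0:
  assumes "\<And>b. b \<in> keys p \<Longrightarrow> \<xi> b = 0"
  shows "lin_ext (*) \<xi> p = (0 :: 'k::field)"
  using assms by (simp add: lin_ext_def)

text \<open>For the monomials that occur this means form degree at least 2 (\<open>high_iff\<close>). It is stated as the
  complement of the two shapes \<open>{}\<close> and \<open>{k}\<close> of index sets to which \<open>separation\<close> is applied.\<close>

definition high :: "mono_form \<Rightarrow> bool" where
  "high b \<longleftrightarrow> snd b \<noteq> {} \<and> (\<forall>k. snd b \<noteq> {k})"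

lemma high_iff: "finite (snd b) \<Longrightarrow> high b \<longleftrightarrow> fdeg b \<ge> 2"
proof -
  assume fin: "finite (snd b)"
  have "fdeg b = 0 \<longleftrightarrow> snd b = {}" using fin by (simp add: fdeg_def)
  moreover have "fdeg b = 1 \<longleftrightarrow> (\<exists>k. snd b = {k})" by (simp add: fdeg_def card_1_singleton_iff)
  ultimately show ?thesis unfolding high_def
    by (metis One_nat_def Suc_1 less_2_cases_iff not_less)
qed

context convolution
begin

lemma conv_bracket_3:
  fixes F G H :: "('a, 'b, 'c, 'd) conv"
  shows "conv_bracket W [(- 1, F), (- 1, G), (- 1, H)] =
    cup3 F G H + cup3 G F H + cup3 F H G + cup3 H F G + cup3 H G F + cup3 G H F"
proof
  fix w
  let ?Fs = "[(- 1 :: int, F), (- 1, G), (- 1, H)]"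
  define \<Phi> where "\<Phi> = (\<lambda>\<sigma>. lin_ext (scl W) (\<lambda>ws. let Gs = permute_list \<sigma> ?Fs in
    scl W (interchange_sign (map fst Gs) (map wdeg ws)) (ops W (map2 (\<lambda>G a. snd G a) Gs ws)))
    (coprod_iter (length ?Fs - 1) w))"
  have \<Phi>: "\<Phi> \<sigma> = cup3 P Q R w" if "permute_list \<sigma> ?Fs = [(- 1, P), (- 1, Q), (- 1, R)]" for \<sigma> P Q R
  proof -
    have 2: "length ?Fs - 1 = Suc (Suc 0)" by simp
    show ?thesis unfolding \<Phi>_def cup3_def 2 that Let_def
    proof (rule lin_ext_cong)
      fix ws assume "ws \<in> keys (coprod_iter (Suc (Suc 0)) w :: _ \<Rightarrow>\<^sub>0 'k)"
      then obtain u v t where "ws = [u, v, t]" using coprod_iter_2_keys by blast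
      then show "scl W (interchange_sign (map fst [(- 1, P), (- 1, Q), (- 1, R)]) (map wdeg ws))
          (ops W (map2 (\<lambda>G a. snd G a) [(- 1 :: int, P), (- 1, Q), (- 1, R)] ws)) =
        scl W (interchange_sign [- 1, - 1, - 1] (map wdeg ws)) (ops W [P (ws ! 0), Q (ws ! Suc 0), R (ws ! Suc (Suc 0))])"
        by simp
    qed
  qed
  have "conv_bracket W ?Fs w = (\<Sum>\<sigma> | \<sigma> permutes {..<Suc (Suc (Suc 0))}.
      scl W (koszul [- 1, - 1, - 1] \<sigma> * of_int (sign \<sigma>)) (\<Phi> \<sigma>))"
    unfolding conv_bracket_def \<Phi>_def by (rule sum.cong) simp_all
  also have "\<dots> = \<Phi> id + \<Phi> (transpose 0 1) + \<Phi> (transpose 1 2) + \<Phi> (transpose 1 2 \<circ> transpose 0 1)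
    + \<Phi> (transpose 0 2) + \<Phi> (transpose 0 2 \<circ> transpose 0 1)"
    unfolding sum_permutations_3 by (subst (1 2 3 4 5 6) koszul_sign_3) simp_all
  also have "\<Phi> id = cup3 F G H w" by (rule \<Phi>) simp
  also have "\<Phi> (transpose 0 1) = cup3 G F H w" by (rule \<Phi>) (simp add: permute_list_def transpose_def)
  also have "\<Phi> (transpose 1 2) = cup3 F H G w" by (rule \<Phi>) (simp add: permute_list_def transpose_def numeral_2_eq_2)
  also have "\<Phi> (transpose 1 2 \<circ> transpose 0 1) = cup3 H F G w" by (rule \<Phi>) (simp add: permute_list_def transpose_def numeral_2_eq_2)
  also have "\<Phi> (transpose 0 2) = cup3 H G F w" by (rule \<Phi>) (simp add: permute_list_def transpose_def numeral_2_eq_2)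
  also have "\<Phi> (transpose 0 2 \<circ> transpose 0 1) = cup3 G H F w" by (rule \<Phi>) (simp add: permute_list_def transpose_def numeral_2_eq_2)
  finally show "conv_bracket W ?Fs w = (cup3 F G H + cup3 G F H + cup3 F H G + cup3 H F G + cup3 H G F + cup3 G H F) w"
    by simp
qed

text \<open>\<open>m\<^sub>3\<close> is zero unless all its arguments are in \<open>W\<^sub>0\<close>.\<close>

lemma conv_bracket_3_vanish:
  fixes Fs :: "(int \<times> ('a, 'b, 'c, 'd) conv) list"
  assumes "length Fs = 3" and P: "P \<in> set Fs" "\<And>w. fst (snd P w) = 0"
  shows "conv_bracket W Fs = 0"
proof
  fix w
  have 2: "length Fs - 1 = Suc (Suc 0)" using assms by simp
  have "lin_ext (scl W) (\<lambda>ws. let Gs = permute_list \<sigma> Fs in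
      scl W (interchange_sign (map fst Gs) (map wdeg ws)) (ops W (map2 (\<lambda>G a. snd G a) Gs ws)))
    (coprod_iter (length Fs - 1) w) = 0" if "\<sigma> permutes {..<length Fs}" for \<sigma>
    unfolding lin_ext_def
  proof (intro sum.neutral ballI)
    fix ws assume "ws \<in> keys (coprod_iter (length Fs - 1) w :: _ \<Rightarrow>\<^sub>0 'k)"
    then obtain u v t where ws: "ws = [u, v, t]" using coprod_iter_2_keys unfolding 2 by blast
    have "length (permute_list \<sigma> Fs) = 3" using assms by simp
    then obtain A B C where Gs: "permute_list \<sigma> Fs = [A, B, C]"
      using length_3_cases by blast
    have "P \<in> {A, B, C}" using P that set_permute_list[OF that] Gs by auto
    then have "ops W (map2 (\<lambda>G a. snd G a) (permute_list \<sigma> Fs) ws) = 0"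
      using P(2) by (auto simp: Gs ws prod_eq_iff)
    then show "scl W (lookup (coprod_iter (length Fs - 1) w) ws) (let Gs = permute_list \<sigma> Fs in
      scl W (interchange_sign (map fst Gs) (map wdeg ws)) (ops W (map2 (\<lambda>G a. snd G a) Gs ws))) = 0"
      by (simp add: Let_def)
  qed
  then show "conv_bracket W Fs w = 0 w"
    by (auto simp: conv_bracket_def intro!: sum.neutral)
qed

lemma cup_vanish:
  fixes F G :: "('a, 'b, 'c, 'd) conv"
  assumes "\<And>w. fst (F w) = 0" "\<And>w. fst (G w) = 0"
  shows "cup k F G = 0"
  by (auto simp: cup_def lin_ext_def fun_eq_iff assms prod_eq_iff fst_sum snd_sum intro!: sum.neutral)

lemma cup_zero [simp]: "cup k 0 G = 0" "cup k G 0 = 0"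
  using linear_simps(3)[OF linear_cup(1)] linear_simps(3)[OF linear_cup(2)] by auto

lemma convf_degD:
  assumes "\<alpha> \<in> convf_deg V W n k"
  shows "lookup \<alpha> b \<in> conv_deg V W (k + int (fdeg b))"
    "b \<in> keys \<alpha> \<Longrightarrow> b \<in> simplex_basis n"
    "b \<in> keys \<alpha> \<Longrightarrow> finite (snd b)"
proof -
  show "lookup \<alpha> b \<in> conv_deg V W (k + int (fdeg b))"
    using assms unfolding convf_deg_def by blast
  have *: "b \<in> simplex_basis n" if "b \<in> keys \<alpha>"
    using assms that unfolding convf_deg_def by blast
  then show "b \<in> keys \<alpha> \<Longrightarrow> b \<in> simplex_basis n" .
  show "finite (snd b)" if "b \<in> keys \<alpha>"
    using *[OF that] finite_subset[OF _ finite_atLeastAtMost[of 1 n]] by (auto simp: simplex_basis_def)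
qed

lemma half_double: "conv_scale W (1 / 2) (X + X) = (X :: ('a, 'b, 'c, 'd) conv)"
proof -
  have "conv_scale W (1 / 2) (X + X) = conv_scale W (1 / 2 + 1 / 2) X"
    by (simp only: L.scale_right_distrib L.scale_left_distrib)
  also have "1 / 2 + 1 / 2 = (1 :: 'k)" by simp
  finally show ?thesis by (simp only: L.scale_one)
qed

lemma sixth_sextuple: "conv_scale W (1 / 6) (X + X + X + X + X + X) = (X :: ('a, 'b, 'c, 'd) conv)"
proof -
  have "conv_scale W (1 / 6) (X + X + X + X + X + X) = conv_scale W (1 / 6 + 1 / 6 + 1 / 6 + 1 / 6 + 1 / 6 + 1 / 6) X"
    by (simp only: L.scale_right_distrib L.scale_left_distrib)
  also have "1 / 6 + 1 / 6 + 1 / 6 + 1 / 6 + 1 / 6 + 1 / 6 = (1 :: 'k)" by simp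
  finally show ?thesis by (simp only: L.scale_one)
qed

text \<open>The degree of the coefficient of \<open>b\<close> in an element of degree \<open>-1\<close>.\<close>

abbreviation coeff_deg :: "mono_form \<Rightarrow> int" where
  "coeff_deg b \<equiv> - 1 + int (fdeg b)"

text \<open>The contributions of fixed monomials to the brackets of \<open>\<alpha>\<close> with itself; the signs are those of moving
  each coefficient past the monomials before it.\<close>

definition bracket_2_term :: "(mono_form \<Rightarrow> 'k) \<Rightarrow> ('a, 'b, 'c, 'd) convf \<Rightarrow> mono_form \<Rightarrow> mono_form \<Rightarrow> ('a, 'b, 'c, 'd) conv" where
  "bracket_2_term \<xi> \<alpha> b c =
    conv_scale W (lin_ext (*) \<xi> (wedge (single b 1) (wedge (single c 1) form_one))
      * (- 1) powi (coeff_deg c * - int (fdeg b)))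
     (conv_bracket W [(coeff_deg b, lookup \<alpha> b), (coeff_deg c, lookup \<alpha> c)])"

definition bracket_3_term :: "(mono_form \<Rightarrow> 'k) \<Rightarrow> ('a, 'b, 'c, 'd) convf \<Rightarrow> mono_form \<Rightarrow> mono_form \<Rightarrow> mono_form \<Rightarrow> ('a, 'b, 'c, 'd) conv" where
  "bracket_3_term \<xi> \<alpha> b c e =
    conv_scale W (lin_ext (*) \<xi> (wedge (single b 1) (wedge (single c 1) (wedge (single e 1) form_one)))
      * (- 1) powi (coeff_deg c * - int (fdeg b) + (coeff_deg e * - int (fdeg b) + coeff_deg e * - int (fdeg c))))
     (conv_bracket W [(coeff_deg b, lookup \<alpha> b), (coeff_deg c, lookup \<alpha> c), (coeff_deg e, lookup \<alpha> e)])"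

abbreviation "bracket_2 \<alpha> \<equiv> convf_bracket W [(- 1, \<alpha>), (- 1, \<alpha>)]"
abbreviation "bracket_3 \<alpha> \<equiv> convf_bracket W [(- 1, \<alpha>), (- 1, \<alpha>), (- 1, \<alpha>)]"

lemma pair_convf_bracket_2:
  "pair \<xi> (bracket_2 \<alpha>) = (\<Sum>b\<in>keys \<alpha>. \<Sum>c\<in>keys \<alpha>. bracket_2_term \<xi> \<alpha> b c)"
  unfolding convf_bracket_def list.map sum_listset_2
  by (simp add: bracket_2_term_def L.pairing_sum pair_tensor Let_def interchange_sign_def lessThan_Suc wedge_list_def)

lemma pair_convf_bracket_3:
  "pair \<xi> (bracket_3 \<alpha>) = (\<Sum>b\<in>keys \<alpha>. \<Sum>c\<in>keys \<alpha>. \<Sum>e\<in>keys \<alpha>. bracket_3_term \<xi> \<alpha> b c e)"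
  unfolding convf_bracket_def list.map sum_listset_3
  by (simp add: bracket_3_term_def L.pairing_sum pair_tensor Let_def interchange_sign_def lessThan_Suc wedge_list_def
    algebra_simps)

lemma pair_total_diff:
  fixes \<alpha> :: "('a, 'b, 'c, 'd) convf"
  assumes "\<And>b. \<xi> b \<noteq> 0 \<Longrightarrow> fdeg b = m"
  shows "pair \<xi> (total_diff V W k \<alpha>) = conv_diff V W (k + int m) (pair \<xi> \<alpha>) +
    pair (\<lambda>b. (- 1) powi (- 1 * (k + int (fdeg b))) * lin_ext (*) \<xi> (d_mono b)) \<alpha>"
proof -
  have "pair \<xi> (\<Sum>b\<in>keys \<alpha>.
      tensor W (conv_diff V W (k + int (fdeg b)) (lookup \<alpha> b)) (single b 1)) =
    (\<Sum>b\<in>keys \<alpha>. conv_scale W (\<xi> b) (conv_diff V W (k + int (fdeg b)) (lookup \<alpha> b)))"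
    by (simp add: L.pairing_sum pair_tensor ev_simps)
  also have "\<dots> = (\<Sum>b\<in>keys \<alpha>. conv_scale W (\<xi> b) (conv_diff V W (k + int m) (lookup \<alpha> b)))"
  proof (rule sum.cong[OF refl])
    fix b
    show "conv_scale W (\<xi> b) (conv_diff V W (k + int (fdeg b)) (lookup \<alpha> b)) =
      conv_scale W (\<xi> b) (conv_diff V W (k + int m) (lookup \<alpha> b))"
      by (cases "\<xi> b = 0") (use assms in auto)
  qed
  also have "\<dots> = conv_diff V W (k + int m) (pair \<xi> \<alpha>)"
    by (rule linear_pairing[OF linear_conv_diff, symmetric])
  finally show ?thesis
    by (simp add: total_diff_def L.pairing_add pair_form_ext)
qed

lemma pair_mc_curvature:
  fixes \<alpha> :: "('a, 'b, 'c, 'd) convf"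
  shows "pair \<xi> (mc_curvature V W \<alpha>) = pair \<xi> (total_diff V W (- 1) \<alpha>)
    - conv_scale W (1 / 2) (pair \<xi> (bracket_2 \<alpha>))
    - conv_scale W (1 / 6) (pair \<xi> (bracket_3 \<alpha>))"
proof -
  have set: "{1..3::nat} = {1, 2, 3}" by auto
  have rep: "replicate 2 x = [x, x]" "replicate 3 x = [x, x, x]" for x :: "int \<times> ('a, 'b, 'c, 'd) convf"
    by (simp_all add: numeral_2_eq_2 numeral_3_eq_3)
  show ?thesis
    unfolding mc_curvature_def set
    by (simp add: L.pairing_add pair_map fact_numeral rep)
qed

text \<open>Exchanging the two equal arguments exchanges the two halves of the bracket, which cancels the
  factor \<open>1/2\<close>.\<close>

lemma pair_bracket_2_at_0:
  assumes \<alpha>: "\<alpha> \<in> convf_deg V W n (- 1)"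
  shows "conv_scale W (1 / 2) (pair (coeff_at T {}) (bracket_2 \<alpha>)) =
    cup (- 1) (pair (coeff_at T {}) \<alpha>) (pair (coeff_at T {}) \<alpha>)"
proof -
  let ?\<xi> = "coeff_at T {}" and ?f = "lookup \<alpha>" and ?K = "keys \<alpha>"
  have "pair ?\<xi> (bracket_2 \<alpha>) = (\<Sum>b\<in>?K. \<Sum>c\<in>?K. conv_scale W (?\<xi> b * ?\<xi> c) (cup (- 1) (?f b) (?f c)))
     + (\<Sum>b\<in>?K. \<Sum>c\<in>?K. conv_scale W (?\<xi> b * ?\<xi> c) (cup (- 1) (?f c) (?f b)))"
    unfolding pair_convf_bracket_2 sum.distrib[symmetric]
  proof (intro sum.cong refl)
    fix b c
    show "bracket_2_term ?\<xi> \<alpha> b c =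
      conv_scale W (?\<xi> b * ?\<xi> c) (cup (- 1) (?f b) (?f c)) + conv_scale W (?\<xi> b * ?\<xi> c) (cup (- 1) (?f c) (?f b))"
      unfolding bracket_2_term_def ev_def[symmetric] ev_wedge_0 ev_single
      by (cases "snd b = {}"; cases "snd c = {}")
        (simp_all add: coeff_at_def fdeg_def conv_bracket_2 L.scale_right_distrib)
  qed
  also have "(\<Sum>b\<in>?K. \<Sum>c\<in>?K. conv_scale W (?\<xi> b * ?\<xi> c) (cup (- 1) (?f c) (?f b))) =
    (\<Sum>b\<in>?K. \<Sum>c\<in>?K. conv_scale W (?\<xi> b * ?\<xi> c) (cup (- 1) (?f b) (?f c)))"
    by (subst sum.swap) (simp add: mult.commute)
  finally show ?thesis
    by (simp only: cup_pair half_double)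
qed

text \<open>One of the two arguments supplies its function part and the other its 1-form part. The
  functions \<open>cup 0 a b\<close> and \<open>- cup (-1) b a\<close> are \<open>m\<^sub>2(a, b)\<close> and \<open>m\<^sub>2(b, a)\<close> on pairs of elements of
  \<open>V\<^sub>0\<close>.\<close>

lemma pair_bracket_2_at_1:
  assumes \<alpha>: "\<alpha> \<in> convf_deg V W n (- 1)"
  shows "conv_scale W (1 / 2) (pair (coeff_at T {k}) (bracket_2 \<alpha>)) =
    cup 0 (pair (coeff_at T {}) \<alpha>) (pair (coeff_at T {k}) \<alpha>)
    - cup (- 1) (pair (coeff_at T {k}) \<alpha>) (pair (coeff_at T {}) \<alpha>)"
proof -
  let ?\<xi> = "coeff_at T {}" and ?\<zeta> = "coeff_at T {k}" and ?f = "lookup \<alpha>" and ?K = "keys \<alpha>"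
  have "pair ?\<zeta> (bracket_2 \<alpha>) =
     (\<Sum>b\<in>?K. \<Sum>c\<in>?K. conv_scale W (?\<xi> b * ?\<zeta> c) (cup 0 (?f b) (?f c) - cup (- 1) (?f c) (?f b)))
     + (\<Sum>b\<in>?K. \<Sum>c\<in>?K. conv_scale W (?\<zeta> b * ?\<xi> c) (cup 0 (?f c) (?f b) - cup (- 1) (?f b) (?f c)))"
    unfolding pair_convf_bracket_2 sum.distrib[symmetric]
  proof (intro sum.cong refl)
    fix b c
    show "bracket_2_term ?\<zeta> \<alpha> b c =
      conv_scale W (?\<xi> b * ?\<zeta> c) (cup 0 (?f b) (?f c) - cup (- 1) (?f c) (?f b))
      + conv_scale W (?\<zeta> b * ?\<xi> c) (cup 0 (?f c) (?f b) - cup (- 1) (?f b) (?f c))"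
      unfolding bracket_2_term_def ev_def[symmetric] ev_wedge_1 ev_wedge_0 ev_single
      by (cases "snd b = {}"; cases "snd c = {}"; cases "snd b = {k}"; cases "snd c = {k}")
        (simp_all add: coeff_at_def fdeg_def conv_bracket_2 L.scale_right_diff_distrib)
  qed
  also have "(\<Sum>b\<in>?K. \<Sum>c\<in>?K. conv_scale W (?\<zeta> b * ?\<xi> c) (cup 0 (?f c) (?f b) - cup (- 1) (?f b) (?f c))) =
    (\<Sum>b\<in>?K. \<Sum>c\<in>?K. conv_scale W (?\<xi> b * ?\<zeta> c) (cup 0 (?f b) (?f c) - cup (- 1) (?f c) (?f b)))"
    by (subst sum.swap) (simp add: mult.commute)
  also have "(\<Sum>b\<in>?K. \<Sum>c\<in>?K. conv_scale W (?\<xi> b * ?\<zeta> c) (cup 0 (?f b) (?f c) - cup (- 1) (?f c) (?f b))) =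
    cup 0 (pair ?\<xi> \<alpha>) (pair ?\<zeta> \<alpha>) - cup (- 1) (pair ?\<zeta> \<alpha>) (pair ?\<xi> \<alpha>)"
    unfolding cup_pair
    by (subst (3) sum.swap) (simp add: L.scale_right_diff_distrib sum_subtractf mult.commute)
  finally show ?thesis
    by (simp only: half_double)
qed

text \<open>A product of form degree 2 has two factors in \<open>L\<^sub>0\<close>, which take values in \<open>W\<^sub>1\<close>, where \<open>m\<^sub>2\<close>
  vanishes.\<close>

lemma pair_bracket_2_high:
  assumes \<alpha>: "\<alpha> \<in> convf_deg V W n (- 1)" and \<xi>: "\<And>b. \<xi> b \<noteq> 0 \<Longrightarrow> high b"
  shows "pair \<xi> (bracket_2 \<alpha>) = 0"
  unfolding pair_convf_bracket_2
proof (intro sum.neutral ballI)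
  fix b c assume b: "b \<in> keys \<alpha>" and c: "c \<in> keys \<alpha>"
  let ?f = "lookup \<alpha>"
  have fin: "finite (snd b)" "finite (snd c)" using b c convf_degD[OF \<alpha>] by auto
  have deg: "?f b \<in> conv_deg V W (coeff_deg b)" "?f c \<in> conv_deg V W (coeff_deg c)"
    using convf_degD[OF \<alpha>] by auto
  consider "fdeg b + fdeg c \<le> 1" | "fdeg b \<ge> 2" | "fdeg c \<ge> 2" | "fdeg b \<ge> 1" "fdeg c \<ge> 1" by linarith
  then show "bracket_2_term \<xi> \<alpha> b c = 0"
  proof cases
    case 1
    let ?p = "wedge (single b 1) (wedge (single c 1) form_one) :: 'k form"
    have p: "?p \<in> forms_on UNIV (fdeg b + (fdeg c + 0))"
      unfolding fdeg_def by (intro forms_on_wedge forms_on_single forms_on_form_one fin)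
    have "\<xi> b' = 0" if "b' \<in> keys ?p" for b'
    proof -
      have "finite (snd b')" "fdeg b' = fdeg b + (fdeg c + 0)"
        using p that by (auto simp: forms_on_def fdeg_def)
      then have "\<not> high b'" using 1 by (simp add: high_iff)
      then show ?thesis using \<xi> by blast
    qed
    then have "lin_ext (*) \<xi> ?p = 0" by (rule lin_ext_eq_0)
    then show ?thesis by (simp add: bracket_2_term_def)
  next
    case 2
    then have "?f b = 0" by (intro conv_deg_pos[OF deg(1)]) simp
    then show ?thesis by (simp add: bracket_2_term_def conv_bracket_2)
  next
    case 3
    then have "?f c = 0" by (intro conv_deg_pos[OF deg(2)]) simp
    then show ?thesis by (simp add: bracket_2_term_def conv_bracket_2)
  next
    case 4
    have "fst (?f b w) = 0" "fst (?f c w) = 0" for w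
      using 4 conv_deg_fst_0[OF deg(1)] conv_deg_fst_0[OF deg(2)] by auto
    then show ?thesis by (simp add: bracket_2_term_def conv_bracket_2 cup_vanish)
  qed
qed

lemma bracket_3_term_vanish:
  assumes \<alpha>: "\<alpha> \<in> convf_deg V W n (- 1)" and "fdeg b \<ge> 1 \<or> fdeg c \<ge> 1 \<or> fdeg e \<ge> 1"
  shows "bracket_3_term \<xi> \<alpha> b c e = 0"
proof -
  have *: "fst (lookup \<alpha> b w) = 0" if "fdeg b \<ge> 1" for b w
    using conv_deg_fst_0[OF convf_degD(1)[OF \<alpha>]] that by simp
  then obtain b' where "b' \<in> {b, c, e}" "fdeg b' \<ge> 1" using assms(2) by blast
  then have "conv_bracket W [(coeff_deg b, lookup \<alpha> b), (coeff_deg c, lookup \<alpha> c), (coeff_deg e, lookup \<alpha> e)] = 0"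
    by (intro conv_bracket_3_vanish[where P = "(coeff_deg b', lookup \<alpha> b')"]) (use * in auto)
  then show ?thesis by (simp only: bracket_3_term_def L.scale_zero_right)
qed

lemma pair_bracket_3_pos:
  assumes \<alpha>: "\<alpha> \<in> convf_deg V W n (- 1)" and \<xi>: "\<And>b. \<xi> b \<noteq> 0 \<Longrightarrow> snd b \<noteq> {}"
  shows "pair \<xi> (bracket_3 \<alpha>) = 0"
  unfolding pair_convf_bracket_3
proof (intro sum.neutral ballI)
  fix b c e assume b: "b \<in> keys \<alpha>" and c: "c \<in> keys \<alpha>" and e: "e \<in> keys \<alpha>"
  have fin: "finite (snd b)" "finite (snd c)" "finite (snd e)" using b c e convf_degD[OF \<alpha>] by auto
  let ?p = "wedge (single b 1) (wedge (single c 1) (wedge (single e 1) form_one)) :: 'k form"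
  show "bracket_3_term \<xi> \<alpha> b c e = 0"
  proof (cases "fdeg b \<ge> 1 \<or> fdeg c \<ge> 1 \<or> fdeg e \<ge> 1")
    case True
    then show ?thesis by (rule bracket_3_term_vanish[OF \<alpha>])
  next
    case False
    have "?p \<in> forms_on UNIV (fdeg b + (fdeg c + (fdeg e + 0)))"
      unfolding fdeg_def by (intro forms_on_wedge forms_on_single forms_on_form_one fin)
    then have "?p \<in> forms_on UNIV 0" using False by (simp add: not_le)
    then have "snd b' = {}" if "b' \<in> keys ?p" for b'
      using that by (auto simp: forms_on_def)
    then have "lin_ext (*) \<xi> ?p = 0" using \<xi> by (intro lin_ext_eq_0) blast
    then show ?thesis by (simp add: bracket_3_term_def)
  qed
qed

text \<open>The six orders of three equal arguments contribute equally, which cancels the factor \<open>1/6\<close>.\<close>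

lemma pair_bracket_3_at_0:
  fixes T :: "nat \<Rightarrow> 'k"
  assumes \<alpha>: "\<alpha> \<in> convf_deg V W n (- 1)"
  defines "a \<equiv> pair (coeff_at T {}) \<alpha>"
  shows "conv_scale W (1 / 6) (pair (coeff_at T {}) (bracket_3 \<alpha>)) = cup3 a a a"
proof -
  let ?\<xi> = "coeff_at T {}" and ?f = "lookup \<alpha>" and ?K = "keys \<alpha>"
  define S :: "(('a, 'b, 'c, 'd) conv \<Rightarrow> ('a, 'b, 'c, 'd) conv \<Rightarrow> ('a, 'b, 'c, 'd) conv \<Rightarrow> ('a, 'b, 'c, 'd) conv) \<Rightarrow> ('a, 'b, 'c, 'd) conv"
    where "S = (\<lambda>\<Phi>. \<Sum>b\<in>?K. \<Sum>c\<in>?K. \<Sum>e\<in>?K. conv_scale W (?\<xi> b * ?\<xi> c * ?\<xi> e) (\<Phi> (?f b) (?f c) (?f e)))"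
  have "pair ?\<xi> (bracket_3 \<alpha>) =
    S (\<lambda>F G H. cup3 F G H + cup3 G F H + cup3 F H G + cup3 H F G + cup3 H G F + cup3 G H F)"
    unfolding pair_convf_bracket_3 S_def
  proof (intro sum.cong refl)
    fix b c e
    show "bracket_3_term ?\<xi> \<alpha> b c e =
      conv_scale W (?\<xi> b * ?\<xi> c * ?\<xi> e) (cup3 (?f b) (?f c) (?f e) + cup3 (?f c) (?f b) (?f e) + cup3 (?f b) (?f e) (?f c)
        + cup3 (?f e) (?f b) (?f c) + cup3 (?f e) (?f c) (?f b) + cup3 (?f c) (?f e) (?f b))"
      unfolding bracket_3_term_def ev_def[symmetric] ev_wedge_0 ev_single
      by (cases "snd b = {}"; cases "snd c = {}"; cases "snd e = {}")
        (simp_all add: coeff_at_def fdeg_def conv_bracket_3)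
  qed
  also have "\<dots> = S (\<lambda>F G H. cup3 F G H) + S (\<lambda>F G H. cup3 G F H) + S (\<lambda>F G H. cup3 F H G) + S (\<lambda>F G H. cup3 H F G)
    + S (\<lambda>F G H. cup3 H G F) + S (\<lambda>F G H. cup3 G H F)"
    by (simp add: S_def L.scale_right_distrib sum.distrib)
  also have "S (\<lambda>F G H. cup3 G F H) = S cup3"
    unfolding S_def by (subst sum.swap) (simp add: mult_ac)
  moreover have swap23: "S (\<lambda>F G H. \<Phi> F H G) = S \<Phi>" for \<Phi>
    unfolding S_def by (rule sum.cong[OF refl], subst sum.swap) (simp add: mult_ac)
  moreover have swap12: "S (\<lambda>F G H. \<Phi> G F H) = S \<Phi>" for \<Phi>
    unfolding S_def by (subst sum.swap) (simp add: mult_ac)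
  moreover have "S cup3 = cup3 a a a" by (simp add: S_def a_def cup3_pair)
  moreover have "S (\<lambda>F G H. cup3 F H G) = S cup3" by (rule swap23)
  moreover have "S (\<lambda>F G H. cup3 H F G) = S cup3" using swap23[of "\<lambda>F G H. cup3 G F H"] swap12[of cup3] by simp
  moreover have "S (\<lambda>F G H. cup3 G H F) = S cup3" using swap12[of "\<lambda>F G H. cup3 F H G"] swap23[of cup3] by simp
  moreover have "S (\<lambda>F G H. cup3 H G F) = S cup3"
    using swap12[of "\<lambda>F G H. cup3 H F G"] swap23[of "\<lambda>F G H. cup3 G F H"] swap12[of cup3] by simp
  ultimately have "pair ?\<xi> (bracket_3 \<alpha>) =
    cup3 a a a + cup3 a a a + cup3 a a a + cup3 a a a + cup3 a a a + cup3 a a a" by simp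
  then show ?thesis
    by (simp only: sixth_sextuple)
qed

text \<open>The function part of the curvature at a point is the curvature in \<open>L\<close> of the value of \<open>\<alpha>\<close> at
  that point.\<close>

lemma curvature_at_0:
  fixes T :: "nat \<Rightarrow> 'k"
  assumes \<alpha>: "\<alpha> \<in> convf_deg V W n (- 1)"
  defines "a \<equiv> pair (coeff_at T {}) \<alpha>"
  shows "pair (coeff_at T {}) (mc_curvature V W \<alpha>) = conv_diff V W (- 1) a - cup (- 1) a a - cup3 a a a"
proof -
  have "pair (coeff_at T {}) (total_diff V W (- 1) \<alpha>) = conv_diff V W (- 1 + int 0) a +
    pair (\<lambda>c. (- 1) powi (- 1 * (coeff_deg c)) * ev T {} (d_mono c)) \<alpha>"
    unfolding a_def ev_def by (rule pair_total_diff) (auto simp: coeff_at_def fdeg_def split: if_splits)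
  also have "\<dots> = conv_diff V W (- 1) a" by (simp only: ev_d_mono_0 mult_zero_right L.pairing_functional_zero) simp
  finally show ?thesis
    by (simp only: pair_mc_curvature pair_bracket_2_at_0[OF \<alpha>] pair_bracket_3_at_0[OF \<alpha>] a_def)
qed

text \<open>The 1-form part, in the direction \<open>k\<close>, expresses \<open>dA\<close> through \<open>A\<close> and \<open>B\<close>. The minus sign of \<open>dA\<close>
  comes from moving \<open>d\<close> past a coefficient of degree \<open>-1\<close>.\<close>

lemma curvature_at_1:
  fixes T :: "nat \<Rightarrow> 'k" and k :: nat
  assumes \<alpha>: "\<alpha> \<in> convf_deg V W n (- 1)"
  defines "a \<equiv> pair (coeff_at T {}) \<alpha>" and "b \<equiv> pair (coeff_at T {k}) \<alpha>"
  shows "pair (coeff_at T {k}) (mc_curvature V W \<alpha>) =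
    conv_diff V W 0 b - pair (\<lambda>c. ev T {k} (d_mono c)) \<alpha> - cup 0 a b + cup (- 1) b a"
proof -
  have "pair (coeff_at T {k}) (total_diff V W (- 1) \<alpha>) = conv_diff V W 0 b +
    pair (\<lambda>c. (- 1) powi (- 1 * (coeff_deg c)) * lin_ext (*) (coeff_at T {k}) (d_mono c)) \<alpha>"
    by (subst pair_total_diff[of _ 1]) (auto simp: coeff_at_def fdeg_def b_def split: if_splits)
  also have "pair (\<lambda>c. (- 1) powi (- 1 * (coeff_deg c)) * lin_ext (*) (coeff_at T {k}) (d_mono c)) \<alpha> =
    pair (\<lambda>c. (- 1) * ev T {k} (d_mono c)) \<alpha>"
    by (rule L.pairing_cong) (auto simp: ev_def[symmetric] ev_d_mono_1 fdeg_def)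
  also have "\<dots> = - pair (\<lambda>c. ev T {k} (d_mono c)) \<alpha>"
    by (subst L.pairing_functional_scale) (simp add: fun_eq_iff prod_eq_iff)
  finally have td: "pair (coeff_at T {k}) (total_diff V W (- 1) \<alpha>) =
    conv_diff V W 0 b + - pair (\<lambda>c. ev T {k} (d_mono c)) \<alpha>" .
  have b3: "pair (coeff_at T {k}) (bracket_3 \<alpha>) = 0"
    by (rule pair_bracket_3_pos[OF \<alpha>]) (auto simp: coeff_at_def split: if_splits)
  show ?thesis
    unfolding pair_mc_curvature pair_bracket_2_at_1[OF \<alpha>] b3 td L.scale_zero_right a_def b_def
    by (simp only: diff_conv_add_uminus minus_add_distrib minus_minus minus_zero add_0_right add.assoc)
qed

text \<open>In form degree 2 only \<open>dB\<close> remains.\<close>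

lemma curvature_high:
  assumes \<alpha>: "\<alpha> \<in> convf_deg V W n (- 1)" and \<xi>: "\<And>b. \<xi> b \<noteq> 0 \<Longrightarrow> high b"
  shows "pair \<xi> (mc_curvature V W \<alpha>) = pair (\<lambda>b. lin_ext (*) \<xi> (d_mono b)) \<alpha>"
proof -
  have zero: "lookup \<alpha> b = 0" if "fdeg b \<ge> 2" for b
    using conv_deg_pos[OF convf_degD(1)[OF \<alpha>]] that by simp
  have high0: "lookup \<alpha> b = 0" if "high b" for b
    using zero[of b] convf_degD(3)[OF \<alpha>, of b] high_iff[of b] that by (auto simp: in_keys_iff)
  have diff0: "conv_diff V W k (0 :: ('a, 'b, 'c, 'd) conv) = 0" for k by (rule linear_simps(3)[OF linear_conv_diff])
  have "pair \<xi> (total_diff V W (- 1) \<alpha>) = (\<Sum>b\<in>keys \<alpha>. conv_scale W (\<xi> b) (conv_diff V W (coeff_deg b) (lookup \<alpha> b)))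
    + pair (\<lambda>b. (- 1) powi (- 1 * (coeff_deg b)) * lin_ext (*) \<xi> (d_mono b)) \<alpha>"
    by (simp add: total_diff_def L.pairing_add pair_form_ext L.pairing_sum pair_tensor ev_simps)
  also have "(\<Sum>b\<in>keys \<alpha>. conv_scale W (\<xi> b) (conv_diff V W (coeff_deg b) (lookup \<alpha> b))) = 0"
  proof (intro sum.neutral ballI)
    fix b
    show "conv_scale W (\<xi> b) (conv_diff V W (coeff_deg b) (lookup \<alpha> b)) = 0"
      by (cases "\<xi> b = 0") (use \<xi> high0 diff0 in auto)
  qed
  also have "pair (\<lambda>b. (- 1) powi (- 1 * (coeff_deg b)) * lin_ext (*) \<xi> (d_mono b)) \<alpha> =
    pair (\<lambda>b. lin_ext (*) \<xi> (d_mono b)) \<alpha>"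
  proof (rule L.pairing_cong)
    fix b assume b: "b \<in> keys \<alpha>"
    then have fin: "finite (snd b)" using convf_degD[OF \<alpha>] by auto
    have "fdeg b < 2" using zero[of b] b by (auto simp: in_keys_iff)
    then consider "fdeg b = 0" | "fdeg b = 1" by linarith
    then show "(- 1) powi (- 1 * (coeff_deg b)) * lin_ext (*) \<xi> (d_mono b) = lin_ext (*) \<xi> (d_mono b)"
    proof cases
      case 1
      have "d_mono b \<in> (forms_on UNIV 1 :: 'k form set)"
        using forms_on_d_mono[of "fst b" UNIV "snd b"] fin 1 by (simp add: fdeg_def)
      then have "lin_ext (*) \<xi> (d_mono b) = 0"
        using \<xi> by (intro lin_ext_eq_0) (fastforce simp: forms_on_def high_def card_1_singleton_iff)
      then show ?thesis by simp
    qed simp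
  qed
  finally have td: "pair \<xi> (total_diff V W (- 1) \<alpha>) = pair (\<lambda>b. lin_ext (*) \<xi> (d_mono b)) \<alpha>"
    by (simp only: add_0_left)
  have b2: "pair \<xi> (bracket_2 \<alpha>) = 0"
    by (rule pair_bracket_2_high[OF \<alpha> \<xi>])
  have b3: "pair \<xi> (bracket_3 \<alpha>) = 0"
    by (rule pair_bracket_3_pos[OF \<alpha>]) (use \<xi> in \<open>auto simp: high_def\<close>)
  show ?thesis
    by (simp only: pair_mc_curvature td b2 b3 L.scale_zero_right diff_zero)
qed

end

section \<open>Infinity morphisms and their homotopies\<close>

lemma coprod_iter_2_1: "coprod_iter (Suc (Suc 0)) [u] = 0"
  unfolding coprod_iter_2 coprod_1 by simp

context convolution
begin

lemma linear_inj:
  "linear_map s (scl0 W) f \<Longrightarrow> linear_map s (scl W) (\<lambda>x. (f x, 0))"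
  "linear_map s (scl1 W) f' \<Longrightarrow> linear_map s (scl W) (\<lambda>x. (0, f' x))"
  using W.vector_space_scl by (auto simp: Vector_Spaces.linear_iff scl_def)

lemma bilinear_mapI:
  assumes "\<And>x. linear_map s2 s3 (\<lambda>y. f x y)" "\<And>y. linear_map s1 s3 (\<lambda>x. f x y)"
  shows "bilinear_map s1 s2 s3 f"
  using assms by (simp add: bilinear_map_def)

lemma bilinear_mapD:
  assumes "bilinear_map s1 s2 s3 f"
  shows "linear_map s2 s3 (\<lambda>y. f x y)" "linear_map s1 s3 (\<lambda>x. f x y)"
  using assms by (simp_all add: bilinear_map_def)

lemma mc_of_conv_deg:
  fixes m :: "('a, 'b, 'c, 'd) leibniz2_mor"
  assumes "linear_map (scl0 V) (scl0 W) (mor0 m)" "linear_map (scl1 V) (scl1 W) (mor1 m)"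
    "bilinear_map (scl0 V) (scl0 V) (scl1 W) (mor2 m)"
  shows "mc_of m \<in> conv_deg V W (- 1)"
proof -
  have null: "linear_map (scl0 V) (scl W) (\<lambda>x. (0, 0))" "linear_map (scl1 V) (scl W) (\<lambda>x. (0, 0))"
    using linear_null[OF V.vs0 W.vector_space_scl] linear_null[OF V.vs1 W.vector_space_scl]
    by (simp_all add: zero_prod_def)
  have "linear_map (scl0 V) (scl W) (\<lambda>x. mc_of m (u @ Inl x # w))" for u w
  proof -
    consider "u = []" "w = []" | y where "u = []" "w = [Inl y]" | y where "u = [Inl y]" "w = []"
      | "\<And>x. mc_of m (u @ Inl x # w) = (0, 0)"
      by (cases "(m, u @ Inl undefined # w)" rule: mc_of.cases) (auto simp: append_eq_Cons_conv Cons_eq_append_conv)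
    then show ?thesis
      by cases (auto intro: linear_inj assms null bilinear_mapD[OF assms(3)])
  qed
  moreover have "linear_map (scl1 V) (scl W) (\<lambda>x. mc_of m (u @ Inr x # w))" for u w
  proof -
    consider "u = []" "w = []" | "\<And>x. mc_of m (u @ Inr x # w) = (0, 0)"
      by (cases "(m, u @ Inr undefined # w)" rule: mc_of.cases) (auto simp: append_eq_Cons_conv Cons_eq_append_conv)
    then show ?thesis
      by cases (auto intro: linear_inj assms null)
  qed
  moreover have "(wdeg w \<noteq> 1 \<longrightarrow> fst (mc_of m w) = 0) \<and> (wdeg w \<noteq> 2 \<longrightarrow> snd (mc_of m w) = 0)" for w
    by (cases "(m, w)" rule: mc_of.cases) auto
  ultimately show ?thesis by (auto simp: conv_deg_def zero_prod_def)
qed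

lemma cup_apply_0:
  fixes F G :: "('a, 'b, 'c, 'd) conv"
  assumes "\<And>u v. wdeg u + wdeg v = wdeg w \<Longrightarrow> ops W [F u, G v] = 0"
  shows "cup k F G w = 0"
  unfolding cup_def lin_ext_def
proof (intro sum.neutral ballI)
  fix ws assume "ws \<in> keys (coprod w :: _ \<Rightarrow>\<^sub>0 'k)"
  then obtain u v where "ws = [u, v]" "wdeg u + wdeg v = wdeg w" using coprod_keys by blast
  then show "scl W (lookup (coprod w) ws) (scl W ((- 1) powi (k * wdeg (ws ! 0))) (ops W [F (ws ! 0), G (ws ! Suc 0)])) = 0"
    using assms by simp
qed

lemma cup3_apply_0:
  fixes F G H :: "('a, 'b, 'c, 'd) conv"
  assumes "\<And>u v t. wdeg u + wdeg v + wdeg t = wdeg w \<Longrightarrow> ops W [F u, G v, H t] = 0"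
  shows "cup3 F G H w = 0"
  unfolding cup3_def lin_ext_def
proof (intro sum.neutral ballI)
  fix ws assume "ws \<in> keys (coprod_iter (Suc (Suc 0)) w :: _ \<Rightarrow>\<^sub>0 'k)"
  then obtain u v t where "ws = [u, v, t]" "wdeg u + wdeg v + wdeg t = wdeg w" using coprod_iter_2_keys by blast
  then show "scl W (lookup (coprod_iter (Suc (Suc 0)) w) ws)
      (scl W (interchange_sign [- 1, - 1, - 1] (map wdeg ws)) (ops W [F (ws ! 0), G (ws ! Suc 0), H (ws ! Suc (Suc 0))])) = 0"
    using assms by simp
qed

lemma conv_diff_apply_0:
  fixes F :: "('a, 'b, 'c, 'd) conv"
  assumes "ops W [F w] = 0" "\<And>v. wdeg v = wdeg w - 1 \<Longrightarrow> F v = 0"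
  shows "conv_diff V W k F w = 0"
proof -
  have "lin_ext (scl W) F (coder V w) = 0"
    unfolding lin_ext_def by (rule sum.neutral) (use assms(2) V.coder_keys in fastforce)
  then show ?thesis using assms(1) by (simp add: conv_diff_def)
qed

lemmas word_simps = conv_diff_def cup_def cup3_def V.coder_small lin_ext_add[OF W.vector_space_scl]
  lin_ext_single[OF W.vector_space_scl] coprod_1 coprod_2 coprod_3 coprod_iter_2_1 coprod_iter_2_2 coprod_iter_2_3
  interchange_sign_def lessThan_Suc

text \<open>By degree, the equation is trivial except on words of degree 2 and 3, and on the five types
  of such words it is one of the five defining equations of an infinity morphism.\<close>

lemma infinity_morphism_curvature:
  fixes m :: "('a, 'b, 'c, 'd) leibniz2_mor"
  assumes "infinity_morphism V W m"
  defines "a \<equiv> mc_of m"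
  shows "conv_diff V W (- 1) a - cup (- 1) a a - cup3 a a a = 0"
proof
  fix w :: "('a, 'b) word"
  interpret m: infinity_morphism V W m by fact
  have deg: "a \<in> conv_deg V W (- 1)"
    unfolding a_def by (intro mc_of_conv_deg m.mor0_linear m.mor1_linear m.mor2_bilinear)
  have f0: "fst (a u) = 0" if "wdeg u \<noteq> 1" for u using conv_degD(2)[OF deg] that by auto
  have s0: "snd (a u) = 0" if "wdeg u \<noteq> 2" for u using conv_degD(3)[OF deg] that by auto
  consider "wdeg w \<noteq> 2" "wdeg w \<noteq> 3" | "wdeg w = 2" | "wdeg w = 3" by blast
  then show "(conv_diff V W (- 1) a - cup (- 1) a a - cup3 a a a) w = 0 w"
  proof cases
    case 1
    have "conv_diff V W (- 1) a w = 0"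
      by (rule conv_diff_apply_0) (use 1 f0 s0 in \<open>auto simp: prod_eq_iff\<close>)
    moreover have "cup (- 1) a a w = 0"
    proof (rule cup_apply_0)
      fix u v :: "('a, 'b) word" assume uv: "wdeg u + wdeg v = wdeg w"
      have "fst (a u) = 0 \<or> fst (a v) = 0" using 1 uv f0[of u] f0[of v] by fastforce
      moreover have "fst (a u) = 0 \<or> snd (a v) = 0" using 1 uv f0[of u] s0[of v] by fastforce
      moreover have "snd (a u) = 0 \<or> fst (a v) = 0" using 1 uv s0[of u] f0[of v] by fastforce
      ultimately show "ops W [a u, a v] = 0" by (auto simp: prod_eq_iff)
    qed
    moreover have "cup3 a a a w = 0"
    proof (rule cup3_apply_0)
      fix u v t :: "('a, 'b) word" assume uvt: "wdeg u + wdeg v + wdeg t = wdeg w"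
      have "fst (a u) = 0 \<or> fst (a v) = 0 \<or> fst (a t) = 0" using 1 uvt f0[of u] f0[of v] f0[of t] by fastforce
      then show "ops W [a u, a v, a t] = 0" by (auto simp: prod_eq_iff)
    qed
    ultimately show ?thesis by simp
  next
    case 2
    then consider h where "w = [Inr h]" | x y where "w = [Inl x, Inl y]" using wdeg_2 by blast
    then show ?thesis
    proof cases
      case 1
      then show ?thesis by (simp add: word_simps a_def m.mor_l1 prod_eq_iff del: coprod_iter.simps)
    next
      case 2
      then show ?thesis by (simp add: word_simps a_def m.mor_l2_00[symmetric] prod_eq_iff del: coprod_iter.simps)
    qed
  next
    case 3
    then consider x h where "w = [Inl x, Inr h]" | h x where "w = [Inr h, Inl x]" | x y z where "w = [Inl x, Inl y, Inl z]"
      using wdeg_3 by blast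
    then show ?thesis
    proof cases
      case 1
      then show ?thesis by (simp add: word_simps a_def m.mor_l2_01 prod_eq_iff del: coprod_iter.simps)
    next
      case 2
      then show ?thesis by (simp add: word_simps a_def m.mor_l2_10 prod_eq_iff del: coprod_iter.simps)
    next
      case (3 x y z)
      have "l3 W (mor0 m x) (mor0 m y) (mor0 m z) =
        mor1 m (l3 V x y z) + mor2 m (l2_00 V x y) z - mor2 m x (l2_00 V y z) + mor2 m y (l2_00 V x z)
        + l2_10 W (mor2 m x y) (mor0 m z) - l2_01 W (mor0 m x) (mor2 m y z) + l2_01 W (mor0 m y) (mor2 m x z)"
        using m.mor_l3[of x y z] by (simp add: algebra_simps)
      then show ?thesis using 3 by (simp add: word_simps a_def prod_eq_iff del: coprod_iter.simps)
    qed
  qed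
qed

text \<open>The target of the homotopy with source \<open>g\<close> and underlying map \<open>\<beta>\<close>, obtained by solving the
  equations of a homotopy for their target.\<close>

definition shift :: "('a, 'b, 'c, 'd) leibniz2_mor \<Rightarrow> ('a \<Rightarrow> 'd) \<Rightarrow> ('a, 'b, 'c, 'd) leibniz2_mor" where
  "shift g \<beta> = \<lparr>mor0 = \<lambda>x. mor0 g x + l1 W (\<beta> x), mor1 = \<lambda>h. mor1 g h + \<beta> (l1 V h),
     mor2 = \<lambda>x y. mor2 g x y + \<beta> (l2_00 V x y) - l2_01 W (mor0 g x) (\<beta> y) - l2_10 W (\<beta> x) (mor0 g y)
       - l2_10 W (\<beta> x) (l1 W (\<beta> y))\<rparr>"

text \<open>Terms containing \<open>m\<^sub>1 \<beta>\<close> inside \<open>m\<^sub>3\<close> are expanded by the axioms (d), those inside \<open>m\<^sub>2\<close> by (a) and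
  (b); what remains are the equations of \<open>g\<close>.\<close>

lemma infinity_morphism_shift:
  assumes "infinity_morphism V W g" and \<beta>: "linear_map (scl0 V) (scl1 W) \<beta>"
  shows "infinity_morphism V W (shift g \<beta>)"
proof -
  interpret g: infinity_morphism V W g by fact
  note [simp] = linear_simps[OF \<beta>] linear_simps[OF g.mor0_linear] linear_simps[OF g.mor1_linear]
    V.bilinear_simps[OF g.mor2_bilinear] V.ax_a1 V.ax_a2 V.ax_c W.ax_a1 W.ax_a2
  have g00: "mor0 g (l2_00 V x y) = l2_00 W (mor0 g x) (mor0 g y) + l1 W (mor2 g x y)" for x y
    using g.mor_l2_00[of x y] by simp
  have g01: "mor1 g (l2_01 V x h) = l2_01 W (mor0 g x) (mor1 g h) + mor2 g x (l1 V h)" for x h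
    using g.mor_l2_01[of x h] by simp
  have g10: "mor1 g (l2_10 V h x) = l2_10 W (mor1 g h) (mor0 g x) + mor2 g (l1 V h) x" for x h
    using g.mor_l2_10[of h x] by simp
  have g3: "mor1 g (l3 V x y z) = l3 W (mor0 g x) (mor0 g y) (mor0 g z) - l2_10 W (mor2 g x y) (mor0 g z)
      + l2_01 W (mor0 g x) (mor2 g y z) - l2_01 W (mor0 g y) (mor2 g x z)
      - mor2 g (l2_00 V x y) z + mor2 g x (l2_00 V y z) - mor2 g y (l2_00 V x z)" for x y z
    using g.mor_l3[of x y z] by (simp add: algebra_simps)
  \<comment> \<open>Axiom (b), read so that \<open>m\<^sub>1\<close> meets the product: otherwise the terms of weight 2 and 3 in \<open>\<beta>\<close> do not match.\<close>
  have l2_10_l1: "l2_10 W (l2_01 W a b) (l1 W c) = l2_01 W (l2_00 W a (l1 W b)) c"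
    "l2_10 W (l2_10 W b a) (l1 W c) = l2_01 W (l2_00 W (l1 W b) a) c" for a b c
    by (simp_all flip: W.ax_b)
  show ?thesis
  proof (rule infinity_morphism.intro)
    show "linear_map (scl0 V) (scl0 W) (mor0 (shift g \<beta>))"
      unfolding shift_def by (simp, intro linear_plus g.mor0_linear linear_comp[OF \<beta> W.l1_linear])
    show "linear_map (scl1 V) (scl1 W) (mor1 (shift g \<beta>))"
      unfolding shift_def by (simp, intro linear_plus g.mor1_linear linear_comp[OF V.l1_linear \<beta>])
    show "bilinear_map (scl0 V) (scl0 V) (scl1 W) (mor2 (shift g \<beta>))"
      unfolding shift_def
      by (simp, intro bilinear_mapI linear_plus linear_minus bilinear_mapD[OF g.mor2_bilinear]
        linear_comp[OF bilinear_mapD(1)[OF V.l2_00_bilinear] \<beta>] linear_comp[OF bilinear_mapD(2)[OF V.l2_00_bilinear] \<beta>]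
        linear_comp[OF \<beta> bilinear_mapD(1)[OF W.l2_01_bilinear]] linear_comp[OF g.mor0_linear bilinear_mapD(2)[OF W.l2_01_bilinear]]
        linear_comp[OF \<beta> bilinear_mapD(2)[OF W.l2_10_bilinear]] linear_comp[OF g.mor0_linear bilinear_mapD(1)[OF W.l2_10_bilinear]]
        linear_comp[OF linear_comp[OF \<beta> W.l1_linear] bilinear_mapD(1)[OF W.l2_10_bilinear]])
    show "l1 W (mor1 (shift g \<beta>) h) = mor0 (shift g \<beta>) (l1 V h)" for h
      by (simp add: shift_def g.mor_l1)
    show "l2_00 W (mor0 (shift g \<beta>) x) (mor0 (shift g \<beta>) y) + l1 W (mor2 (shift g \<beta>) x y) =
        mor0 (shift g \<beta>) (l2_00 V x y)" for x y
      by (simp add: shift_def g00)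
    show "l2_01 W (mor0 (shift g \<beta>) x) (mor1 (shift g \<beta>) h) =
        mor1 (shift g \<beta>) (l2_01 V x h) - mor2 (shift g \<beta>) x (l1 V h)" for x h
      by (simp add: shift_def g01 W.ax_b g.mor_l1)
    show "l2_10 W (mor1 (shift g \<beta>) h) (mor0 (shift g \<beta>) x) =
        mor1 (shift g \<beta>) (l2_10 V h x) - mor2 (shift g \<beta>) (l1 V h) x" for h x
      by (simp add: shift_def g10 W.ax_b[symmetric] g.mor_l1[symmetric])
    show "l3 W (mor0 (shift g \<beta>) x) (mor0 (shift g \<beta>) y) (mor0 (shift g \<beta>) z)
      - l2_10 W (mor2 (shift g \<beta>) x y) (mor0 (shift g \<beta>) z)
      + l2_01 W (mor0 (shift g \<beta>) x) (mor2 (shift g \<beta>) y z) - l2_01 W (mor0 (shift g \<beta>) y) (mor2 (shift g \<beta>) x z) =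
      mor1 (shift g \<beta>) (l3 V x y z) + mor2 (shift g \<beta>) (l2_00 V x y) z - mor2 (shift g \<beta>) x (l2_00 V y z)
      + mor2 (shift g \<beta>) y (l2_00 V x z)" for x y z
      by (simp add: shift_def g3 g00 W.ax_d1 W.ax_d2 W.ax_d3 W.ax_b l2_10_l1)
  qed
qed

end

section \<open>The explicit lift\<close>

text \<open>The functional \<open>deriv_at\<close> on monomials, for use in pairings.\<close>

definition deriv_coeff :: "(nat \<Rightarrow> 'k::field) \<Rightarrow> nat \<Rightarrow> mono_form \<Rightarrow> 'k" where
  "deriv_coeff T k b = ev T {k} (d_mono b)"

lemma deriv_coeff_eq: "deriv_coeff T k b = (if snd b = {} then deriv_mono T k (fst b) else 0)"
  by (simp add: deriv_coeff_def ev_d_mono_1)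

lemma deriv_at_deriv_coeff: "deriv_at T k p = lin_ext (*) (deriv_coeff T k) p"
  unfolding deriv_at_eq by (rule lin_ext_cong) (simp add: deriv_coeff_eq)

lemma lin_ext_deriv_coeff_wedge_mono:
  "lin_ext (*) (deriv_coeff T k) (wedge_mono b c) =
    deriv_coeff T k b * coeff_at T {} c + coeff_at T {} b * deriv_coeff T k c"
  by (auto simp: lin_ext_wedge_mono deriv_coeff_eq coeff_at_def deriv_mono_add)

text \<open>Mixed partial derivatives are symmetric while \<open>dt\<^sub>i dt\<^sub>j\<close> is antisymmetric.\<close>

lemma d_mono_d_mono:
  fixes \<xi> :: "mono_form \<Rightarrow> 'k::field_char_0"
  assumes "snd b = {}"
  shows "lin_ext (*) (\<lambda>c. lin_ext (*) \<xi> (d_mono c)) (d_mono b) = 0"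
proof -
  let ?a = "fst b" and ?e = "\<lambda>i. single i (1::nat)"
  \<comment> \<open>\<open>f j i\<close> is the contribution of \<open>\<partial>\<^sub>i \<partial>\<^sub>j\<close>, with the sign of \<open>dt\<^sub>i dt\<^sub>j\<close> in increasing order.\<close>
  define f where "f = (\<lambda>j i. if i = j then 0 else of_nat (lookup ?a j) * of_nat (lookup ?a i) *
    (if j < i then - 1 else 1) * \<xi> (?a - ?e j - ?e i, {i, j}))"
  have comm: "?a - ?e j - ?e i = ?a - ?e i - ?e j" for i j
    by (intro poly_mapping_eqI) (simp add: lookup_minus)
  have anti: "f i j = - f j i" for i j
  proof (cases i j rule: linorder_cases)
    case less
    then show ?thesis by (simp add: f_def comm[of j i, simplified] insert_commute mult_ac)
  next
    case equal
    then show ?thesis by (simp add: f_def)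
  next
    case greater
    then show ?thesis by (simp add: f_def comm[of j i, simplified] insert_commute mult_ac)
  qed
  have inner: "of_nat (lookup ?a j) * lin_ext (*) \<xi> (d_mono (?a - ?e j, {j})) = (\<Sum>i\<in>keys ?a. f j i)" for j
  proof -
    have "lin_ext (*) \<xi> (d_mono (?a - ?e j, {j})) = (\<Sum>i\<in>keys ?a. if i \<in> {j} then 0
        else of_nat (lookup (?a - ?e j) i) * (- 1) ^ card {l \<in> {j}. l < i} * \<xi> (?a - ?e j - ?e i, insert i {j}))"
      unfolding lin_ext_d_mono fst_conv snd_conv
      by (rule sum.mono_neutral_left) (auto simp: in_keys_iff lookup_minus)
    also have "of_nat (lookup ?a j) * \<dots> = (\<Sum>i\<in>keys ?a. f j i)"
      unfolding sum_distrib_left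
    proof (rule sum.cong[OF refl])
      fix i
      have "{l. l = j \<and> l < i} = (if j < i then {j} else {})" by auto
      then show "of_nat (lookup ?a j) * (if i \<in> {j} then 0
        else of_nat (lookup (?a - ?e j) i) * (- 1) ^ card {l \<in> {j}. l < i} * \<xi> (?a - ?e j - ?e i, insert i {j})) = f j i"
        by (simp add: f_def lookup_minus lookup_single mult.assoc)
    qed
    finally show ?thesis .
  qed
  define S where "S = (\<Sum>j\<in>keys ?a. \<Sum>i\<in>keys ?a. f j i)"
  have "lin_ext (*) (\<lambda>c. lin_ext (*) \<xi> (d_mono c)) (d_mono b) = S"
    unfolding lin_ext_d_mono[of "\<lambda>c. lin_ext (*) \<xi> (d_mono c)"] S_def using assms
    by (simp add: inner[simplified])
  moreover have "S = - S"
    unfolding S_def by (subst sum.swap) (simp only: anti[symmetric] sum_negf[symmetric])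
  then have "2 * S = 0" by (metis add.right_inverse mult_2)
  then have "S = 0" by simp
  ultimately show ?thesis by simp
qed

lemma forms_on_d_mono_fdeg:
  assumes "finite (snd b)"
  shows "d_mono b \<in> forms_on UNIV (Suc (fdeg b))"
  using forms_on_d_mono[of "fst b" UNIV "snd b"] assms by (simp add: fdeg_def)

lemma high_lin_ext_0:
  fixes \<xi> :: "mono_form \<Rightarrow> 'k::field"
  assumes "p \<in> forms_on UNIV m" "m \<le> 1" "\<And>b. \<xi> b \<noteq> 0 \<Longrightarrow> high b"
  shows "lin_ext (*) \<xi> p = 0"
proof (rule lin_ext_eq_0)
  fix b assume "b \<in> keys p"
  then have "finite (snd b)" "fdeg b = m" using assms(1) by (auto simp: forms_on_def fdeg_def)
  then have "\<not> high b" using assms(2) by (simp add: high_iff)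
  then show "\<xi> b = 0" using assms(3) by blast
qed

lemma diff_rearrange: "a - x - c + d = (a - c + d) - (x :: 'z::ab_group_add)"
  by (simp add: algebra_simps)

context convolution
begin

lemma word_cases:
  fixes w :: "('a, 'b) word"
  obtains (V0) x where "w = [Inl x]" | (V1) h where "w = [Inr h]" | (V00) x y where "w = [Inl x, Inl y]"
    | (other) "\<And>m :: ('a, 'b, 'c, 'd) leibniz2_mor. mc_of m w = 0" "wdeg w \<noteq> 1" "wdeg w \<noteq> 2"
proof (cases "wdeg w = 1 \<or> wdeg w = 2")
  case True
  then show ?thesis using wdeg_1[of w] wdeg_2[of w] V0 V1 V00 by blast
next
  case False
  moreover have "mc_of m w = 0" for m :: "('a, 'b, 'c, 'd) leibniz2_mor"
    using False by (cases "(m, w)" rule: mc_of.cases) (auto simp: zero_prod_def)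
  ultimately show ?thesis using other by blast
qed

text \<open>The terms of \<open>mc_of (shift g \<beta>)\<close> that are linear in \<open>\<beta>\<close>, and the quadratic one in polarized
  form; the latter is needed because \<open>\<beta>\<close> will be a combination of monomials whose products have to be
  formed.\<close>

definition lin_part :: "('a, 'b, 'c, 'd) leibniz2_mor \<Rightarrow> ('a, 'b, 'c, 'd) conv \<Rightarrow> ('a, 'b, 'c, 'd) conv" where
  "lin_part g F = mc_of \<lparr>mor0 = \<lambda>x. l1 W (snd (F [Inl x])), mor1 = \<lambda>h. snd (F [Inl (l1 V h)]),
     mor2 = \<lambda>x y. snd (F [Inl (l2_00 V x y)]) - l2_01 W (mor0 g x) (snd (F [Inl y])) - l2_10 W (snd (F [Inl x])) (mor0 g y)\<rparr>"

definition quad_part :: "('a, 'b, 'c, 'd) conv \<Rightarrow> ('a, 'b, 'c, 'd) conv \<Rightarrow> ('a, 'b, 'c, 'd) conv" where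
  "quad_part F G = mc_of \<lparr>mor0 = \<lambda>x. 0, mor1 = \<lambda>h. 0, mor2 = \<lambda>x y. - l2_10 W (snd (F [Inl x])) (l1 W (snd (G [Inl y])))\<rparr>"

lemma scl1_minus [simp]: "scl1 W c (x - y) = scl1 W c x - scl1 W c y" "scl1 W c (- x) = - scl1 W c x"
proof -
  interpret v1: vector_space "scl1 W" by (rule W.vs1)
  show "scl1 W c (x - y) = scl1 W c x - scl1 W c y" "scl1 W c (- x) = - scl1 W c x"
    by (simp_all add: v1.scale_right_diff_distrib)
qed

lemma linear_lin_part: "linear_map (conv_scale W) (conv_scale W) (lin_part g)"
proof -
  have "lin_part g (F + G) w = (lin_part g F + lin_part g G) w" for F G w
    by (cases w rule: word_cases) (simp_all add: lin_part_def prod_eq_iff)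
  moreover have "lin_part g (conv_scale W c F) w = conv_scale W c (lin_part g F) w" for c F w
    by (cases w rule: word_cases) (simp_all add: lin_part_def prod_eq_iff)
  ultimately show ?thesis
    by (simp add: Vector_Spaces.linear_iff L.vector_space_axioms fun_eq_iff)
qed

lemma linear_quad_part:
  "linear_map (conv_scale W) (conv_scale W) (\<lambda>F. quad_part F G)"
  "linear_map (conv_scale W) (conv_scale W) (\<lambda>F. quad_part G F)"
proof -
  have "quad_part (F + F') G w = (quad_part F G + quad_part F' G) w"
    "quad_part G (F + F') w = (quad_part G F + quad_part G F') w" for F F' G w
    by (cases w rule: word_cases; simp add: quad_part_def prod_eq_iff)+
  moreover have "quad_part (conv_scale W c F) G w = conv_scale W c (quad_part F G) w"
    "quad_part G (conv_scale W c F) w = conv_scale W c (quad_part G F) w" for c F G w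
    by (cases w rule: word_cases; simp add: quad_part_def prod_eq_iff)+
  ultimately show "linear_map (conv_scale W) (conv_scale W) (\<lambda>F. quad_part F G)"
    "linear_map (conv_scale W) (conv_scale W) (\<lambda>F. quad_part G F)"
    by (simp_all add: Vector_Spaces.linear_iff L.vector_space_axioms fun_eq_iff)
qed

lemma mc_of_shift:
  "mc_of g + lin_part g F + quad_part F F = mc_of (shift g (\<lambda>x. snd (F [Inl x])))"
proof
  fix w
  show "(mc_of g + lin_part g F + quad_part F F) w = mc_of (shift g (\<lambda>x. snd (F [Inl x]))) w"
    by (cases w rule: word_cases) (simp_all add: lin_part_def quad_part_def shift_def prod_eq_iff)
qed

lemma linear_snd: "linear_map (scl W) (scl1 W) snd"
  using W.vector_space_scl W.vs1 by (simp add: Vector_Spaces.linear_iff)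

lemma conv_deg_hom_linear:
  assumes "F \<in> conv_deg V W k"
  shows "linear_map (scl0 V) (scl1 W) (\<lambda>x. snd (F [Inl x]))"
  using linear_comp[OF conv_degD(4)[OF assms, of "[]" "[]"] linear_snd] by simp

lemma lin_part_conv_deg:
  assumes "infinity_morphism V W g" "F \<in> conv_deg V W k"
  shows "lin_part g F \<in> conv_deg V W (- 1)"
proof -
  interpret g: infinity_morphism V W g by fact
  note F = conv_deg_hom_linear[OF assms(2)]
  show ?thesis unfolding lin_part_def
    by (rule mc_of_conv_deg; simp; intro bilinear_mapI linear_minus
       linear_comp[OF F W.l1_linear] linear_comp[OF V.l1_linear F]
       linear_comp[OF bilinear_mapD(1)[OF V.l2_00_bilinear] F] linear_comp[OF bilinear_mapD(2)[OF V.l2_00_bilinear] F]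
       linear_comp[OF F bilinear_mapD(1)[OF W.l2_01_bilinear]] linear_comp[OF g.mor0_linear bilinear_mapD(2)[OF W.l2_01_bilinear]]
       linear_comp[OF F bilinear_mapD(2)[OF W.l2_10_bilinear]] linear_comp[OF g.mor0_linear bilinear_mapD(1)[OF W.l2_10_bilinear]])
qed

lemma quad_part_conv_deg:
  assumes "F \<in> conv_deg V W k" "G \<in> conv_deg V W l"
  shows "quad_part F G \<in> conv_deg V W (- 1)"
proof -
  note F = conv_deg_hom_linear[OF assms(1)] and G = conv_deg_hom_linear[OF assms(2)]
  show ?thesis unfolding quad_part_def
    by (rule mc_of_conv_deg; simp; intro bilinear_mapI linear_neg linear_null V.vs0 V.vs1 W.vs0 W.vs1
       linear_comp[OF F bilinear_mapD(2)[OF W.l2_10_bilinear]]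
       linear_comp[OF linear_comp[OF G W.l1_linear] bilinear_mapD(1)[OF W.l2_10_bilinear]])
qed

lemma lookup_tensor [simp]:
  fixes F :: "('a, 'b, 'c, 'd) conv"
  shows "lookup (tensor W F \<omega>) b = conv_scale W (lookup \<omega> b) F"
  by (simp add: tensor_def Poly_Mapping.map.rep_eq when_def)

lemma tensor_convf_deg:
  fixes F :: "('a, 'b, 'c, 'd) conv"
  assumes "F \<in> conv_deg V W (k + int m)" "\<omega> \<in> forms_on {1..n} m"
  shows "tensor W F \<omega> \<in> convf_deg V W n k"
proof -
  have "keys (tensor W F \<omega>) \<subseteq> keys \<omega>" by (auto simp: in_keys_iff)
  moreover have "keys \<omega> \<subseteq> simplex_basis n"
  proof
    fix b assume "b \<in> keys \<omega>"
    then have "keys (fst b) \<subseteq> {1..n} \<and> snd b \<subseteq> {1..n}"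
      using assms(2) unfolding forms_on_def by blast
    then show "b \<in> simplex_basis n" by (cases b) (simp add: simplex_basis_def)
  qed
  moreover have "conv_scale W (lookup \<omega> b) F \<in> conv_deg V W (k + int (fdeg b))" for b
  proof (cases "b \<in> keys \<omega>")
    case True
    then have "fdeg b = m" using assms(2) by (auto simp: forms_on_def fdeg_def)
    then show ?thesis using assms(1) by (simp add: conv_deg_scale)
  next
    case False
    then show ?thesis by (simp add: in_keys_iff conv_deg_zero)
  qed
  ultimately show ?thesis unfolding convf_deg_def mem_Collect_eq lookup_tensor by blast
qed

lemma convf_deg_zero: "0 \<in> convf_deg V W n k"
  by (simp add: convf_deg_def conv_deg_zero)

lemma convf_deg_add:
  assumes "\<alpha> \<in> convf_deg V W n k" "\<beta> \<in> convf_deg V W n k"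
  shows "\<alpha> + \<beta> \<in> convf_deg V W n k"
  using assms Poly_Mapping.keys_add[of \<alpha> \<beta>] unfolding convf_deg_def
  by (simp add: lookup_add conv_deg_add) blast

lemma convf_deg_sum: "(\<And>a. a \<in> A \<Longrightarrow> \<alpha> a \<in> convf_deg V W n k) \<Longrightarrow> sum \<alpha> A \<in> convf_deg V W n k"
  by (induction A rule: infinite_finite_induct) (auto intro: convf_deg_zero convf_deg_add)

lemma conv0_functionsD:
  assumes "\<beta> \<in> conv0_functions V W n"
  shows "\<beta> \<in> convf_deg V W n 0" "b \<in> keys \<beta> \<Longrightarrow> snd b = {}"
    "b \<in> keys \<beta> \<Longrightarrow> keys (fst b) \<subseteq> {1..n}"
    "b \<in> keys \<beta> \<Longrightarrow> lookup \<beta> b \<in> conv_deg V W 0"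
proof -
  show \<beta>: "\<beta> \<in> convf_deg V W n 0" using assms by (simp add: conv0_functions_def)
  show "snd b = {}" if "b \<in> keys \<beta>"
    using assms convf_degD(3)[OF \<beta> that] that by (auto simp: conv0_functions_def fdeg_def)
  then show "lookup \<beta> b \<in> conv_deg V W 0" if "b \<in> keys \<beta>"
    using convf_degD(1)[OF \<beta>, of b] that by (simp add: fdeg_def)
  show "keys (fst b) \<subseteq> {1..n}" if "b \<in> keys \<beta>"
    using convf_degD(2)[OF \<beta> that] by (auto simp: simplex_basis_def)
qed

lemma eval_vertex_pair: "eval_vertex W i \<alpha> = pair (coeff_at (\<lambda>j. of_bool (j = i)) {}) \<alpha>"
  unfolding eval_vertex_def pairing_def by (simp add: eval_mono_eq)

text \<open>The element \<open>A + B\<close> with \<open>A = mc_of (shift g \<beta>)\<close>, evaluated in functions on the simplex, and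
  \<open>B = d\<beta>\<close>.\<close>

definition lift :: "('a, 'b, 'c, 'd) leibniz2_mor \<Rightarrow> ('a, 'b, 'c, 'd) convf \<Rightarrow> ('a, 'b, 'c, 'd) convf" where
  "lift g \<beta> = tensor W (mc_of g) form_one
    + (\<Sum>b\<in>keys \<beta>. tensor W (lin_part g (lookup \<beta> b)) (single b 1))
    + (\<Sum>b\<in>keys \<beta>. \<Sum>c\<in>keys \<beta>.
        tensor W (quad_part (lookup \<beta> b) (lookup \<beta> c)) (wedge_mono b c))
    + (\<Sum>b\<in>keys \<beta>. tensor W (lookup \<beta> b) (d_mono b))"

lemma lift_convf_deg:
  assumes g: "infinity_morphism V W g" and \<beta>: "\<beta> \<in> conv0_functions V W n"
  shows "lift g \<beta> \<in> convf_deg V W n (- 1)"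
proof -
  interpret g: infinity_morphism V W g by fact
  have b: "keys (fst b) \<subseteq> {1..n}" "snd b = {}" "lookup \<beta> b \<in> conv_deg V W 0"
    if "b \<in> keys \<beta>" for b
    using conv0_functionsD[OF \<beta>] that by auto
  have "tensor W (mc_of g) form_one \<in> convf_deg V W n (- 1)"
    by (rule tensor_convf_deg[where m = 0])
      (simp_all add: mc_of_conv_deg g.mor0_linear g.mor1_linear g.mor2_bilinear forms_on_form_one)
  moreover have "tensor W (lin_part g (lookup \<beta> b)) (single b 1) \<in> convf_deg V W n (- 1)"
    if "b \<in> keys \<beta>" for b
    by (rule tensor_convf_deg[where m = 0]) (use b[OF that] lin_part_conv_deg[OF g] in \<open>auto simp: forms_on_def\<close>)
  moreover have "tensor W (quad_part (lookup \<beta> b) (lookup \<beta> c)) (wedge_mono b c) \<in> convf_deg V W n (- 1)"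
    if "b \<in> keys \<beta>" "c \<in> keys \<beta>" for b c
  proof (rule tensor_convf_deg[where m = 0])
    show "quad_part (lookup \<beta> b) (lookup \<beta> c) \<in> conv_deg V W (- 1 + int 0)"
      using quad_part_conv_deg[OF b(3)[OF that(1)] b(3)[OF that(2)]] by simp
    show "wedge_mono b c \<in> forms_on {1..n} 0"
      using forms_on_wedge_mono[of "fst b" "{1..n}" "{}" "fst c" "{}"] b[OF that(1)] b[OF that(2)]
      by (cases b; cases c) simp
  qed
  moreover have "tensor W (lookup \<beta> b) (d_mono b) \<in> convf_deg V W n (- 1)"
    if "b \<in> keys \<beta>" for b
  proof (rule tensor_convf_deg[where m = 1])
    show "lookup \<beta> b \<in> conv_deg V W (- 1 + int 1)" using b[OF that] by simp
    show "d_mono b \<in> forms_on {1..n} 1"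
      using forms_on_d_mono[of "fst b" "{1..n}" "{}"] b[OF that] by (cases b) simp
  qed
  ultimately show ?thesis unfolding lift_def
    by (intro convf_deg_add convf_deg_sum)
qed

lemma pair_lift:
  "pair \<xi> (lift g \<beta>) = conv_scale W (\<xi> (0, {})) (mc_of g) + lin_part g (pair \<xi> \<beta>)
    + (\<Sum>b\<in>keys \<beta>. \<Sum>c\<in>keys \<beta>.
        conv_scale W (lin_ext (*) \<xi> (wedge_mono b c)) (quad_part (lookup \<beta> b) (lookup \<beta> c)))
    + pair (\<lambda>b. lin_ext (*) \<xi> (d_mono b)) \<beta>"
proof -
  have "pair \<xi> (\<Sum>b\<in>keys \<beta>. tensor W (lookup \<beta> b) (d_mono b)) = pair (\<lambda>b. lin_ext (*) \<xi> (d_mono b)) \<beta>"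
    by (simp only: L.pairing_sum pair_tensor) (simp only: pairing_def)
  moreover have "pair \<xi> (\<Sum>b\<in>keys \<beta>. tensor W (lin_part g (lookup \<beta> b)) (single b 1)) = lin_part g (pair \<xi> \<beta>)"
    by (simp add: L.pairing_sum pair_tensor ev_simps linear_pairing[OF linear_lin_part])
  ultimately show ?thesis
    unfolding lift_def by (simp only: L.pairing_add L.pairing_sum pair_tensor form_one_def ev_simps mult_1)
qed

lemma quad_part_pair:
  "quad_part (pair \<xi> \<beta>) (pair \<zeta> \<beta>) = (\<Sum>b\<in>keys \<beta>. \<Sum>c\<in>keys \<beta>.
     conv_scale W (\<xi> b * \<zeta> c) (quad_part (lookup \<beta> b) (lookup \<beta> c)))"
proof -
  have 1: "quad_part (pair \<xi> \<beta>) Q = (\<Sum>b\<in>keys \<beta>. conv_scale W (\<xi> b) (quad_part (lookup \<beta> b) Q))" for Q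
    by (rule linear_pairing[OF linear_quad_part(1)])
  have 2: "quad_part P (pair \<zeta> \<beta>) = (\<Sum>c\<in>keys \<beta>. conv_scale W (\<zeta> c) (quad_part P (lookup \<beta> c)))" for P
    by (rule linear_pairing[OF linear_quad_part(2)])
  show ?thesis unfolding 1 unfolding 2 by (simp add: L.scale_sum_right)
qed

lemma lin_part_0: "lin_part g 0 = 0"
  by (rule linear_simps(3)[OF linear_lin_part])

lemma lift_at_0:
  assumes \<beta>: "\<beta> \<in> conv0_functions V W n"
  shows "pair (coeff_at T {}) (lift g \<beta>) = mc_of (shift g (\<lambda>x. snd (pair (coeff_at T {}) \<beta> [Inl x])))"
proof -
  have "pair (coeff_at T {}) (lift g \<beta>) =
    mc_of g + lin_part g (pair (coeff_at T {}) \<beta>) + quad_part (pair (coeff_at T {}) \<beta>) (pair (coeff_at T {}) \<beta>)"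
    unfolding pair_lift quad_part_pair ev_def[symmetric] ev_wedge_mono_0 ev_d_mono_0
    by (simp add: coeff_at_def[of T "{}" "(0, {})"])
  then show ?thesis by (simp only: mc_of_shift)
qed

text \<open>The positive-degree part of the lift is \<open>d\<beta>\<close>.\<close>

lemma lift_positive:
  assumes \<beta>: "\<beta> \<in> conv0_functions V W n" and \<xi>: "\<And>b. \<xi> b \<noteq> 0 \<Longrightarrow> snd b \<noteq> {}"
  shows "pair \<xi> (lift g \<beta>) = pair (\<lambda>b. lin_ext (*) \<xi> (d_mono b)) \<beta>"
proof -
  have \<xi>0: "\<xi> (a, {}) = 0" for a using \<xi>[of "(a, {})"] by auto
  have "pair \<xi> \<beta> = 0"
    unfolding pairing_def
  proof (intro sum.neutral ballI)
    fix b assume "b \<in> keys \<beta>"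
    then have "snd b = {}" by (rule conv0_functionsD(2)[OF \<beta>])
    then have "\<xi> b = 0" using \<xi> by blast
    then show "conv_scale W (\<xi> b) (lookup \<beta> b) = 0" by simp
  qed
  moreover have "lin_ext (*) \<xi> (wedge_mono b c) = 0" if "b \<in> keys \<beta>" "c \<in> keys \<beta>" for b c
    using conv0_functionsD(2)[OF \<beta>] that by (simp add: lin_ext_wedge_mono \<xi>0)
  ultimately show ?thesis
    unfolding pair_lift by (simp add: \<xi>0 lin_part_0)
qed

lemma lift_at_1:
  assumes \<beta>: "\<beta> \<in> conv0_functions V W n"
  shows "pair (coeff_at T {k}) (lift g \<beta>) = pair (deriv_coeff T k) \<beta>"
proof -
  have "pair (coeff_at T {k}) (lift g \<beta>) = pair (\<lambda>b. ev T {k} (d_mono b)) \<beta>"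
    unfolding ev_def by (rule lift_positive[OF \<beta>]) (auto simp: coeff_at_def split: if_splits)
  then show ?thesis by (simp only: deriv_coeff_def[abs_def])
qed

text \<open>\<open>dA\<close>, computed by the Leibniz rule from the expression of \<open>A\<close> as a polynomial in \<open>\<beta>\<close>.\<close>

lemma lift_derivative:
  assumes \<beta>: "\<beta> \<in> conv0_functions V W n"
  shows "pair (deriv_coeff T k) (lift g \<beta>) = lin_part g (pair (deriv_coeff T k) \<beta>)
    + quad_part (pair (deriv_coeff T k) \<beta>) (pair (coeff_at T {}) \<beta>) + quad_part (pair (coeff_at T {}) \<beta>) (pair (deriv_coeff T k) \<beta>)"
proof -
  have "lin_ext (*) (deriv_coeff T k) (d_mono b) = 0" for b
    unfolding lin_ext_d_mono by (rule sum.neutral) (auto simp: deriv_coeff_eq)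
  moreover have "deriv_coeff T k (0, {}) = 0" by (simp add: deriv_coeff_eq deriv_mono_def)
  ultimately show ?thesis
    unfolding pair_lift quad_part_pair lin_ext_deriv_coeff_wedge_mono
    by (simp only: L.scale_left_distrib sum.distrib L.scale_zero_left L.pairing_functional_zero add_0_left add_0_right add.assoc)
qed

text \<open>The right-hand side of the equation for \<open>dA\<close> on words. On elements of \<open>V\<close> it depends on \<open>b\<close>
  only, and on pairs it involves \<open>a\<close> only through its values on elements of \<open>V\<^sub>0\<close>; so the equation
  can be integrated step by step.\<close>

lemma curvature_at_1_words:
  fixes a b :: "('a, 'b, 'c, 'd) conv"
  assumes a: "a \<in> conv_deg V W (- 1)" and b: "b \<in> conv_deg V W 0"
  defines "E \<equiv> conv_diff V W 0 b - cup 0 a b + cup (- 1) b a"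
  shows "E [Inl x] = (l1 W (snd (b [Inl x])), 0)"
    and "E [Inr h] = (0, snd (b [Inl (l1 V h)]))"
    and "E [Inl x, Inl y] = (0, snd (b [Inl (l2_00 V x y)]) - l2_01 W (fst (a [Inl x])) (snd (b [Inl y])) -
       l2_10 W (snd (b [Inl x])) (fst (a [Inl y])))"
    and "wdeg w \<noteq> 1 \<Longrightarrow> wdeg w \<noteq> 2 \<Longrightarrow> E w = 0"
proof -
  have b0: "fst (b w) = 0" for w using conv_deg_fst_0[OF b] by simp
  have b1: "wdeg w \<noteq> 1 \<Longrightarrow> snd (b w) = 0" for w using conv_degD(3)[OF b] by auto
  have a0: "wdeg w \<noteq> 1 \<Longrightarrow> fst (a w) = 0" for w using conv_degD(2)[OF a] by auto
  show "E [Inl x] = (l1 W (snd (b [Inl x])), 0)"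
    by (simp add: E_def word_simps prod_eq_iff)
  show "E [Inr h] = (0, snd (b [Inl (l1 V h)]))"
    using b1[of "[Inr h]"] b0 by (simp add: E_def word_simps prod_eq_iff)
  show "E [Inl x, Inl y] = (0, snd (b [Inl (l2_00 V x y)]) - l2_01 W (fst (a [Inl x])) (snd (b [Inl y])) -
       l2_10 W (snd (b [Inl x])) (fst (a [Inl y])))"
    using b1[of "[Inl x, Inl y]"] b0 by (simp add: E_def word_simps prod_eq_iff)
  assume w: "wdeg w \<noteq> 1" "wdeg w \<noteq> 2"
  have "conv_diff V W 0 b w = 0"
    by (rule conv_diff_apply_0) (use w b0 b1 in \<open>auto simp: prod_eq_iff\<close>)
  moreover have "cup 0 a b w = 0"
  proof (rule cup_apply_0)
    fix u v :: "('a, 'b) word" assume "wdeg u + wdeg v = wdeg w"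
    then have "fst (a u) = 0 \<or> snd (b v) = 0" using w a0[of u] b1[of v] by fastforce
    then show "ops W [a u, b v] = 0" using b0 by (auto simp: prod_eq_iff)
  qed
  moreover have "cup (- 1) b a w = 0"
  proof (rule cup_apply_0)
    fix u v :: "('a, 'b) word" assume "wdeg u + wdeg v = wdeg w"
    then have "fst (a v) = 0 \<or> snd (b u) = 0" using w a0[of v] b1[of u] by fastforce
    then show "ops W [b u, a v] = 0" using b0 by (auto simp: prod_eq_iff)
  qed
  ultimately show "E w = 0" by (simp add: E_def)
qed

text \<open>In form degree 0 this is that \<open>shift\<close> yields infinity morphisms, in degree 1 the differential
  equation, and in higher degree \<open>d d\<beta> = 0\<close>.\<close>

lemma lift_MC:
  assumes g: "infinity_morphism V W g" and \<beta>: "\<beta> \<in> conv0_functions V W n"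
  shows "lift g \<beta> \<in> MC_simplex V W n"
proof -
  let ?\<alpha> = "lift g \<beta>"
  interpret g: infinity_morphism V W g by fact
  have \<alpha>: "?\<alpha> \<in> convf_deg V W n (- 1)" by (rule lift_convf_deg[OF g \<beta>])
  have deg0: "pair \<xi> \<beta> \<in> conv_deg V W 0" if "\<And>b. \<xi> b \<noteq> 0 \<Longrightarrow> snd b = {}" for \<xi>
    using convf_degD(1)[OF conv0_functionsD(1)[OF \<beta>]] that
    by (intro conv_deg_pair) (metis add_0_right card.empty fdeg_def of_nat_0)
  have at0: "pair (coeff_at T {}) (mc_curvature V W ?\<alpha>) = 0" for T
    unfolding curvature_at_0[OF \<alpha>] lift_at_0[OF \<beta>]
    by (intro infinity_morphism_curvature infinity_morphism_shift g conv_deg_hom_linear[of _ 0] deg0)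
      (simp add: coeff_at_def split: if_splits)
  have at1: "pair (coeff_at T {k}) (mc_curvature V W ?\<alpha>) = 0" for T k
  proof -
    define b where "b = pair (coeff_at T {}) \<beta>"
    define b' where "b' = pair (deriv_coeff T k) \<beta>"
    define a where "a = mc_of (shift g (\<lambda>x. snd (b [Inl x])))"
    have b: "b \<in> conv_deg V W 0" and b': "b' \<in> conv_deg V W 0"
      unfolding b_def b'_def by (rule deg0, simp add: coeff_at_def deriv_coeff_eq split: if_splits)+
    have "infinity_morphism V W (shift g (\<lambda>x. snd (b [Inl x])))"
      by (rule infinity_morphism_shift[OF g conv_deg_hom_linear[OF b]])
    then have a: "a \<in> conv_deg V W (- 1)"
      unfolding a_def infinity_morphism_def by (intro mc_of_conv_deg) auto
    let ?E = "conv_diff V W 0 b' - cup 0 a b' + cup (- 1) b' a"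
    have "?E w = (lin_part g b' + quad_part b' b + quad_part b b') w" for w
    proof (cases w rule: word_cases)
      case (V0 x)
      then show ?thesis using curvature_at_1_words(1)[OF a b']
        by (simp add: lin_part_def quad_part_def prod_eq_iff)
    next
      case (V1 h)
      then show ?thesis using curvature_at_1_words(2)[OF a b']
        by (simp add: lin_part_def quad_part_def prod_eq_iff)
    next
      case (V00 x y)
      then show ?thesis using curvature_at_1_words(3)[OF a b']
        by (simp add: lin_part_def quad_part_def prod_eq_iff a_def shift_def W.ax_b)
    next
      case other
      then show ?thesis using curvature_at_1_words(4)[OF a b' other(2,3)]
        by (simp add: lin_part_def quad_part_def)
    qed
    then have "?E = lin_part g b' + quad_part b' b + quad_part b b'" by blast
    moreover have "pair (coeff_at T {k}) (mc_curvature V W ?\<alpha>) =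
      conv_diff V W 0 b' - (lin_part g b' + quad_part b' b + quad_part b b') - cup 0 a b' + cup (- 1) b' a"
      unfolding curvature_at_1[OF \<alpha>] lift_at_0[OF \<beta>] lift_at_1[OF \<beta>] deriv_coeff_def[symmetric] lift_derivative[OF \<beta>]
      by (simp only: a_def b_def b'_def)
    ultimately show ?thesis by (simp only: diff_rearrange diff_self)
  qed
  have "lookup (mc_curvature V W ?\<alpha>) b = 0" for b
  proof -
    consider "snd b = {}" | k where "snd b = {k}" | "high b" unfolding high_def by blast
    then show ?thesis
    proof cases
      case 1
      then show ?thesis
        using separation_pairing[OF L.vector_space_axioms, of "{}" "mc_curvature V W ?\<alpha>" 0 b] at0 by simp
    next
      case (2 k)
      then show ?thesis
        using separation_pairing[OF L.vector_space_axioms, of "{k}" "mc_curvature V W ?\<alpha>" 0 b] at1 by simp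
    next
      case 3
      let ?\<xi> = "\<lambda>c. of_bool (c = b) :: 'k"
      have "lookup (mc_curvature V W ?\<alpha>) b = pair (\<lambda>c. lin_ext (*) ?\<xi> (d_mono c)) ?\<alpha>"
        using curvature_high[OF \<alpha>, of ?\<xi>] 3 by (simp add: L.pairing_indicator split: if_splits)
      also have "\<dots> = pair (\<lambda>c. lin_ext (*) (\<lambda>c. lin_ext (*) ?\<xi> (d_mono c)) (d_mono c)) \<beta>"
      proof (rule lift_positive[OF \<beta>])
        fix c :: mono_form
        assume c: "lin_ext (*) ?\<xi> (d_mono c) \<noteq> 0"
        show "snd c \<noteq> {}"
        proof
          assume "snd c = {}"
          then have "d_mono c \<in> forms_on UNIV 1" using forms_on_d_mono_fdeg[of c] by (simp add: fdeg_def)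
          then have "lin_ext (*) ?\<xi> (d_mono c) = 0"
            by (rule high_lin_ext_0) (use 3 in \<open>auto split: if_splits\<close>)
          with c show False by simp
        qed
      qed
      also have "\<dots> = 0"
        unfolding pairing_def by (rule sum.neutral) (use conv0_functionsD(2)[OF \<beta>] in \<open>auto simp: d_mono_d_mono\<close>)
      finally show ?thesis .
    qed
  qed
  then have "mc_curvature V W ?\<alpha> = 0" by (intro poly_mapping_eqI) simp
  then show ?thesis using \<alpha> by (simp add: MC_simplex_def)
qed

end

section \<open>Uniqueness of the lift\<close>

lemma eq_of_zero_diff: "0 = x - y \<Longrightarrow> y = (x :: 'z::ab_group_add)"
  by simp

context convolution
begin

lemma lookup_eqI:
  fixes \<alpha> \<alpha>' :: "('a, 'b, 'c, 'd) convf"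
  assumes "\<And>T. pair (coeff_at T I) \<alpha> = pair (coeff_at T I) \<alpha>'" "snd b = I"
  shows "lookup \<alpha> b = lookup \<alpha>' b"
  by (rule separation_pairing[OF L.vector_space_axioms assms])

lemma pair_dform:
  fixes P :: "('a, 'b, 'c, 'd) convf"
  shows "pair \<xi> (form_ext W 0 0 d_mono P) = pair (\<lambda>b. lin_ext (*) \<xi> (d_mono b)) P"
  by (simp add: pair_form_ext)

lemma fdeg_le_1:
  assumes \<alpha>: "\<alpha> \<in> convf_deg V W n (- 1)" and b: "b \<in> keys \<alpha>"
  shows "snd b = {} \<or> (\<exists>k. snd b = {k})"
proof -
  have "fdeg b < 2"
    using conv_deg_pos[OF convf_degD(1)[OF \<alpha>, of b]] b by (force simp: in_keys_iff)
  then have "\<not> high b" using convf_degD(3)[OF \<alpha> b] by (simp add: high_iff)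
  then show ?thesis by (auto simp: high_def)
qed

lemma h_op_off_functions:
  assumes \<alpha>: "\<alpha> \<in> convf_deg V W n (- 1)" and "snd b \<noteq> {}"
  shows "lookup (h_op W i (- 1) \<alpha>) b = 0"
proof -
  have "lin_ext (*) (\<lambda>c. of_bool (c = b) :: 'k) (h_mono i c) = 0" if c: "c \<in> keys \<alpha>" for c
  proof (rule lin_ext_eq_0)
    fix e :: mono_form assume e: "e \<in> keys (h_mono i c :: 'k form)"
    have "fdeg c - 1 = 0" using fdeg_le_1[OF \<alpha> c] by (auto simp: fdeg_def)
    then have "h_mono i c \<in> (forms_on {1..n} 0 :: 'k form set)"
      using h_mono_forms_on(1)[OF convf_degD(2)[OF \<alpha> c]] by metis
    then have "snd e = {}" using e by (auto simp: forms_on_def)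
    then show "(of_bool (e = b) :: 'k) = 0" using assms(2) by auto
  qed
  then have "pair (\<lambda>c. (- 1) powi (1 * (coeff_deg c)) * lin_ext (*) (\<lambda>c. of_bool (c = b) :: 'k) (h_mono i c)) \<alpha> = pair (\<lambda>c. 0) \<alpha>"
    by (intro L.pairing_cong) simp
  then show ?thesis
    unfolding L.pairing_indicator[symmetric] h_op_def pair_form_ext by simp
qed

text \<open>The operator \<open>h\<close> kills functions, hence sees only the 1-form part \<open>dP\<close> of \<open>\<alpha>\<close>, where
  \<open>h(dP) = P - P(e\<^sub>i)\<close>.\<close>

lemma h_op_exact:
  assumes \<alpha>: "\<alpha> \<in> convf_deg V W n (- 1)" and P: "P \<in> conv0_functions V W n"
    and exact: "\<And>T k. pair (coeff_at T {k}) \<alpha> = pair (deriv_coeff T k) P"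
  shows "pair (coeff_at T {}) (h_op W i (- 1) \<alpha>) = pair (coeff_at T {}) P - eval_vertex W i P"
proof -
  let ?dP = "form_ext W 0 0 d_mono P :: ('a, 'b, 'c, 'd) convf"
  define \<mu> :: "mono_form \<Rightarrow> 'k" where "\<mu> b = (if \<exists>k. snd b = {k} then ev T {} (h_mono i b) else 0)" for b
  have "pair (coeff_at T {}) (h_op W i (- 1) \<alpha>) = pair \<mu> \<alpha>"
    unfolding h_op_def pair_form_ext
  proof (rule L.pairing_cong)
    fix b assume b: "b \<in> keys \<alpha>"
    have "(h_mono i b :: 'k form) = 0" if "snd b = {}"
      using h_mono_forms_on(2)[OF convf_degD(2)[OF \<alpha> b]] that by (simp add: fdeg_def)
    then show "(- 1) powi (1 * (coeff_deg b)) * lin_ext (*) (coeff_at T {}) (h_mono i b) = \<mu> b"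
      using fdeg_le_1[OF \<alpha> b] by (auto simp: \<mu>_def fdeg_def ev_def)
  qed
  also have "\<dots> = pair \<mu> ?dP"
  proof (rule L.pairing_lookup_cong)
    fix b assume "\<mu> b \<noteq> 0"
    then obtain k where k: "snd b = {k}" by (auto simp: \<mu>_def split: if_splits)
    have "pair (coeff_at T {k}) \<alpha> = pair (coeff_at T {k}) ?dP" for T
      unfolding exact pair_dform ev_def[symmetric] deriv_coeff_def[abs_def] ..
    then show "lookup \<alpha> b = lookup ?dP b" using k by (rule lookup_eqI)
  qed
  also have "\<dots> = pair (\<lambda>b. lin_ext (*) \<mu> (d_mono b)) P" by (rule pair_dform)
  also have "\<dots> = pair (\<lambda>b. coeff_at T {} b - coeff_at (\<lambda>j. of_bool (j = i)) {} b) P"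
  proof (rule L.pairing_cong)
    fix b assume b: "b \<in> keys P"
    have b0: "snd b = {}" "0 \<notin> keys (fst b)" using conv0_functionsD[OF P] b by fastforce+
    have "d_mono b \<in> (forms_on UNIV 1 :: 'k form set)" using forms_on_d_mono_fdeg[of b] b0 by (simp add: fdeg_def)
    then have "lin_ext (*) \<mu> (d_mono b) = lin_ext (*) (\<lambda>b. ev T {} (h_mono i b)) (d_mono b)"
      by (intro lin_ext_cong) (auto simp: \<mu>_def forms_on_def card_1_singleton_iff)
    also have "\<dots> = mval T (fst b) - eval_mono i (fst b, {})"
      using h_mono_d_mono[OF b0(2), of T i] b0(1) by (metis prod.collapse)
    finally show "lin_ext (*) \<mu> (d_mono b) = coeff_at T {} b - coeff_at (\<lambda>j. of_bool (j = i)) {} b"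
      using b0 by (simp add: eval_mono_eq coeff_at_def)
  qed
  also have "\<dots> = pair (coeff_at T {}) P - eval_vertex W i P"
    unfolding L.pairing_functional_diff eval_vertex_pair ..
  finally show ?thesis .
qed

text \<open>The function \<open>P\<close> is the cone operator of \<open>poincare\<close> applied to the 1-form part. That part is
  closed by \<open>curvature_high\<close>, so the functional \<open>\<xi>\<close> of \<open>poincare\<close> composed with \<open>d\<close> vanishes on it.\<close>

lemma closed_imp_exact:
  assumes \<alpha>: "\<alpha> \<in> MC_simplex V W n"
  shows "\<exists>P \<in> conv0_functions V W n. \<forall>T k. pair (coeff_at T {k}) \<alpha> = pair (deriv_coeff T k) P"
proof -
  have deg: "\<alpha> \<in> convf_deg V W n (- 1)" and mc: "mc_curvature V W \<alpha> = 0"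
    using \<alpha> by (auto simp: MC_simplex_def)
  let ?K = "{b \<in> keys \<alpha>. \<exists>j. snd b = {j}}"
  \<comment> \<open>\<open>\<psi> b\<close> is the cone operator applied to the monomial \<open>b = t\<^sup>a dt\<^sub>J\<close>.\<close>
  define J where "J b = the_elem (snd b)" for b :: mono_form
  define \<psi> :: "mono_form \<Rightarrow> 'k form" where
    "\<psi> b = single (fst b + single (J b) 1, {}) (1 / of_nat (Suc (tot (fst b))))" for b
  define P where "P = (\<Sum>b\<in>?K. tensor W (lookup \<alpha> b) (\<psi> b))"
  have K: "keys (fst b) \<subseteq> {1..n}" "J b \<in> {1..n}" "snd b = {J b}" "lookup \<alpha> b \<in> conv_deg V W 0"
    if "b \<in> ?K" for b
    using that convf_degD(2)[OF deg, of b] convf_degD(1)[OF deg, of b] by (auto simp: simplex_basis_def J_def fdeg_def)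
  have summand: "tensor W (lookup \<alpha> b) (\<psi> b) \<in> conv0_functions V W n" if b: "b \<in> ?K" for b
  proof -
    have "keys (fst b + single (J b) 1) \<subseteq> {1..n}"
      using K[OF b] Poly_Mapping.keys_add[of "fst b" "single (J b) 1"] by auto
    then have "tensor W (lookup \<alpha> b) (\<psi> b) \<in> convf_deg V W n 0"
      by (intro tensor_convf_deg[where m = 0]) (use K[OF b] in \<open>auto simp: forms_on_def \<psi>_def\<close>)
    moreover have "fdeg c = 0" if "c \<in> keys (tensor W (lookup \<alpha> b) (\<psi> b))" for c
      using that by (auto simp: in_keys_iff \<psi>_def lookup_single when_def fdeg_def split: if_splits)
    ultimately show ?thesis by (simp add: conv0_functions_def)
  qed
  have "P \<in> convf_deg V W n 0"
    unfolding P_def using summand by (intro convf_deg_sum) (simp add: conv0_functions_def)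
  moreover have "fdeg c = 0" if "c \<in> keys P" for c
    using that Poly_Mapping.keys_sum[of "\<lambda>b. tensor W (lookup \<alpha> b) (\<psi> b)" ?K] summand
    unfolding P_def conv0_functions_def by blast
  ultimately have "P \<in> conv0_functions V W n" by (simp add: conv0_functions_def)
  moreover have "pair (coeff_at T {k}) \<alpha> = pair (deriv_coeff T k) P" for T k
  proof -
    obtain \<xi> :: "mono_form \<Rightarrow> 'k" where \<xi>: "\<And>b. card (snd b) \<noteq> 2 \<Longrightarrow> \<xi> b = 0"
      "\<And>a j. lin_ext (*) \<xi> (d_mono (a, {j})) =
        deriv_mono T k (a + single j 1) / of_nat (Suc (tot a)) - coeff_at T {k} (a, {j})"
      using poincare[of T k] by blast
    have high: "high b" if "\<xi> b \<noteq> 0" for b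
    proof -
      have "card (snd b) = 2" using that \<xi>(1) by blast
      then have "finite (snd b)" by (metis card.infinite zero_neq_numeral)
      then show ?thesis using \<open>card (snd b) = 2\<close> by (simp add: high_iff fdeg_def)
    qed
    have "0 = pair (\<lambda>b. lin_ext (*) \<xi> (d_mono b)) \<alpha>"
      using curvature_high[OF deg high] mc by simp
    also have "\<dots> = (\<Sum>b\<in>?K. conv_scale W (lin_ext (*) \<xi> (d_mono b)) (lookup \<alpha> b))"
      unfolding pairing_def
    proof (rule sum.mono_neutral_right)
      show "\<forall>b\<in>keys \<alpha> - ?K. conv_scale W (lin_ext (*) \<xi> (d_mono b)) (lookup \<alpha> b) = 0"
      proof
        fix b assume b: "b \<in> keys \<alpha> - ?K"
        then have "snd b = {}" using fdeg_le_1[OF deg, of b] by blast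
        then have "d_mono b \<in> (forms_on UNIV 1 :: 'k form set)" using forms_on_d_mono_fdeg[of b] by (simp add: fdeg_def)
        then have "lin_ext (*) \<xi> (d_mono b) = 0" by (rule high_lin_ext_0) (use high in auto)
        then show "conv_scale W (lin_ext (*) \<xi> (d_mono b)) (lookup \<alpha> b) = 0" by simp
      qed
    qed auto
    also have "\<dots> = (\<Sum>b\<in>?K. conv_scale W (lin_ext (*) (deriv_coeff T k) (\<psi> b) - coeff_at T {k} b) (lookup \<alpha> b))"
    proof (rule sum.cong[OF refl])
      fix b assume b: "b \<in> ?K"
      have "lin_ext (*) \<xi> (d_mono (fst b, {J b})) = lin_ext (*) (deriv_coeff T k) (\<psi> b) - coeff_at T {k} (fst b, {J b})"
        unfolding \<xi>(2) by (simp add: \<psi>_def ev_simps deriv_coeff_eq)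
      moreover have "(fst b, {J b}) = b" using K(3)[OF b] by (metis prod.collapse)
      ultimately show "conv_scale W (lin_ext (*) \<xi> (d_mono b)) (lookup \<alpha> b) =
        conv_scale W (lin_ext (*) (deriv_coeff T k) (\<psi> b) - coeff_at T {k} b) (lookup \<alpha> b)" by simp
    qed
    also have "\<dots> = (\<Sum>b\<in>?K. conv_scale W (lin_ext (*) (deriv_coeff T k) (\<psi> b)) (lookup \<alpha> b))
      - (\<Sum>b\<in>?K. conv_scale W (coeff_at T {k} b) (lookup \<alpha> b))"
      by (simp only: L.scale_left_diff_distrib sum_subtractf)
    also have "(\<Sum>b\<in>?K. conv_scale W (lin_ext (*) (deriv_coeff T k) (\<psi> b)) (lookup \<alpha> b)) = pair (deriv_coeff T k) P"
      unfolding P_def L.pairing_sum pair_tensor ..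
    also have "(\<Sum>b\<in>?K. conv_scale W (coeff_at T {k} b) (lookup \<alpha> b)) = pair (coeff_at T {k}) \<alpha>"
      unfolding pairing_def by (rule sum.mono_neutral_left) (auto simp: coeff_at_def)
    finally show ?thesis by (rule eq_of_zero_diff)
  qed
  ultimately show ?thesis by blast
qed

text \<open>On functions with values in \<open>L\<^sub>0\<close>, the 1-form part of \<open>\<delta> + d\<close> is \<open>d\<close>.\<close>

lemma total_diff_at_1:
  assumes "\<And>b. snd b \<noteq> {} \<Longrightarrow> lookup \<gamma> b = 0"
  shows "pair (coeff_at T {k}) (total_diff V W 0 \<gamma>) = pair (deriv_coeff T k) \<gamma>"
proof -
  have "pair (coeff_at T {k}) \<gamma> = pair (coeff_at T {k}) 0"
    by (rule L.pairing_lookup_cong) (use assms in \<open>auto simp: coeff_at_def split: if_splits\<close>)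
  then have 0: "conv_diff V W (0 + int 1) (pair (coeff_at T {k}) \<gamma>) = 0"
    by (simp only: L.pairing_zero linear_simps(3)[OF linear_conv_diff])
  have "pair (coeff_at T {k}) (total_diff V W 0 \<gamma>) = conv_diff V W (0 + int 1) (pair (coeff_at T {k}) \<gamma>)
    + pair (\<lambda>b. (- 1) powi (- 1 * (0 + int (fdeg b))) * lin_ext (*) (coeff_at T {k}) (d_mono b)) \<gamma>"
    by (rule pair_total_diff) (auto simp: coeff_at_def fdeg_def split: if_splits)
  also have "pair (\<lambda>b. (- 1) powi (- 1 * (0 + int (fdeg b))) * lin_ext (*) (coeff_at T {k}) (d_mono b)) \<gamma> = pair (deriv_coeff T k) \<gamma>"
    by (rule L.pairing_cong) (simp add: ev_def[symmetric] deriv_coeff_def[symmetric] deriv_coeff_eq fdeg_def)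
  finally show ?thesis unfolding 0 by (simp only: add_0_left)
qed

text \<open>Writing the 1-form part as \<open>dP\<close> gives \<open>h\<alpha> = P - P(e\<^sub>i)\<close>, so that \<open>dP = d(h\<alpha>) = d\<beta>\<close>.\<close>

lemma MC_one_forms:
  assumes \<alpha>: "\<alpha> \<in> MC_simplex V W n" and \<beta>: "\<beta> \<in> conv0_functions V W n"
    and eq: "total_diff V W 0 (h_op W i (- 1) \<alpha>) = total_diff V W 0 \<beta>"
  shows "pair (coeff_at T {k}) \<alpha> = pair (deriv_coeff T k) \<beta>"
proof -
  have deg: "\<alpha> \<in> convf_deg V W n (- 1)" using \<alpha> by (simp add: MC_simplex_def)
  obtain P where P: "P \<in> conv0_functions V W n" "\<And>T k. pair (coeff_at T {k}) \<alpha> = pair (deriv_coeff T k) P"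
    using closed_imp_exact[OF \<alpha>] by blast
  \<comment> \<open>\<open>?P\<close> is normalized to vanish at \<open>e\<^sub>i\<close>, as \<open>h\<alpha>\<close> does.\<close>
  let ?\<gamma> = "h_op W i (- 1) \<alpha>" and ?P = "P - tensor W (eval_vertex W i P) form_one"
  have "pair (coeff_at T {}) ?\<gamma> = pair (coeff_at T {}) ?P" for T
    by (simp add: h_op_exact[OF deg P] L.pairing_diff pair_tensor ev_def[symmetric])
  then have look: "lookup ?\<gamma> b = lookup ?P b" if "snd b = {}" for b
    using that by (rule lookup_eqI)
  have "pair (deriv_coeff T k) \<beta> = pair (coeff_at T {k}) (total_diff V W 0 \<beta>)"
    by (rule total_diff_at_1[symmetric]) (use conv0_functionsD(2)[OF \<beta>] in \<open>auto simp: in_keys_iff\<close>)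
  also have "\<dots> = pair (deriv_coeff T k) ?\<gamma>"
    unfolding eq[symmetric] by (rule total_diff_at_1) (rule h_op_off_functions[OF deg])
  also have "\<dots> = pair (deriv_coeff T k) ?P"
    by (rule L.pairing_lookup_cong) (metis look deriv_coeff_eq)
  also have "\<dots> = pair (deriv_coeff T k) P"
    by (simp add: L.pairing_diff pair_tensor deriv_at_deriv_coeff[symmetric])
  finally show ?thesis using P(2) by simp
qed

text \<open>A function with vanishing derivatives is constant, hence zero if it vanishes at a vertex. The
  statement is about the values on a single word because derivatives are controlled word by
  word.\<close>

lemma const_of_deriv_0:
  fixes \<gamma> :: "('a, 'b, 'c, 'd) convf"
  assumes "\<And>T k. pair (deriv_coeff T k) \<gamma> w = 0" and "eval_vertex W i \<gamma> w = 0" and "snd b = {}"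
  shows "lookup \<gamma> b w = 0"
proof -
  have *: "lookup \<gamma> b w = 0" if b: "snd b = {}" and nonconst: "fst b \<noteq> 0" for b
  proof -
    obtain k where k: "lookup (fst b) k \<noteq> 0"
      using nonconst by (metis poly_mapping_eqI lookup_zero)
    \<comment> \<open>By \<open>deriv_mono_mult\<close>, \<open>a\<^sub>k\<close> times the coefficient of \<open>t\<^sup>a\<close> is the coefficient of \<open>t\<^sup>a\<close> in \<open>t\<^sub>k \<partial>\<^sub>k \<gamma>\<close>.\<close>
    have "scl W (of_nat (lookup (fst b) k)) (lookup \<gamma> b w) = 0"
    proof (rule separation[OF W'.vector_space_axioms, of "insert b (keys \<gamma>)" "{}"
          "\<lambda>b. scl W (of_nat (lookup (fst b) k)) (lookup \<gamma> b w)"])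
      fix T :: "nat \<Rightarrow> 'k"
      have "(\<Sum>b\<in>insert b (keys \<gamma>). scl W (coeff_at T {} b) (scl W (of_nat (lookup (fst b) k)) (lookup \<gamma> b w)))
        = (\<Sum>b\<in>insert b (keys \<gamma>). scl W (T k) (scl W (deriv_coeff T k b) (lookup \<gamma> b w)))"
        by (rule sum.cong[OF refl]) (simp add: deriv_coeff_eq coeff_at_def deriv_mono_mult mult.commute)
      also have "\<dots> = scl W (T k) ((\<Sum>b\<in>insert b (keys \<gamma>). conv_scale W (deriv_coeff T k b) (lookup \<gamma> b)) w)"
        by (simp only: W'.scale_sum_right[symmetric] sum_fun_apply conv_scale_apply)
      also have "(\<Sum>b\<in>insert b (keys \<gamma>). conv_scale W (deriv_coeff T k b) (lookup \<gamma> b)) = pair (deriv_coeff T k) \<gamma>"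
        by (rule L.pairing_superset[symmetric]) auto
      finally show "(\<Sum>b\<in>insert b (keys \<gamma>). scl W (coeff_at T {} b) (scl W (of_nat (lookup (fst b) k)) (lookup \<gamma> b w))) = 0"
        using assms(1) by simp
    qed (use b in auto)
    then show ?thesis using k by simp
  qed
  show ?thesis
  proof (cases "fst b = 0")
    case True
    then have b: "b = (0, {})" using assms(3) by (metis prod.collapse)
    have "eval_vertex W i \<gamma> w = (\<Sum>c\<in>insert b (keys \<gamma>). scl W (coeff_at (\<lambda>j. of_bool (j = i)) {} c) (lookup \<gamma> c w))"
      unfolding eval_vertex_pair by (subst L.pairing_superset[of "insert b (keys \<gamma>)"]) (auto simp: sum_fun_apply)
    also have "\<dots> = (\<Sum>c\<in>{b}. scl W (coeff_at (\<lambda>j. of_bool (j = i)) {} c) (lookup \<gamma> c w))"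
      by (rule sum.mono_neutral_right) (use * b in \<open>auto simp: coeff_at_def prod_eq_iff\<close>)
    also have "\<dots> = lookup \<gamma> b w" by (simp add: b coeff_at_def)
    finally show ?thesis using assms(2) by simp
  qed (use * assms(3) in auto)
qed

lemma pair_coeff_at_conv_deg:
  assumes "\<alpha> \<in> convf_deg V W n k"
  shows "pair (coeff_at T I) \<alpha> \<in> conv_deg V W (k + int (card I))"
proof (rule conv_deg_pair)
  fix b assume "coeff_at T I b \<noteq> 0"
  then have "fdeg b = card I" by (auto simp: coeff_at_def fdeg_def split: if_splits)
  then show "lookup \<alpha> b \<in> conv_deg V W (k + int (card I))"
    using convf_degD(1)[OF assms, of b] by simp
qed

lemma MC_derivative:
  assumes "\<alpha> \<in> MC_simplex V W n"
  shows "pair (deriv_coeff T k) \<alpha> = conv_diff V W 0 (pair (coeff_at T {k}) \<alpha>)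
    - cup 0 (pair (coeff_at T {}) \<alpha>) (pair (coeff_at T {k}) \<alpha>)
    + cup (- 1) (pair (coeff_at T {k}) \<alpha>) (pair (coeff_at T {}) \<alpha>)"
proof -
  have deg: "\<alpha> \<in> convf_deg V W n (- 1)" and mc: "mc_curvature V W \<alpha> = 0"
    using assms by (auto simp: MC_simplex_def)
  show ?thesis
    using curvature_at_1[OF deg, of T k] unfolding mc L.pairing_zero deriv_coeff_def[symmetric] diff_rearrange
    by (rule eq_of_zero_diff)
qed

text \<open>Both elements satisfy the same equation for \<open>dA\<close>. It determines \<open>A\<close> first on elements of \<open>V\<close> and
  then, with these values inserted, on pairs of elements of \<open>V\<^sub>0\<close>.\<close>

lemma MC_unique:
  assumes \<alpha>: "\<alpha> \<in> MC_simplex V W n" and \<alpha>': "\<alpha>' \<in> MC_simplex V W n"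
    and one: "\<And>T k. pair (coeff_at T {k}) \<alpha> = pair (coeff_at T {k}) \<alpha>'"
    and eval: "eval_vertex W i \<alpha> = eval_vertex W i \<alpha>'"
  shows "\<alpha> = \<alpha>'"
proof -
  have deg: "\<alpha> \<in> convf_deg V W n (- 1)" "\<alpha>' \<in> convf_deg V W n (- 1)"
    using \<alpha> \<alpha>' by (auto simp: MC_simplex_def)
  let ?\<gamma> = "\<alpha> - \<alpha>'"
  have ev0: "eval_vertex W i ?\<gamma> w = 0" for w
    using eval by (simp add: eval_vertex_pair L.pairing_diff)
  have a: "pair (coeff_at T {}) \<alpha> \<in> conv_deg V W (- 1)" "pair (coeff_at T {}) \<alpha>' \<in> conv_deg V W (- 1)" for T
    using pair_coeff_at_conv_deg[OF deg(1), of T "{}"] pair_coeff_at_conv_deg[OF deg(2), of T "{}"] by simp_all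
  have b: "pair (coeff_at T {k}) \<alpha>' \<in> conv_deg V W 0" for T k
    using pair_coeff_at_conv_deg[OF deg(2), of T "{k}"] by simp
  note D = MC_derivative[OF \<alpha>, unfolded one] MC_derivative[OF \<alpha>']
  \<comment> \<open>On elements of \<open>V\<close> the equation for \<open>dA\<close> does not involve \<open>A\<close>.\<close>
  have elem0: "lookup ?\<gamma> c [Inl x] = 0" if "snd c = {}" for c x
    by (rule const_of_deriv_0[OF _ ev0 that])
      (simp only: L.pairing_diff minus_apply D curvature_at_1_words(1)[OF a(1) b] curvature_at_1_words(1)[OF a(2) b] diff_self)
  have elem1: "lookup ?\<gamma> c [Inr h] = 0" if "snd c = {}" for c h
    by (rule const_of_deriv_0[OF _ ev0 that])
      (simp only: L.pairing_diff minus_apply D curvature_at_1_words(2)[OF a(1) b] curvature_at_1_words(2)[OF a(2) b] diff_self)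
  \<comment> \<open>With these values known, the equations on pairs agree as well.\<close>
  have same: "pair (coeff_at T {}) \<alpha> [Inl x] = pair (coeff_at T {}) \<alpha>' [Inl x]" for T x
  proof -
    have "pair (coeff_at T {}) ?\<gamma> [Inl x] = 0"
      unfolding pair_apply by (rule sum.neutral) (use elem0 in \<open>auto simp: coeff_at_def\<close>)
    then show ?thesis by (simp add: L.pairing_diff)
  qed
  have pairs: "lookup ?\<gamma> c [Inl x, Inl y] = 0" if "snd c = {}" for c x y
    by (rule const_of_deriv_0[OF _ ev0 that])
      (simp only: L.pairing_diff minus_apply D curvature_at_1_words(3)[OF a(1) b] curvature_at_1_words(3)[OF a(2) b] same diff_self)
  have "lookup \<alpha> c = lookup \<alpha>' c" for c
  proof -
    consider "snd c = {}" | k where "snd c = {k}" | "snd c \<noteq> {}" "\<And>k. snd c \<noteq> {k}" by blast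
    then show ?thesis
    proof cases
      case 1
      have deg': "lookup \<alpha> c \<in> conv_deg V W (- 1)" "lookup \<alpha>' c \<in> conv_deg V W (- 1)"
        using convf_degD(1)[OF deg(1), of c] convf_degD(1)[OF deg(2), of c] 1 by (simp_all add: fdeg_def)
      have "lookup \<alpha> c w = lookup \<alpha>' c w" for w
      proof (cases w rule: word_cases)
        case (V0 x)
        then show ?thesis using elem0[OF 1, of x] by (simp add: lookup_minus)
      next
        case (V1 h)
        then show ?thesis using elem1[OF 1, of h] by (simp add: lookup_minus)
      next
        case (V00 x y)
        then show ?thesis using pairs[OF 1, of x y] by (simp add: lookup_minus)
      next
        case other
        then show ?thesis using conv_degD(2,3)[OF deg'(1), of w] conv_degD(2,3)[OF deg'(2), of w] by (simp add: prod_eq_iff)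
      qed
      then show ?thesis by blast
    next
      case (2 k)
      then show ?thesis using one lookup_eqI by blast
    next
      case 3
      then have "c \<notin> keys \<alpha>" "c \<notin> keys \<alpha>'"
        using fdeg_le_1[OF deg(1), of c] fdeg_le_1[OF deg(2), of c] by blast+
      then show ?thesis by (simp add: in_keys_iff)
    qed
  qed
  then show ?thesis by (intro poly_mapping_eqI) simp
qed

lemma h_op_lift:
  assumes g: "infinity_morphism V W g" and \<beta>: "\<beta> \<in> conv0_functions V W n" and "eval_vertex W i \<beta> = 0"
  shows "h_op W i (- 1) (lift g \<beta>) = \<beta>"
proof (rule poly_mapping_eqI)
  fix b
  have deg: "lift g \<beta> \<in> convf_deg V W n (- 1)" by (rule lift_convf_deg[OF g \<beta>])
  show "lookup (h_op W i (- 1) (lift g \<beta>)) b = lookup \<beta> b"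
  proof (cases "snd b = {}")
    case True
    show ?thesis
      by (rule lookup_eqI[OF _ True]) (simp only: h_op_exact[OF deg \<beta> lift_at_1[OF \<beta>]] assms(3) diff_zero)
  next
    case False
    then show ?thesis
      using h_op_off_functions[OF deg False] conv0_functionsD(2)[OF \<beta>, of b] by (auto simp: in_keys_iff)
  qed
qed

lemma eval_vertex_lift:
  assumes \<beta>: "\<beta> \<in> conv0_functions V W n" and "eval_vertex W i \<beta> = 0"
  shows "eval_vertex W i (lift g \<beta>) = mc_of g"
proof -
  have "quad_part 0 0 = 0" by (rule linear_simps(3)[OF linear_quad_part(1)])
  then have "mc_of (shift g (\<lambda>x. snd ((0 :: ('a, 'b, 'c, 'd) conv) [Inl x]))) = mc_of g"
    unfolding mc_of_shift[symmetric] by (simp add: lin_part_0)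
  then show ?thesis
    using assms(2) unfolding eval_vertex_pair lift_at_0[OF \<beta>] by simp
qed

lemma mc_lift_eq_lift:
  assumes g: "infinity_morphism V W g" and \<beta>: "\<beta> \<in> conv0_functions V W n" and 0: "eval_vertex W i \<beta> = 0"
  shows "mc_lift V W n i (mc_of g) (total_diff V W 0 \<beta>) = lift g \<beta>"
  unfolding mc_lift_def
proof (rule the_equality)
  show "lift g \<beta> \<in> MC_simplex V W n \<and> eval_vertex W i (lift g \<beta>) = mc_of g \<and>
    total_diff V W 0 (h_op W i (- 1) (lift g \<beta>)) = total_diff V W 0 \<beta>"
    by (simp add: lift_MC[OF g \<beta>] eval_vertex_lift[OF \<beta> 0] h_op_lift[OF g \<beta> 0])
  fix \<alpha> assume \<alpha>: "\<alpha> \<in> MC_simplex V W n \<and> eval_vertex W i \<alpha> = mc_of g \<and>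
    total_diff V W 0 (h_op W i (- 1) \<alpha>) = total_diff V W 0 \<beta>"
  then have "pair (coeff_at T {k}) \<alpha> = pair (coeff_at T {k}) (lift g \<beta>)" for T k
    unfolding lift_at_1[OF \<beta>] by (intro MC_one_forms[OF _ \<beta>]) auto
  then show "\<alpha> = lift g \<beta>"
    by (intro MC_unique[OF _ lift_MC[OF g \<beta>], of \<alpha> i]) (use \<alpha> eval_vertex_lift[OF \<beta> 0] in auto)
qed

section \<open>Edges of the 2-simplex and the composite\<close>

abbreviation edge :: "nat \<Rightarrow> nat \<Rightarrow> nat \<Rightarrow> 'k form" where
  "edge p q \<equiv> simplicial_map 1 (\<lambda>k. if k = 0 then p else q)"

lemma pair_restrict_edge:
  fixes \<alpha> :: "('a, 'b, 'c, 'd) convf"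
  shows "pair \<xi> (restrict_edge W p q \<alpha>) = pair (\<lambda>b. lin_ext (*) \<xi> (pull_mono (edge p q) b)) \<alpha>"
  by (simp add: restrict_edge_def pair_form_ext)

lemma forms_on_pull_edge:
  assumes "finite (snd b)"
  shows "pull_mono (edge p q) b \<in> forms_on {1..1} (fdeg b)"
proof -
  have "pull_mono (edge p q) (fst b, snd b) \<in> forms_on {1..1} (card (snd b))"
    by (rule forms_on_pull_mono[OF forms_on_simplicial_map assms])
  then show ?thesis by (simp only: prod.collapse fdeg_def)
qed

lemma restrict_edge_convf_deg:
  assumes "\<alpha> \<in> convf_deg V W n k"
  shows "restrict_edge W p q \<alpha> \<in> convf_deg V W 1 k"
  unfolding restrict_edge_def form_ext_def
proof (rule convf_deg_sum)
  fix b assume "b \<in> keys \<alpha>"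
  then show "tensor W (conv_scale W ((- 1) powi (0 * (0 + int (fdeg b)))) (lookup \<alpha> b)) (pull_mono (edge p q) b)
      \<in> convf_deg V W 1 k"
    by (intro tensor_convf_deg[where m = "fdeg b"] forms_on_pull_edge conv_deg_scale convf_degD[OF assms])
qed

lemma restrict_edge_conv0_functions:
  assumes \<beta>: "\<beta> \<in> conv0_functions V W n"
  shows "restrict_edge W p q \<beta> \<in> conv0_functions V W 1"
proof -
  have "fdeg c = 0" if "c \<in> keys (restrict_edge W p q \<beta>)" for c
  proof (rule ccontr)
    assume c: "fdeg c \<noteq> 0"
    have "lookup (restrict_edge W p q \<beta>) c = pair (\<lambda>b. lin_ext (*) (\<lambda>e. of_bool (e = c)) (pull_mono (edge p q) b)) \<beta>"
      by (simp only: L.pairing_indicator[symmetric] pair_restrict_edge)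
    also have "\<dots> = pair (\<lambda>b. 0) \<beta>"
    proof (rule L.pairing_cong, rule lin_ext_eq_0)
      fix b and e :: mono_form
      assume "b \<in> keys \<beta>" and e: "e \<in> keys (pull_mono (edge p q) b)"
      then have "snd b = {}" using conv0_functionsD(2)[OF \<beta>] by blast
      then have "fdeg e = 0" using forms_on_pull_edge[of b p q] e by (auto simp: forms_on_def fdeg_def)
      then show "(of_bool (e = c) :: 'k) = 0" using c by auto
    qed
    finally show False using that by (simp add: in_keys_iff)
  qed
  then show ?thesis
    using restrict_edge_convf_deg[OF conv0_functionsD(1)[OF \<beta>]] by (simp add: conv0_functions_def)
qed

lemma eval_vertex_restrict_edge:
  assumes \<beta>: "\<beta> \<in> conv0_functions V W n"
  shows "eval_vertex W 0 (restrict_edge W p q \<beta>) = eval_vertex W p \<beta>"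
    and "eval_vertex W 1 (restrict_edge W p q \<beta>) = eval_vertex W q \<beta>"
proof -
  have "eval_vertex W i (restrict_edge W p q \<beta>) = eval_vertex W (if i = 0 then p else q) \<beta>" if "i \<le> 1" for i
    unfolding eval_vertex_pair pair_restrict_edge
  proof (rule L.pairing_cong)
    fix b assume b: "b \<in> keys \<beta>"
    show "lin_ext (*) (coeff_at (\<lambda>j. of_bool (j = i)) {}) (pull_mono (edge p q) b) =
      coeff_at (\<lambda>j. of_bool (j = (if i = 0 then p else q)) :: 'k) {} b"
      using conv0_functionsD(2)[OF \<beta> b] that
      by (simp only: ev_def[symmetric] ev_pull_mono_0 ev_simplicial_map_vertex finite.emptyI eq_commute)
  qed
  from this[of 0] this[of 1] show "eval_vertex W 0 (restrict_edge W p q \<beta>) = eval_vertex W p \<beta>"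
    "eval_vertex W 1 (restrict_edge W p q \<beta>) = eval_vertex W q \<beta>" by simp_all
qed

text \<open>Restriction commutes with \<open>d\<close>, so the restricted lift has the 1-form part \<open>dP\<close> for the
  restriction \<open>P\<close> of \<open>\<beta>\<close>, and the constant by which \<open>h\<^sup>0\<close> of it differs from \<open>P\<close> cancels in the
  difference of the vertex values.\<close>

lemma S_op_restrict_lift:
  assumes g: "infinity_morphism V W g" and \<beta>: "\<beta> \<in> conv0_functions V W n"
  shows "S_op W (restrict_edge W p q (lift g \<beta>)) = (\<lambda>x. snd ((eval_vertex W q \<beta> - eval_vertex W p \<beta>) [Inl x]))"
proof -
  let ?\<alpha> = "restrict_edge W p q (lift g \<beta>)" and ?P = "restrict_edge W p q \<beta>"
  have \<alpha>: "?\<alpha> \<in> convf_deg V W 1 (- 1)" by (rule restrict_edge_convf_deg[OF lift_convf_deg[OF g \<beta>]])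
  have P: "?P \<in> conv0_functions V W 1" by (rule restrict_edge_conv0_functions[OF \<beta>])
  have exact: "pair (coeff_at T {k}) ?\<alpha> = pair (deriv_coeff T k) ?P" for T k
  proof -
    have "pair (coeff_at T {k}) ?\<alpha> = pair (\<lambda>b. lin_ext (*) (\<lambda>b. ev T {k} (pull_mono (edge p q) b)) (d_mono b)) \<beta>"
      unfolding pair_restrict_edge ev_def
    proof (rule lift_positive[OF \<beta>])
      fix b :: mono_form
      assume b: "lin_ext (*) (coeff_at T {k}) (pull_mono (edge p q) b) \<noteq> 0"
      show "snd b \<noteq> {}"
      proof
        assume "snd b = {}"
        then have "ev T {k} (pull_mono (edge p q) b) = 0"
          using forms_on_ev_0[OF forms_on_pull_edge[of b p q], of "{k}"] by (simp add: fdeg_def)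
        with b show False by (simp add: ev_def)
      qed
    qed
    also have "\<dots> = pair (\<lambda>b. lin_ext (*) (deriv_coeff T k) (pull_mono (edge p q) b)) \<beta>"
    proof (rule L.pairing_cong)
      fix b assume "b \<in> keys \<beta>"
      then have b: "b = (fst b, {})" using conv0_functionsD(2)[OF \<beta>] by (metis prod.collapse)
      show "lin_ext (*) (\<lambda>b. ev T {k} (pull_mono (edge p q) b)) (d_mono b) =
        lin_ext (*) (deriv_coeff T k) (pull_mono (edge p q) b)"
        using chain_rule[of T k "edge p q" "fst b"] b
        by (simp add: ev_def lin_ext_lin_ext[OF vector_space_mult] deriv_at_deriv_coeff)
    qed
    finally show ?thesis by (simp only: pair_restrict_edge)
  qed
  have "eval_vertex W j (h_op W 0 (- 1) ?\<alpha>) = eval_vertex W j ?P - eval_vertex W 0 ?P" for j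
    unfolding eval_vertex_pair[of j] by (rule h_op_exact[OF \<alpha> P exact])
  then show ?thesis
    by (simp only: S_op_def Let_def eval_vertex_restrict_edge[OF \<beta>] diff_self diff_zero)
qed

lemma desusp_conv_deg:
  assumes "linear_map (scl0 V) (scl1 W) \<theta>"
  shows "desusp \<theta> \<in> conv_deg V W 0"
proof -
  have null: "linear_map (scl0 V) (scl W) (\<lambda>x. (0, 0))" "linear_map (scl1 V) (scl W) (\<lambda>x. (0, 0))"
    using linear_null[OF V.vs0 W.vector_space_scl] linear_null[OF V.vs1 W.vector_space_scl]
    by (simp_all add: zero_prod_def)
  have "linear_map (scl0 V) (scl W) (\<lambda>x. desusp \<theta> (u @ Inl x # w))" for u :: "('a, 'b) word" and w
  proof -
    consider "u = []" "w = []" | "\<And>x. desusp \<theta> (u @ Inl x # w) = (0 :: 'c, 0 :: 'd)"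
      by (cases "(\<theta>, u @ Inl undefined # w)" rule: desusp.cases) (auto simp: append_eq_Cons_conv Cons_eq_append_conv)
    then show ?thesis by cases (auto intro: linear_inj assms null)
  qed
  moreover have "desusp \<theta> (u @ Inr h # w) = (0 :: 'c, 0 :: 'd)" for u w :: "('a, 'b) word" and h
    by (cases "(\<theta>, u @ Inr h # w)" rule: desusp.cases) (auto simp: append_eq_Cons_conv Cons_eq_append_conv)
  moreover have "fst (desusp \<theta> w :: 'c \<times> 'd) = 0 \<and> (wdeg w \<noteq> 1 \<longrightarrow> snd (desusp \<theta> w :: 'c \<times> 'd) = 0)" for w :: "('a, 'b) word"
    by (cases "(\<theta>, w)" rule: desusp.cases) simp_all
  ultimately show ?thesis using null by (auto simp: conv_deg_def zero_prod_def)
qed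

text \<open>The affine function \<open>- t\<^sub>0 \<theta>s\<^sup>-\<^sup>1 + t\<^sub>2 \<tau>s\<^sup>-\<^sup>1\<close> has the required values at the vertices.\<close>

lemma exists_extension:
  assumes \<theta>: "linear_map (scl0 V) (scl1 W) \<theta>" and \<tau>: "linear_map (scl0 V) (scl1 W) \<tau>"
  shows "\<exists>\<beta> \<in> conv0_functions V W 2. eval_vertex W 0 \<beta> = - desusp \<theta> \<and> eval_vertex W 1 \<beta> = 0 \<and>
    eval_vertex W 2 \<beta> = desusp \<tau>"
proof -
  \<comment> \<open>This is \<open>- t\<^sub>0\<close>.\<close>
  let ?t0 = "coord 1 + coord 2 - form_one :: 'k form"
  let ?F = "desusp \<theta> :: ('a, 'b, 'c, 'd) conv" and ?G = "desusp \<tau> :: ('a, 'b, 'c, 'd) conv"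
  define \<beta> where "\<beta> = tensor W ?F ?t0 + tensor W ?G (coord 2)"
  have t0: "?t0 \<in> forms_on {1..2} 0" and t2: "(coord 2 :: 'k form) \<in> forms_on {1..2} 0"
    by (auto intro!: forms_on_diff forms_on_add forms_on_coord forms_on_form_one)
  have deg: "tensor W ?F ?t0 \<in> convf_deg V W 2 0" "tensor W ?G (coord 2) \<in> convf_deg V W 2 0"
    using desusp_conv_deg[OF \<theta>] desusp_conv_deg[OF \<tau>] t0 t2 by (auto intro!: tensor_convf_deg[where m = 0])
  have "fdeg b = 0" if "b \<in> keys \<beta>" for b
  proof (rule ccontr)
    assume "fdeg b \<noteq> 0"
    then have "card (snd b) \<noteq> 0" by (simp add: fdeg_def)
    then have "lookup ?t0 b = 0" "lookup (coord 2 :: 'k form) b = 0"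
      using forms_on_lookup[OF t0] forms_on_lookup[OF t2] by blast+
    then have "lookup \<beta> b = 0"
      by (simp only: \<beta>_def lookup_add lookup_tensor L.scale_zero_left add_0_right)
    then show False using that by (simp add: in_keys_iff)
  qed
  then have "\<beta> \<in> conv0_functions V W 2"
    using convf_deg_add[OF deg] by (simp add: conv0_functions_def \<beta>_def)
  moreover have "eval_vertex W i \<beta> = conv_scale W (of_bool (1 = i) + of_bool (2 = i) - 1) ?F + conv_scale W (of_bool (2 = i)) ?G" for i
    using ev_form_one[of "\<lambda>j. of_bool (j = i) :: 'k" "{}"] ev_coord[of "\<lambda>j. of_bool (j = i) :: 'k" "{}" 1]
      ev_coord[of "\<lambda>j. of_bool (j = i) :: 'k" "{}" 2]
    by (simp add: \<beta>_def eval_vertex_pair L.pairing_add pair_tensor ev_simps ev_def)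
  ultimately show ?thesis by (intro bexI[of _ \<beta>]) simp_all
qed

end

text \<open>The composite depends on \<open>\<beta>\<close> only through its values at the three vertices, and an extension
  with the prescribed values exists.\<close>

theorem theorem5p5p7:
  fixes V :: "('k::field_char_0, 'a::ab_group_add, 'b::ab_group_add) leibniz2"
    and W :: "('k, 'c::ab_group_add, 'd::ab_group_add) leibniz2"
    and f g h :: "('a, 'b, 'c, 'd) leibniz2_mor"
    and \<theta> \<tau> :: "'a \<Rightarrow> 'd"
  assumes "two_term_leibniz V" and "two_term_leibniz W"
    and "infinity_morphism V W f" and "infinity_morphism V W g" and "infinity_morphism V W h"
    and "\<theta> \<in> homotopies V W f g" and "\<tau> \<in> homotopies V W g h"
  shows "\<forall>\<rho>. is_vertical_composite V W g \<tau> \<theta> \<rho> \<longleftrightarrow> \<rho> = (\<lambda>x. \<tau> x + \<theta> x)"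
proof (intro allI iffI)
  interpret convolution V W using assms by (simp add: convolution_def)
  note g = \<open>infinity_morphism V W g\<close>
  have linear: "Vector_Spaces.linear (scl0 V) (scl1 W) \<theta>" "Vector_Spaces.linear (scl0 V) (scl1 W) \<tau>"
    using assms by (simp_all add: homotopies_def)
  have composite: "S_op W (restrict_edge W 0 2 (mc_lift V W 2 1 (mc_of g) (total_diff V W 0 \<beta>))) = (\<lambda>x. \<tau> x + \<theta> x)"
    if "\<beta> \<in> conv0_functions V W 2" "eval_vertex W 0 \<beta> = - desusp \<theta>" "eval_vertex W 1 \<beta> = 0" "eval_vertex W 2 \<beta> = desusp \<tau>"
    for \<beta>
    unfolding mc_lift_eq_lift[OF g that(1,3)] S_op_restrict_lift[OF g that(1)] that by simp
  fix \<rho>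
  {
    assume "is_vertical_composite V W g \<tau> \<theta> \<rho>"
    then obtain \<beta> where \<beta>: "\<beta> \<in> conv0_functions V W 2"
      and vertices: "eval_vertex W 0 (restrict_edge W 0 1 \<beta>) = - desusp \<theta>" "eval_vertex W 1 (restrict_edge W 0 1 \<beta>) = 0"
      "eval_vertex W 1 (restrict_edge W 1 2 \<beta>) = desusp \<tau>"
      and \<rho>: "\<rho> = S_op W (restrict_edge W 0 2 (mc_lift V W 2 1 (mc_of g) (total_diff V W 0 \<beta>)))"
      unfolding is_vertical_composite_def by blast
    show "\<rho> = (\<lambda>x. \<tau> x + \<theta> x)"
      unfolding \<rho> by (rule composite[OF \<beta> vertices[unfolded eval_vertex_restrict_edge[OF \<beta>]]])
  next
    assume \<rho>: "\<rho> = (\<lambda>x. \<tau> x + \<theta> x)"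
    obtain \<beta> where \<beta>: "\<beta> \<in> conv0_functions V W 2" "eval_vertex W 0 \<beta> = - desusp \<theta>" "eval_vertex W 1 \<beta> = 0"
      "eval_vertex W 2 \<beta> = desusp \<tau>"
      using exists_extension[OF linear] by blast
    show "is_vertical_composite V W g \<tau> \<theta> \<rho>"
      unfolding is_vertical_composite_def
      by (rule exI[of _ "restrict_edge W 0 1 \<beta>"], rule exI[of _ "restrict_edge W 1 2 \<beta>"], rule exI[of _ \<beta>])
        (simp only: restrict_edge_conv0_functions[OF \<beta>(1)] \<beta> eval_vertex_restrict_edge[OF \<beta>(1)] composite[OF \<beta>] \<rho>)
  }
qed

end
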